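(* Let $T_n=(x_{|i-j|})_{1\le i,j\le n}$ be the random symmetric Toeplitz matrices and $H_n=(y_{i+j})_{1\le i,j\le n}$ the random Hankel matrices built from two independent input sequences $(x_t)_{t\ge 0}$ and $(y_t)_{t\ge 0}$ of real random variables, where the variables of the input sequences are either independent and uniformly bounded, with mean $0$ and variance $1$; or i.i.d. with mean $0$ and variance $1$; or independent with mean $0$ and variance $1$, and with uniformly bounded moments of all orders. Let $T_n\odot H_n=(x_{|i-j|}\,y_{i+j})_{1\le i,j\le n}$ be their Schur-Hadamard (entrywise) product. Then the LSD of $\{n^{-1/2}\,T_n\odot H_n\}$ exists and is the semi-circular law, i.e. the probability distribution on $\mathbb{R}$ with zero odd moments and $2k$-th moment $\frac{1}{k+1}\binom{2k}{k}$ for every $k\ge 1$.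
   Context: Assumptions on an input sequence: (A1) the variables are independent and uniformly bounded, with mean $0$ and variance $1$; (A2) the variables are i.i.d. with mean $0$ and variance $1$; (A3) the variables are independent with mean $0$ and variance $1$, and with uniformly bounded moments of all orders. For an $n\times n$ real symmetric random matrix $A_n$ with eigenvalues $\lambda_1,\dots,\lambda_n$, the empirical spectral distribution (ESD) $F^{A_n}$ is the random distribution function of $\frac1n\sum_{i=1}^n\delta_{\lambda_i}$. A non-random distribution function $F$ is the limiting spectral distribution (LSD) of $\{A_n\}$ if, almost surely, $F^{A_n}(x)\to F(x)$ at all continuity points $x$ of $F$. *)

theory Defs
  imports "HOL-Probability.Probability" "Jordan_Normal_Form.Char_Poly"
begin

definition standardized :: "'a measure \<Rightarrow> ('a \<Rightarrow> real) \<Rightarrow> bool" where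
  "standardized M X \<longleftrightarrow>
     X \<in> borel_measurable M \<and> integrable M X \<and> integrable M (\<lambda>\<omega>. (X \<omega>)\<^sup>2) \<and>
     integral\<^sup>L M X = 0 \<and> integral\<^sup>L M (\<lambda>\<omega>. (X \<omega> - integral\<^sup>L M X)\<^sup>2) = 1"

definition indep_standardized :: "'a measure \<Rightarrow> (nat \<Rightarrow> 'a \<Rightarrow> real) \<Rightarrow> bool" where
  "indep_standardized M x \<longleftrightarrow>
     prob_space.indep_vars M (\<lambda>_. borel) x UNIV \<and> (\<forall>t. standardized M (x t))"

definition assumption_A1 :: "'a measure \<Rightarrow> (nat \<Rightarrow> 'a \<Rightarrow> real) \<Rightarrow> bool" where
  "assumption_A1 M x \<longleftrightarrow>
     indep_standardized M x \<and> (\<exists>B. \<forall>t. AE \<omega> in M. \<bar>x t \<omega>\<bar> \<le> B)"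

definition assumption_A2 :: "'a measure \<Rightarrow> (nat \<Rightarrow> 'a \<Rightarrow> real) \<Rightarrow> bool" where
  "assumption_A2 M x \<longleftrightarrow>
     indep_standardized M x \<and> (\<forall>s t. distr M borel (x s) = distr M borel (x t))"

definition assumption_A3 :: "'a measure \<Rightarrow> (nat \<Rightarrow> 'a \<Rightarrow> real) \<Rightarrow> bool" where
  "assumption_A3 M x \<longleftrightarrow>
     indep_standardized M x \<and>
     (\<forall>k. \<exists>C. \<forall>t. integrable M (\<lambda>\<omega>. \<bar>x t \<omega>\<bar> ^ k) \<and>
                   integral\<^sup>L M (\<lambda>\<omega>. \<bar>x t \<omega>\<bar> ^ k) \<le> C)"

definition input_sequence :: "'a measure \<Rightarrow> (nat \<Rightarrow> 'a \<Rightarrow> real) \<Rightarrow> bool" where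
  "input_sequence M x \<longleftrightarrow> assumption_A1 M x \<or> assumption_A2 M x \<or> assumption_A3 M x"

text \<open>Independence of two sequences as random elements of the product space of real sequences.\<close>

definition indep_sequences ::
    "'a measure \<Rightarrow> (nat \<Rightarrow> 'a \<Rightarrow> real) \<Rightarrow> (nat \<Rightarrow> 'a \<Rightarrow> real) \<Rightarrow> bool" where
  "indep_sequences M x y \<longleftrightarrow>
     prob_space.indep_var M
       (PiM UNIV (\<lambda>_. borel)) (\<lambda>\<omega> t. x t \<omega>) (PiM UNIV (\<lambda>_. borel)) (\<lambda>\<omega> t. y t \<omega>)"

text \<open>Matrix indices start at 0, so entry (i, j) below is entry (i + 1, j + 1) in the usual
  numbering.\<close>

definition toeplitz_mat :: "nat \<Rightarrow> (nat \<Rightarrow> real) \<Rightarrow> real mat" where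
  "toeplitz_mat n a = Matrix.mat n n (\<lambda>(i, j). a (nat \<bar>int i - int j\<bar>))"

definition hankel_mat :: "nat \<Rightarrow> (nat \<Rightarrow> real) \<Rightarrow> real mat" where
  "hankel_mat n b = Matrix.mat n n (\<lambda>(i, j). b ((i + 1) + (j + 1)))"

definition schur_product :: "real mat \<Rightarrow> real mat \<Rightarrow> real mat" where
  "schur_product A B =
     Matrix.mat (dim_row A) (dim_col A) (\<lambda>(i, j). A $$ (i, j) * B $$ (i, j))"

text \<open>The eigenvalues are counted with multiplicity as roots of the characteristic polynomial;
  all of them are real when the matrix is symmetric.\<close>

definition esd :: "real mat \<Rightarrow> real \<Rightarrow> real" where
  "esd A u = real (size (filter_mset (\<lambda>l. l \<le> u) (proots (char_poly A)))) / real (dim_row A)"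

definition has_lsd ::
    "'a measure \<Rightarrow> (nat \<Rightarrow> 'a \<Rightarrow> real mat) \<Rightarrow> (real \<Rightarrow> real) \<Rightarrow> bool" where
  "has_lsd M A F \<longleftrightarrow>
     (\<exists>\<mu>. real_distribution \<mu> \<and> F = cdf \<mu>) \<and>
     (AE \<omega> in M. \<forall>u. isCont F u \<longrightarrow> (\<lambda>n. esd (A n \<omega>) u) \<longlonglongrightarrow> F u)"

definition semicircular_law :: "real measure \<Rightarrow> bool" where
  "semicircular_law \<mu> \<longleftrightarrow>
     real_distribution \<mu> \<and>
     (\<forall>k. integrable \<mu> (\<lambda>u. u ^ k)) \<and>
     (\<forall>k. odd k \<longrightarrow> integral\<^sup>L \<mu> (\<lambda>u. u ^ k) = 0) \<and>
     (\<forall>k\<ge>1. integral\<^sup>L \<mu> (\<lambda>u. u ^ (2 * k)) = real ((2 * k) choose k) / real (k + 1))"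

end

theory Submission
  imports Defs
begin

text \<open>
  The proof is by the method of moments. The trace of a power of the matrix is a sum over closed
  walks, in which an edge \<open>{a, b}\<close> has the weight \<open>x \<bar>a - b\<bar> * y (a + b)\<close>. A walk has nonzero
  expectation only if every Toeplitz index \<open>\<bar>a - b\<bar>\<close> and every Hankel index \<open>a + b\<close> occurs at
  least twice. Call a vertex generic if it satisfies no linear relation with small coefficients
  over the earlier vertices; walks of length \<open>2k\<close> with at most \<open>k\<close> generic vertices are
  negligible in number. If there are \<open>k + 1\<close> of them, then each index occurs exactly twice, and
  linear independence forces the Toeplitz and the Hankel partner of each step to be the same edge,
  so that the walk is a depth first traversal of a plane tree; these are counted by Dyck paths. The
  same argument for pairs of walks bounds the variance by \<open>O(1/n)\<close>, whence almost sure convergence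
  of the moments along the squares \<open>n = j\<^sup>2\<close>.

  The general case follows, since the averages of a Lipschitz function over the spectra of \<open>A\<close> and
  \<open>B\<close> differ by at most a constant times the Frobenius norm of \<open>A - B\<close> divided by \<open>\<surd>n\<close>; this
  allows passing from the matrix of size \<open>n\<close> to its corner of size \<open>\<lfloor>\<surd>n\<rfloor>\<^sup>2\<close> and replacing the
  input sequences by bounded ones, the error being controlled by a law of large numbers.
\<close>

subsection \<open>Generic vertices and tree walks\<close>

text \<open>For a pure Toeplitz or Hankel matrix, two different edges may share an index at the cost
  of one free vertex, and such matchings survive in the limit. In the product a repeated step obeys
  two linear equations at once, one from each factor, and this leaves only the retraced edge.

  Expectations are computed exactly in two cases only: 0 if some index occurs once, 1 for trees. All
  other walks are few, so a uniform bound suffices for them. Pairs of walks cover the means as well,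
  the partner being the walk of length 0, whose sum is \<open>n\<close>.

  A variance of order 1/n is not summable over all sizes, but it is along squares; going down to the
  next square discards O(sqrt n) rows, which is invisible to the normalized Frobenius norm.

  With second moments only, higher traces need not be stable under truncation. Hence the comparison
  of spectra uses Lipschitz functions, sandwiching the indicator of a half-line. The law of large
  numbers is required only as an upper bound up to a constant factor, which lets one argument treat
  identically distributed variables and variables with bounded fourth moments.\<close>

text \<open>The bound 8 only has to exceed the coefficients of the relations between indices that occur.\<close>

definition generic :: "nat set \<Rightarrow> nat \<Rightarrow> bool" where
  "generic U v \<longleftrightarrow> (\<forall>(c::int) f. c \<noteq> 0 \<longrightarrow> \<bar>c\<bar> \<le> 8 \<longrightarrow> (\<forall>u\<in>U. \<bar>f u\<bar> \<le> 8) \<longrightarrow>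
     c * int v \<noteq> (\<Sum>u\<in>U. f u * int u))"

text \<open>Two natural numbers always satisfy some nontrivial integer relation, so independence can
  only mean the absence of relations with small coefficients.\<close>

definition small_indep :: "nat set \<Rightarrow> bool" where
  "small_indep U \<longleftrightarrow> (\<forall>f::nat \<Rightarrow> int. (\<forall>u\<in>U. \<bar>f u\<bar> \<le> 8) \<longrightarrow> (\<Sum>u\<in>U. f u * int u) = 0 \<longrightarrow>
     (\<forall>u\<in>U. f u = 0))"

lemma sum_of_bool_eq_mult:
  "finite U \<Longrightarrow> a \<in> U \<Longrightarrow> (\<Sum>u\<in>U. of_bool (u = a) * int u) = int a"
  by (simp add: of_bool_def if_distrib[of "\<lambda>x. x * _"] sum.delta cong: if_cong)

lemma generic_notin:
  assumes "finite U" "generic U v"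
  shows "v \<notin> U"
proof
  assume "v \<in> U"
  hence "1 * int v = (\<Sum>u\<in>U. of_bool (u = v) * int u)"
    using assms(1) by (simp add: sum_of_bool_eq_mult)
  moreover have "\<bar>of_bool (u = v)\<bar> \<le> (8::int)" for u by (simp add: of_bool_def)
  ultimately show False
    using assms(2)[unfolded generic_def, rule_format, of 1 "\<lambda>u. of_bool (u = v)"] by auto
qed

text \<open>An equation between the index of the step from \<open>p\<close> to \<open>v\<close> and
  that of an older edge \<open>{a, b}\<close>, solved for \<open>v\<close>, has this shape. The
  three vertices may coincide; their coefficients then add up, to at most 3 in absolute
  value.\<close>

lemma generic_relation3:
  assumes "finite U" "generic U v" "a \<in> U" "b \<in> U" "p \<in> U"
    and "\<bar>s1\<bar> \<le> 1" "\<bar>s2\<bar> \<le> 1" "\<bar>s3\<bar> \<le> 1"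
  shows "int v \<noteq> s1 * int p + s2 * int a + s3 * int b"
proof
  assume eq: "int v = s1 * int p + s2 * int a + s3 * int b"
  define f where "f u = s1 * of_bool (u = p) + s2 * of_bool (u = a) + s3 * of_bool (u = b)" for u :: nat
  have "(\<Sum>u\<in>U. f u * int u) = s1 * (\<Sum>u\<in>U. of_bool (u = p) * int u)
      + s2 * (\<Sum>u\<in>U. of_bool (u = a) * int u) + s3 * (\<Sum>u\<in>U. of_bool (u = b) * int u)"
    unfolding sum_distrib_left sum.distrib[symmetric]
    by (intro sum.cong refl) (simp add: f_def algebra_simps)
  also have "\<dots> = s1 * int p + s2 * int a + s3 * int b"
    using assms by (simp only: sum_of_bool_eq_mult)
  finally have "1 * int v = (\<Sum>u\<in>U. f u * int u)" using eq by simp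
  moreover have "\<bar>f u\<bar> \<le> 8" for u
    using assms(6-8) by (auto simp: f_def of_bool_def split: if_splits)
  ultimately show False using assms(2)[unfolded generic_def, rule_format, of 1 f] by simp
qed

lemma small_indep_empty: "small_indep {}"
  by (simp add: small_indep_def)

lemma small_indep_insert:
  assumes "finite U" "small_indep U" "generic U v"
  shows "small_indep (insert v U)"
  unfolding small_indep_def
proof (intro allI impI)
  fix f :: "nat \<Rightarrow> int"
  assume f: "\<forall>u\<in>insert v U. \<bar>f u\<bar> \<le> 8" and 0: "(\<Sum>u\<in>insert v U. f u * int u) = 0"
  have v: "v \<notin> U" using generic_notin assms by blast
  have eq: "(- f v) * int v = (\<Sum>u\<in>U. f u * int u)" using 0 v assms(1) by simp
  have "f v = 0"
  proof (rule ccontr)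
    assume "f v \<noteq> 0"
    with assms(3)[unfolded generic_def, rule_format, of "- f v" f] f eq show False by simp
  qed
  moreover have "\<forall>u\<in>U. f u = 0"
    using assms(2)[unfolded small_indep_def, rule_format, of f] f eq \<open>f v = 0\<close> by simp
  ultimately show "\<forall>u\<in>insert v U. f u = 0" by simp
qed

text \<open>A nongeneric vertex is recovered from its relation by dividing by \<open>c\<close>, and
  each of the \<open>card U + 1\<close> coefficients takes 17 values. What matters is that the bound
  does not involve \<open>n\<close>.\<close>

lemma nongeneric_card:
  assumes "finite U"
  shows "finite {v. \<not> generic U v}" "card {v. \<not> generic U v} \<le> 17 ^ (card U + 1)"
proof -
  define P where "P = {-8..8::int} \<times> (\<Pi>\<^sub>E u\<in>U. {-8..8::int})"
  define g where "g z = nat ((\<Sum>u\<in>U. snd z u * int u) div fst z)" for z :: "int \<times> (nat \<Rightarrow> int)"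
  have sub: "{v. \<not> generic U v} \<subseteq> g ` P"
  proof
    fix v assume "v \<in> {v. \<not> generic U v}"
    then obtain c f where cf: "c \<noteq> 0" "\<bar>c\<bar> \<le> 8" "\<forall>u\<in>U. \<bar>f u\<bar> \<le> 8"
      "c * int v = (\<Sum>u\<in>U. f u * int u)" unfolding generic_def by auto
    have "(\<Sum>u\<in>U. restrict f U u * int u) = c * int v" using cf(4) by simp
    hence "g (c, restrict f U) = v" using cf(1) by (simp add: g_def)
    moreover have "(c, restrict f U) \<in> P" using cf by (auto simp: P_def abs_le_iff)
    ultimately show "v \<in> g ` P" by (metis imageI)
  qed
  have "finite P" using assms by (auto simp: P_def intro!: finite_PiE)
  thus "finite {v. \<not> generic U v}" using sub by (rule_tac finite_subset) auto
  have "card {v. \<not> generic U v} \<le> card P"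
    using sub \<open>finite P\<close> by (meson card_image_le card_mono finite_imageI le_trans)
  also have "card P = 17 ^ (card U + 1)"
    using assms by (simp add: P_def card_cartesian_product card_PiE)
  finally show "card {v. \<not> generic U v} \<le> 17 ^ (card U + 1)" .
qed

lemma sum_generic_ge:
  assumes "finite U" "card U \<le> N"
  shows "real n - 17 ^ Suc N \<le> (\<Sum>v<n. of_bool (generic U v))"
proof -
  have "(\<Sum>v<n. of_bool (generic U v)) = real (card {v \<in> {..<n}. generic U v})"
    by (simp add: of_bool_def sum.If_cases Int_def)
  moreover have "n \<le> card {v \<in> {..<n}. generic U v} + card {v. \<not> generic U v}"
  proof -
    have "card {..<n} \<le> card ({v \<in> {..<n}. generic U v} \<union> {v. \<not> generic U v})"
      using nongeneric_card(1)[OF assms(1)] by (intro card_mono) auto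
    also have "\<dots> \<le> card {v \<in> {..<n}. generic U v} + card {v. \<not> generic U v}" by (rule card_Un_le)
    finally show ?thesis by simp
  qed
  moreover have "card {v. \<not> generic U v} \<le> 17 ^ Suc N"
  proof -
    have "(17::nat) ^ (card U + 1) \<le> 17 ^ Suc N" using assms(2) by (intro power_increasing) auto
    thus ?thesis by (rule order.trans[OF nongeneric_card(2)[OF assms(1)]])
  qed
  ultimately have "n \<le> card {v \<in> {..<n}. generic U v} + 17 ^ Suc N"
    "(\<Sum>v<n. of_bool (generic U v)) = real (card {v \<in> {..<n}. generic U v})" by linarith+
  hence "real n \<le> (\<Sum>v<n. of_bool (generic U v)) + real (17 ^ Suc N)"
    by (simp only: of_nat_add[symmetric] of_nat_le_iff)
  thus ?thesis by simp
qed

section \<open>Counting vertex lists by the number of generic entries\<close>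

fun gencount :: "nat set \<Rightarrow> nat list \<Rightarrow> nat" where
  "gencount U [] = 0"
| "gencount U (v # vs) = of_bool (generic U v) + gencount (insert v U) vs"

lemma gencount_append: "gencount U (xs @ ys) = gencount U xs + gencount (U \<union> set xs) ys"
  by (induction xs arbitrary: U) auto

definition lists_below :: "nat \<Rightarrow> nat \<Rightarrow> nat list set" where
  "lists_below n L = {vs. length vs = L \<and> set vs \<subseteq> {..<n}}"

lemma finite_lists_below [simp]: "finite (lists_below n L)"
  using finite_lists_length_eq[of "{..<n}" L] by (simp add: lists_below_def conj_commute)

lemma lists_below_0 [simp]: "lists_below n 0 = {[]}"
  by (auto simp: lists_below_def)

lemma lists_below_Suc:
  "lists_below n (Suc L) = (\<lambda>(v, vs). v # vs) ` ({..<n} \<times> lists_below n L)"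
  by (force simp: lists_below_def length_Suc_conv image_iff)

lemma sum_lists_below_Suc:
  "(\<Sum>vs\<in>lists_below n (Suc L). f vs) = (\<Sum>v<n. \<Sum>vs\<in>lists_below n L. f (v # vs))"
  unfolding lists_below_Suc
  by (subst sum.reindex) (auto simp: inj_on_def sum.cartesian_product case_prod_beta)

lemma card_lists_below_Suc:
  "card {vs \<in> lists_below n (Suc L). P vs} = (\<Sum>v<n. card {vs \<in> lists_below n L. P (v # vs)})"
proof -
  have *: "card {vs \<in> lists_below n k. Q vs} = (\<Sum>vs\<in>lists_below n k. of_bool (Q vs))" for k Q
    by (simp add: of_bool_def sum.If_cases Int_def)
  show ?thesis unfolding * by (rule sum_lists_below_Suc)
qed

text \<open>Choosing the entries one by one, a generic entry costs a factor \<open>n\<close> and a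
  nongeneric one at most \<open>17 ^ Suc N\<close>; one \<open>N\<close> serves all stages because
  the set of earlier vertices grows by at most one each time. The sum \<open>1 + 17 ^ Suc N\<close>
  per entry pays for both alternatives.\<close>

lemma card_gencount_eq:
  assumes "finite U" "card U + L \<le> N"
  shows "card {vs \<in> lists_below n L. gencount U vs = g} \<le> (1 + 17 ^ Suc N) ^ L * n ^ g"
  using assms
proof (induction L arbitrary: U g)
  case 0
  have "card {vs \<in> lists_below n 0. gencount U vs = g} \<le> card {[]::nat list}"
    by (intro card_mono) auto
  moreover have "{vs \<in> lists_below n 0. gencount U vs = g} = {}" if "g \<noteq> 0" using that by auto
  ultimately show ?case
  proof (cases "g = 0")
    case False
    with \<open>g \<noteq> 0 \<Longrightarrow> _ = {}\<close> have "card {vs \<in> lists_below n 0. gencount U vs = g} = 0"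
      by (simp only: card.empty not_False_eq_True)
    thus ?thesis by (simp only: zero_le)
  qed simp
next
  case (Suc L)
  define C :: nat where "C = 17 ^ Suc N"
  define B where "B = (1 + C) ^ L * n ^ g"
  have ins: "card (insert v U) + L \<le> N" for v
    using Suc.prems card_insert_le_m1[of "Suc (card U)" U v] by auto
  have bad: "card {v. \<not> generic U v} \<le> C"
  proof -
    have "(17::nat) ^ (card U + 1) \<le> 17 ^ Suc N" using Suc.prems(2) by (intro power_increasing) auto
    thus ?thesis unfolding C_def by (rule order.trans[OF nongeneric_card(2)[OF Suc.prems(1)]])
  qed
  \<comment> \<open>The factor \<open>n\<close> stands on the left because \<open>g - 1\<close> as
    an exponent would be wrong for \<open>g = 0\<close>, where no list qualifies.\<close>
  have gen: "card {vs \<in> lists_below n L. gencount U (v # vs) = g} * n \<le> B" if "generic U v" for v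
  proof (cases g)
    case 0
    thus ?thesis using that by simp
  next
    case (Suc g')
    have "card {vs \<in> lists_below n L. gencount (insert v U) vs = g'} \<le> (1 + C) ^ L * n ^ g'"
      unfolding C_def by (rule Suc.IH) (use Suc.prems ins in auto)
    hence "card {vs \<in> lists_below n L. gencount (insert v U) vs = g'} * n \<le> (1 + C) ^ L * n ^ g' * n"
      by (rule mult_right_mono) simp
    thus ?thesis using that Suc by (simp add: B_def mult_ac)
  qed
  have ngen: "card {vs \<in> lists_below n L. gencount U (v # vs) = g} \<le> B" if "\<not> generic U v" for v
    using Suc.IH[of "insert v U" g] Suc.prems ins that by (simp add: B_def C_def)
  let ?c = "\<lambda>v. card {vs \<in> lists_below n L. gencount U (v # vs) = g}"
  have "card {vs \<in> lists_below n (Suc L). gencount U vs = g}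
      = (\<Sum>v<n. ?c v)" by (rule card_lists_below_Suc)
  also have "\<dots> = (\<Sum>v\<in>{..<n} \<inter> {v. generic U v}. ?c v) + (\<Sum>v\<in>{..<n} - {v. generic U v}. ?c v)"
    by (subst sum.Int_Diff[of _ _ "{v. generic U v}"]) auto
  also have "(\<Sum>v\<in>{..<n} \<inter> {v. generic U v}. ?c v) \<le> B"
  proof (cases "n = 0")
    case False
    have "(\<Sum>v\<in>{..<n} \<inter> {v. generic U v}. ?c v) * n = (\<Sum>v\<in>{..<n} \<inter> {v. generic U v}. ?c v * n)"
      by (simp add: sum_distrib_right)
    also have "\<dots> \<le> (\<Sum>v\<in>{..<n} \<inter> {v. generic U v}. B)" by (intro sum_mono gen) auto
    also have "\<dots> \<le> n * B"
      using card_mono[of "{..<n}" "{..<n} \<inter> {v. generic U v}"] by simp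
    finally show ?thesis using False by (simp add: mult.commute)
  qed simp
  also have "(\<Sum>v\<in>{..<n} - {v. generic U v}. ?c v) \<le> (\<Sum>v\<in>{..<n} - {v. generic U v}. B)"
    by (intro sum_mono ngen) auto
  also have "\<dots> \<le> C * B"
  proof -
    have "card ({..<n} - {v. generic U v}) \<le> card {v. \<not> generic U v}"
      using nongeneric_card(1)[OF Suc.prems(1)] by (intro card_mono) auto
    thus ?thesis using bad by (simp add: mult_right_mono)
  qed
  also have "B + C * B = (1 + 17 ^ Suc N) ^ Suc L * n ^ g" by (simp add: B_def C_def algebra_simps)
  finally show ?case by simp
qed

lemma card_gencount_le:
  assumes "n > 0"
  shows "card {vs \<in> lists_below n L. gencount {} vs \<le> g} \<le> (Suc g * (1 + 17 ^ Suc L) ^ L) * n ^ g"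
proof -
  have "{vs \<in> lists_below n L. gencount {} vs \<le> g}
      = (\<Union>h\<le>g. {vs \<in> lists_below n L. gencount {} vs = h})" by auto
  hence "card {vs \<in> lists_below n L. gencount {} vs \<le> g}
      \<le> (\<Sum>h\<le>g. card {vs \<in> lists_below n L. gencount {} vs = h})"
    by (simp add: card_UN_le)
  also have "\<dots> \<le> (\<Sum>h\<le>g. (1 + 17 ^ Suc L) ^ L * n ^ g)"
  proof (intro sum_mono)
    fix h assume "h \<in> {..g}"
    hence "n ^ h \<le> n ^ g" using assms by (intro power_increasing) auto
    moreover have "card {vs \<in> lists_below n L. gencount {} vs = h} \<le> (1 + 17 ^ Suc L) ^ L * n ^ h"
      by (rule card_gencount_eq) auto
    ultimately show "card {vs \<in> lists_below n L. gencount {} vs = h} \<le> (1 + 17 ^ Suc L) ^ L * n ^ g"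
      by (meson le_trans mult_le_mono2)
  qed
  finally show ?thesis by (simp add: algebra_simps)
qed

text \<open>A tree walk explores a plane tree depth first: each step either moves to a generic vertex,
  pushed on the stack \<open>S\<close> of ancestors, or returns to the parent.\<close>

fun tree_walk :: "nat set \<Rightarrow> nat list \<Rightarrow> nat list \<Rightarrow> bool" where
  "tree_walk U S [] \<longleftrightarrow> tl S = []"
| "tree_walk U S (v # vs) \<longleftrightarrow> generic U v \<and> tree_walk (insert v U) (v # S) vs \<or>
     tl S \<noteq> [] \<and> v = hd (tl S) \<and> tree_walk U (tl S) vs"

text \<open>The number of Dyck paths of length \<open>m\<close> from height \<open>s\<close> to 0, each up-step having weight
  \<open>q\<close>.\<close>

fun dyck_weight :: "nat \<Rightarrow> nat \<Rightarrow> real \<Rightarrow> real" where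
  "dyck_weight 0 s q = of_bool (s = 0)"
| "dyck_weight (Suc m) s q = q * dyck_weight m (Suc s) q + (if s = 0 then 0 else dyck_weight m (s - 1) q)"

section \<open>Weighted Dyck paths and Catalan numbers\<close>

lemma dyck_weight_nonneg: "q \<ge> 0 \<Longrightarrow> dyck_weight m s q \<ge> 0"
  by (induction m arbitrary: s) auto

lemma dyck_weight_vanish: "odd (m + s) \<or> m < s \<Longrightarrow> dyck_weight m s q = 0"
proof (induction m arbitrary: s)
  case (Suc m)
  have "dyck_weight m (Suc s) q = 0" by (rule Suc.IH) (use Suc.prems in auto)
  moreover have "dyck_weight m (s - 1) q = 0" if "s \<noteq> 0"
  proof (rule Suc.IH)
    show "odd (m + (s - 1)) \<or> m < s - 1" using Suc.prems that by (cases s) auto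
  qed
  ultimately show ?case by simp
qed (auto simp: odd_pos)

text \<open>These are the ballot numbers: a path from height \<open>s\<close> to 0 has
  \<open>j\<close> up-steps, and by reflection those that reach -1 are as many as the unrestricted
  paths with \<open>j - 1\<close> up-steps. The proof checks Pascal's rule for the first
  step.\<close>

lemma dyck_weight_ballot:
  "dyck_weight (2 * j + s) s q
    = q ^ j * (real ((2 * j + s) choose j) - (if j = 0 then 0 else real ((2 * j + s) choose (j - 1))))"
proof (induction "2 * j + s" arbitrary: j s)
  case 0
  thus ?case by simp
next
  case (Suc m)
  have down: "dyck_weight m (s - 1) q
    = q ^ j * (real (m choose j) - (if j = 0 then 0 else real (m choose (j - 1))))" if "s > 0"
  proof -
    obtain s' where s: "s = Suc s'" using \<open>s > 0\<close> by (cases s) auto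
    hence m: "m = 2 * j + s'" using Suc.hyps(2) by simp
    show ?thesis using Suc.hyps(1)[OF m] unfolding m[symmetric] s by simp
  qed
  have up: "dyck_weight m (Suc s) q
    = q ^ i * (real (m choose i) - (if i = 0 then 0 else real (m choose (i - 1))))" if "j = Suc i" for i
  proof -
    have m: "m = 2 * i + Suc s" using Suc.hyps(2) that by simp
    show ?thesis using Suc.hyps(1)[OF m] unfolding m[symmetric] .
  qed
  show ?case
  proof (cases j)
    case 0
    hence "dyck_weight m (Suc s) q = 0" using Suc.hyps(2) by (intro dyck_weight_vanish) auto
    thus ?thesis using 0 down Suc.hyps(2)[symmetric] by simp
  next
    case (Suc i)
    note m = Suc.hyps(2)[symmetric]
    define b where "b = (if i = 0 then 0 else real (m choose (i - 1)))"
    have pascal: "real (Suc m choose Suc i) = real (m choose i) + real (m choose Suc i)"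
      "real (Suc m choose i) = real (m choose i) + b"
      unfolding b_def by (simp, cases i, simp_all)
    have up': "dyck_weight m (Suc s) q = q ^ i * (real (m choose i) - b)"
      using up[OF Suc] by (simp only: b_def)
    show ?thesis
    proof (cases "s = 0")
      case True
      have mm: "m = Suc (2 * i)" using m True Suc by simp
      \<comment> \<open>At height 0 the down-step is missing; the term it would contribute,
        \<open>(m choose Suc i) - (m choose i)\<close>, vanishes by symmetry since \<open>m\<close>
        is odd.\<close>
      have "m choose Suc i = m choose i"
        using binomial_symmetric[of i m] mm by simp
      hence *: "real (Suc m choose Suc i) = 2 * real (m choose i)" using pascal(1) by simp
      show ?thesis unfolding m unfolding Suc dyck_weight.simps up' using True *
        by (simp add: pascal(2) algebra_simps del: binomial_Suc_Suc)
    next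
      case False
      have down': "dyck_weight m (s - 1) q
          = q ^ Suc i * (real (m choose Suc i) - real (m choose i))"
        using down False Suc by simp
      show ?thesis unfolding m unfolding Suc dyck_weight.simps up' using False down'
        by (simp add: pascal algebra_simps del: binomial_Suc_Suc)
    qed
  qed
qed

text \<open>The number of Dyck paths of length \<open>h\<close>, hence a Catalan number for even
  \<open>h\<close> and 0 for odd \<open>h\<close>. It is introduced as a count because it arises
  from counting tree walks.\<close>

definition semicircle_moment :: "nat \<Rightarrow> real" where
  "semicircle_moment h = dyck_weight h 0 1"

lemma semicircle_moment_odd: "odd h \<Longrightarrow> semicircle_moment h = 0"
  unfolding semicircle_moment_def by (rule dyck_weight_vanish) simp

text \<open>The ballot formula gives the central binomial coefficient minus its neighbour, and the
  neighbour is \<open>k / (k + 1)\<close> times the central one.\<close>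

lemma semicircle_moment_even:
  "semicircle_moment (2 * k) = real ((2 * k) choose k) / real (k + 1)"
proof (cases k)
  case (Suc i)

  have "(k + 1) * (2 * k choose (k + 1)) = k * (2 * k choose k)"
  proof -
    have "2 * k - k = k" by simp
    with binomial_absorb_comp[of "2 * k" k] have "k * (2 * k choose k) = 2 * k * (2 * k - 1 choose k)"
      by (simp only:)
    thus ?thesis using binomial_absorption[of k "2 * k"] by (simp only: Suc_eq_plus1)
  qed
  moreover have "2 * k choose (k + 1) = 2 * k choose i"
    using binomial_symmetric[of "k + 1" "2 * k"] Suc by simp
  ultimately have eq: "(k + 1) * (2 * k choose i) = k * (2 * k choose k)" by (simp only:)
  have aux: "C - D = C / a" if "a * D = b * C" "a = b + 1" "a \<noteq> 0" for a b C D :: real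
  proof -
    have "a * (C - D) = C" using that(1,2) by (simp add: algebra_simps)
    thus ?thesis using that(3) by (simp add: eq_divide_eq mult.commute)
  qed
  have "real (2 * k choose k) - real (2 * k choose i) = real (2 * k choose k) / real (k + 1)"
  proof (rule aux[where b = "real k"])
    show "real (k + 1) * real (2 * k choose i) = real k * real (2 * k choose k)"
      unfolding of_nat_mult[symmetric] eq ..
  qed (simp_all del: of_nat_Suc)
  moreover have "semicircle_moment (2 * k) = real (2 * k choose k) - real (2 * k choose i)"
    using dyck_weight_ballot[of k 0 1] Suc by (simp add: semicircle_moment_def)
  ultimately show ?thesis by (simp only:)
qed (simp add: semicircle_moment_def)

text \<open>A path from 0 to 0 has \<open>h div 2\<close> up-steps, each of weight
  \<open>q\<close>.\<close>

lemma dyck_weight_homogeneous: "dyck_weight h 0 q = q ^ (h div 2) * semicircle_moment h"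
proof (cases "even h")
  case True
  then obtain j where "h = 2 * j" by blast
  thus ?thesis using dyck_weight_ballot[of j 0] by (simp add: semicircle_moment_def)
qed (simp add: semicircle_moment_odd dyck_weight_vanish)

lemma semicircle_moment_nonneg: "semicircle_moment h \<ge> 0"
  unfolding semicircle_moment_def by (rule dyck_weight_nonneg) simp

text \<open>The height of the stack above the root traces a Dyck path. A push is an up-step with at
  most \<open>n\<close> choices; a return is a down-step whose vertex is forced.\<close>

lemma card_tree_walk_le:
  assumes "S \<noteq> []"
  shows "real (card {vs \<in> lists_below n m. tree_walk U S vs}) \<le> dyck_weight m (length S - 1) (real n)"
  using assms
proof (induction m arbitrary: U S)
  case 0
  have "card {vs \<in> lists_below n 0. tree_walk U S vs} \<le> card {[]::nat list}"
    by (intro card_mono) auto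
  moreover have "{vs \<in> lists_below n 0. tree_walk U S vs} = {}" if "length S - 1 \<noteq> 0"
    using that by (cases S) auto
  ultimately show ?case by (cases "length S - 1 = 0") auto
next
  case (Suc m)
  define D1 where "D1 = dyck_weight m (length S) (real n)"
  define D2 where "D2 = (if tl S = [] then 0 else dyck_weight m (length S - 2) (real n))"
  have D: "D1 \<ge> 0" "D2 \<ge> 0" by (auto simp: D1_def D2_def dyck_weight_nonneg)
  have "real (card {vs \<in> lists_below n m. tree_walk U S (v # vs)}) \<le> D1 + of_bool (v = hd (tl S)) * D2"
    (is "real (card ?A) \<le> _") for v
  proof -
    let ?A1 = "{vs \<in> lists_below n m. tree_walk (insert v U) (v # S) vs}"
    let ?A2 = "{vs \<in> lists_below n m. tl S \<noteq> [] \<and> v = hd (tl S) \<and> tree_walk U (tl S) vs}"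
    have "card ?A \<le> card (?A1 \<union> ?A2)" by (intro card_mono) auto
    also have "\<dots> \<le> card ?A1 + card ?A2" by (rule card_Un_le)
    finally have "real (card ?A) \<le> real (card ?A1) + real (card ?A2)" by linarith
    moreover have "real (card ?A1) \<le> D1" using Suc.IH[of "v # S" "insert v U"] by (simp add: D1_def)
    moreover have "real (card ?A2) \<le> of_bool (v = hd (tl S)) * D2"
    proof (cases "tl S \<noteq> [] \<and> v = hd (tl S)")
      case True
      hence "?A2 = {vs \<in> lists_below n m. tree_walk U (tl S) vs}" by auto
      thus ?thesis using True Suc.IH[of "tl S" U] by (simp add: D2_def numeral_2_eq_2)
    next
      case False
      hence "?A2 = {}" by auto
      thus ?thesis using D by (simp only: card.empty) simp
    qed
    ultimately show ?thesis by linarith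
  qed
  hence "real (card {vs \<in> lists_below n (Suc m). tree_walk U S vs})
      \<le> (\<Sum>v<n. D1 + of_bool (v = hd (tl S)) * D2)"
    unfolding card_lists_below_Suc of_nat_sum by (intro sum_mono)
  also have "\<dots> = real n * D1 + (\<Sum>v<n. of_bool (v = hd (tl S))) * D2"
    by (simp add: sum.distrib sum_distrib_right)
  also have "(\<Sum>v<n. of_bool (v = hd (tl S))) \<le> (1::real)"
    by (simp add: of_bool_def)
  finally have "real (card {vs \<in> lists_below n (Suc m). tree_walk U S vs}) \<le> real n * D1 + D2"
    using D by (simp add: mult_right_mono)
  also have "real n * D1 + D2 = dyck_weight (Suc m) (length S - 1) (real n)"
    using Suc.prems by (cases S; cases "tl S") (auto simp: D1_def D2_def)
  finally show ?case .
qed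

lemma card_tree_walk_ge:
  assumes "S \<noteq> []" "finite U" "card U + m \<le> N" "17 ^ Suc N \<le> n" "set S \<subseteq> U" "set S \<subseteq> {..<n}"
  shows "dyck_weight m (length S - 1) (real n - 17 ^ Suc N)
    \<le> real (card {vs \<in> lists_below n m. tree_walk U S vs})"
  using assms(1-3,5-)
proof (induction m arbitrary: U S)
  case 0
  have "{vs \<in> lists_below n 0. tree_walk U S vs} = {[]}" if "length S - 1 = 0"
    using that by (cases S) auto
  thus ?case by (cases "length S - 1 = 0") auto
next
  case (Suc m)
  define q where "q = real n - 17 ^ Suc N"
  have "real (17 ^ Suc N) \<le> real n" using assms(4) by (simp only: of_nat_le_iff)
  hence q: "q \<ge> 0" by (simp add: q_def)
  define D1 where "D1 = dyck_weight m (length S) q"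
  define D2 where "D2 = (if tl S = [] then 0 else dyck_weight m (length S - 2) q)"
  have D: "D1 \<ge> 0" "D2 \<ge> 0" by (auto simp: D1_def D2_def dyck_weight_nonneg q)
  have ins: "card (insert v U) + m \<le> N" for v
    using Suc.prems card_insert_le_m1[of "Suc (card U)" U v] by auto
  have "of_bool (generic U v) * D1 + of_bool (tl S \<noteq> [] \<and> v = hd (tl S)) * D2
      \<le> real (card {vs \<in> lists_below n m. tree_walk U S (v # vs)})"
    (is "_ \<le> real (card ?A)") if "v < n" for v
  proof -
    have gen: "D1 \<le> real (card ?A)" if "generic U v"
    proof -
      have "D1 \<le> real (card {vs \<in> lists_below n m. tree_walk (insert v U) (v # S) vs})"
        using Suc.IH[of "v # S" "insert v U"] ins Suc.prems \<open>v < n\<close>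
        unfolding D1_def q_def by auto
      also have "\<dots> \<le> real (card ?A)" using that by (intro of_nat_mono card_mono) auto
      finally show ?thesis .
    qed
    have pop: "D2 \<le> real (card ?A)" if "tl S \<noteq> []" "v = hd (tl S)"
    proof -
      have "D2 \<le> real (card {vs \<in> lists_below n m. tree_walk U (tl S) vs})"
        using Suc.IH[of "tl S" U] Suc.prems that list.set_sel(2)[of S]
        unfolding D2_def q_def by (auto simp: numeral_2_eq_2)
      also have "\<dots> \<le> real (card ?A)" using that by (intro of_nat_mono card_mono) auto
      finally show ?thesis .
    qed
    \<comment> \<open>The parent has been visited, so a push and a return never use the same vertex
      and their counts add up.\<close>
    have "\<not> generic U v" if "tl S \<noteq> []" "v = hd (tl S)"
    proof -
      have "v \<in> U" using that Suc.prems by (cases S; cases "tl S") auto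
      thus ?thesis using generic_notin Suc.prems(2) by blast
    qed
    with gen pop show ?thesis by (auto simp: of_bool_def)
  qed
  hence "(\<Sum>v<n. of_bool (generic U v) * D1 + of_bool (tl S \<noteq> [] \<and> v = hd (tl S)) * D2)
      \<le> real (card {vs \<in> lists_below n (Suc m). tree_walk U S vs})"
    unfolding card_lists_below_Suc of_nat_sum by (intro sum_mono) auto
  moreover have "(\<Sum>v<n. of_bool (generic U v) * D1 + of_bool (tl S \<noteq> [] \<and> v = hd (tl S)) * D2)
      = (\<Sum>v<n. of_bool (generic U v)) * D1 + (\<Sum>v<n. of_bool (tl S \<noteq> [] \<and> v = hd (tl S))) * D2"
    by (simp only: sum.distrib sum_distrib_right)
  moreover have "q * D1 \<le> (\<Sum>v<n. of_bool (generic U v)) * D1"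
    unfolding q_def using Suc.prems(2,3) by (intro mult_right_mono[OF _ D(1)] sum_generic_ge) auto
  moreover have "D2 \<le> (\<Sum>v<n. of_bool (tl S \<noteq> [] \<and> v = hd (tl S))) * D2"
  proof (cases "tl S = []")
    case False
    hence "hd (tl S) < n" using Suc.prems by (cases S; cases "tl S") auto
    hence "(\<Sum>v<n. of_bool (v = hd (tl S))) = (1::real)" by (simp add: of_bool_def)
    thus ?thesis using False by simp
  qed (simp add: D2_def)
  moreover have "q * D1 + D2 = dyck_weight (Suc m) (length S - 1) q"
    using Suc.prems by (cases S; cases "tl S") (auto simp: D1_def D2_def)
  ultimately show ?case unfolding q_def by linarith
qed

subsection \<open>Closed walks with doubled indices\<close>

fun walk_edges :: "nat \<Rightarrow> nat list \<Rightarrow> (nat \<times> nat) list" where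
  "walk_edges p [] = []"
| "walk_edges p (v # vs) = (p, v) # walk_edges v vs"

lemma length_walk_edges [simp]: "length (walk_edges p vs) = length vs"
  by (induction vs arbitrary: p) auto

lemma walk_edges_subset: "(a, b) \<in> set (walk_edges p vs) \<Longrightarrow> a \<in> insert p (set vs) \<and> b \<in> set vs"
  by (induction vs arbitrary: p) auto

fun walk_steps :: "nat set \<Rightarrow> nat \<Rightarrow> nat list \<Rightarrow> (bool \<times> nat \<times> nat) list" where
  "walk_steps U p [] = []"
| "walk_steps U p (v # vs) = (generic U v, (p, v)) # walk_steps (insert v U) v vs"

lemma map_snd_walk_steps [simp]: "map snd (walk_steps U p vs) = walk_edges p vs"
  by (induction vs arbitrary: U p) auto

lemma set_walk_edges: "set (walk_edges p vs) = snd ` set (walk_steps U p vs)"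
  by (metis map_snd_walk_steps set_map)

lemma length_filter_walk_steps: "length (filter fst (walk_steps U p vs)) = gencount U vs"
  by (induction vs arbitrary: U p) auto

section \<open>Fresh and repeated keys along a walk\<close>

fun flags_fresh :: "'b set \<Rightarrow> (bool \<times> 'b) list \<Rightarrow> bool" where
  "flags_fresh A [] = True"
| "flags_fresh A (z # zs) \<longleftrightarrow> (fst z \<longrightarrow> snd z \<notin> A) \<and> flags_fresh (insert (snd z) A) zs"

text \<open>Converse to \<open>flags_fresh\<close>. A nongeneric vertex may well produce a new key,
  so for walks this property is available only in the extremal case of
  \<open>flags_fresh_tight\<close>.\<close>

fun unflagged_old :: "'b set \<Rightarrow> (bool \<times> 'b) list \<Rightarrow> bool" where
  "unflagged_old A [] = True"
| "unflagged_old A (z # zs) \<longleftrightarrow> (\<not> fst z \<longrightarrow> snd z \<in> A) \<and> unflagged_old (insert (snd z) A) zs"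

lemma flags_fresh_append:
  "flags_fresh A (xs @ ys) \<longleftrightarrow> flags_fresh A xs \<and> flags_fresh (A \<union> snd ` set xs) ys"
  by (induction xs arbitrary: A) auto

lemma unflagged_old_append:
  "unflagged_old A (xs @ ys) \<longleftrightarrow> unflagged_old A xs \<and> unflagged_old (A \<union> snd ` set xs) ys"
  by (induction xs arbitrary: A) auto

lemma flags_fresh_card:
  assumes "finite A" "flags_fresh A zs"
  shows "card A + length (filter fst zs) \<le> card (A \<union> snd ` set zs)"
  using assms
proof (induction zs arbitrary: A)
  case (Cons z zs)
  from Cons.IH[of "insert (snd z) A"] Cons.prems
  have "card (insert (snd z) A) + length (filter fst zs) \<le> card (A \<union> snd ` set (z # zs))" by simp
  thus ?case using Cons.prems by (auto simp: card_insert_if split: if_splits)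
qed simp

text \<open>The flagged entries already account for all new values, so an unflagged entry with a new
  value would exceed the count.\<close>

lemma flags_fresh_tight:
  assumes "finite A" "flags_fresh A zs" "card (A \<union> snd ` set zs) \<le> card A + length (filter fst zs)"
  shows "unflagged_old A zs"
  using assms
proof (induction zs arbitrary: A)
  case (Cons z zs)
  have *: "card (insert (snd z) A) + length (filter fst zs) \<le> card (A \<union> snd ` set (z # zs))"
    using flags_fresh_card[of "insert (snd z) A" zs] Cons.prems by simp
  have old: "\<not> fst z \<Longrightarrow> snd z \<in> A"
    using * Cons.prems by (auto simp: card_insert_if split: if_splits)
  have "card (insert (snd z) A \<union> snd ` set zs) \<le> card (insert (snd z) A) + length (filter fst zs)"
    using Cons.prems old by (auto simp: card_insert_if insert_absorb split: if_splits)
  hence "unflagged_old (insert (snd z) A) zs" using Cons by simp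
  with old show ?case by simp
qed simp

text \<open>If each value fills at least two of \<open>2 * K\<close> places there are at most
  \<open>K\<close> values, and flagged entries have distinct ones. Once \<open>K\<close> entries are
  flagged, equality holds throughout: unflagged entries bring nothing new, and no value occurs three
  times.\<close>

lemma flags_fresh_doubled:
  assumes fresh: "flags_fresh {} zs" and two: "\<And>a. a \<in> snd ` set zs \<Longrightarrow> count_list (map snd zs) a \<ge> 2"
    and len: "length zs = 2 * K"
  shows "length (filter fst zs) \<le> K"
    and "K \<le> length (filter fst zs) \<Longrightarrow> unflagged_old {} zs"
    and "K \<le> length (filter fst zs) \<Longrightarrow> count_list (map snd zs) a \<le> 2"
proof -
  let ?D = "snd ` set zs"
  have sum: "(\<Sum>a\<in>?D. count_list (map snd zs) a) = 2 * K"
    using sum_count_set[of "map snd zs" ?D] len by simp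
  moreover have "(\<Sum>a\<in>?D. count_list (map snd zs) a) \<ge> (\<Sum>a\<in>?D. 2)"
    by (intro sum_mono two)
  ultimately have D: "card ?D \<le> K" by simp
  moreover have "length (filter fst zs) \<le> card ?D" using flags_fresh_card[of "{}" zs] fresh by simp
  ultimately show "length (filter fst zs) \<le> K" by simp
  assume K: "K \<le> length (filter fst zs)"
  show "unflagged_old {} zs"
    by (rule flags_fresh_tight) (use fresh K D in auto)
  have KD: "card ?D = K" using D K \<open>length (filter fst zs) \<le> card ?D\<close> by simp
  show "count_list (map snd zs) a \<le> 2"
  proof (cases "a \<in> ?D")
    case True
    have "(\<Sum>b\<in>?D. count_list (map snd zs) b)
        = count_list (map snd zs) a + (\<Sum>b\<in>?D - {a}. count_list (map snd zs) b)"
      using True by (intro sum.remove) auto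
    \<comment> \<open>The other \<open>K - 1\<close> values fill at least \<open>2 * (K - 1)\<close>
      of the \<open>2 * K\<close> places.\<close>
    moreover have "(\<Sum>b\<in>?D - {a}. count_list (map snd zs) b) \<ge> (\<Sum>b\<in>?D - {a}. 2)"
      by (intro sum_mono two) auto
    moreover have "(\<Sum>b\<in>?D - {a}. 2::nat) = 2 * (K - 1)" using True KD by simp
    moreover have "K \<ge> 1" using KD True by (metis card_gt_0_iff empty_iff finite_imageI finite_set less_eq_Suc_le One_nat_def)
    ultimately show ?thesis using sum by linarith
  next
    case False
    hence "count_list (map snd zs) a = 0" by (simp add: count_list_0_iff)
    thus ?thesis by simp
  qed
qed

text \<open>What the counting needs from both indices alike: independence of the direction of an
  edge, and a new value at each step to a generic vertex.\<close>

definition edge_key :: "(nat \<times> nat \<Rightarrow> nat) \<Rightarrow> bool" where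
  "edge_key f \<longleftrightarrow> (\<forall>a b. f (a, b) = f (b, a)) \<and>
     (\<forall>U p v a b. finite U \<longrightarrow> generic U v \<longrightarrow> p \<in> U \<longrightarrow> a \<in> U \<longrightarrow> b \<in> U \<longrightarrow> f (p, v) \<noteq> f (a, b))"

definition toeplitz_index :: "nat \<times> nat \<Rightarrow> nat" where
  "toeplitz_index = (\<lambda>(a, b). nat \<bar>int a - int b\<bar>)"

definition hankel_index :: "nat \<times> nat \<Rightarrow> nat" where
  "hankel_index = (\<lambda>(a, b). (a + 1) + (b + 1))"

lemma edge_key_toeplitz: "edge_key toeplitz_index"
  unfolding edge_key_def
proof (intro conjI allI impI)
  fix U p v a b assume *: "finite U" "generic U v" "p \<in> U" "a \<in> U" "b \<in> U"
  have "int v \<noteq> 1 * int p + 1 * int a + (-1) * int b" "int v \<noteq> 1 * int p + (-1) * int a + 1 * int b"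
    by (rule generic_relation3; use * in simp)+
  thus "toeplitz_index (p, v) \<noteq> toeplitz_index (a, b)" by (auto simp: toeplitz_index_def)
qed (auto simp: toeplitz_index_def abs_minus_commute)

lemma edge_key_hankel: "edge_key hankel_index"
  unfolding edge_key_def
proof (intro conjI allI impI)
  fix U p v a b assume *: "finite U" "generic U v" "p \<in> U" "a \<in> U" "b \<in> U"
  have "int v \<noteq> (-1) * int p + 1 * int a + 1 * int b"
    by (rule generic_relation3; use * in simp)
  thus "hankel_index (p, v) \<noteq> hankel_index (a, b)" by (auto simp: hankel_index_def)
qed (auto simp: hankel_index_def)

text \<open>The Toeplitz index gives \<open>v - p\<close> as \<open>c - d\<close> up to sign, the
  Hankel index gives \<open>v + p = c' + d'\<close>. Eliminating \<open>v\<close> leaves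
  \<open>c' + d' - 2 p = c - d\<close>, or its mirror image, between independent vertices. A priori
  \<open>{c', d'}\<close> is another edge than \<open>{c, d}\<close>; the relation can be trivial
  only if \<open>p\<close> is an end of \<open>{c, d}\<close>.\<close>

lemma indices_determine_edge:
  assumes "finite U" "small_indep U" "p \<in> U" "c \<in> U" "d \<in> U" "c' \<in> U" "d' \<in> U" "c \<noteq> d"
    and x: "toeplitz_index (p, v) = toeplitz_index (c, d)"
    and y: "hankel_index (p, v) = hankel_index (c', d')"
  shows "v = c \<and> p = d \<or> v = d \<and> p = c"
proof -
  have core: "p = d" if "c \<in> U" "d \<in> U" "c \<noteq> d" "int c' + int d' - 2 * int p = int c - int d" for c d
  proof -
    define f :: "nat \<Rightarrow> int" where "f u = of_bool (u = c') + of_bool (u = d') - 2 * of_bool (u = p)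
      - of_bool (u = c) + of_bool (u = d)" for u
    have "(\<Sum>u\<in>U. f u * int u) = (\<Sum>u\<in>U. of_bool (u = c') * int u)
        + (\<Sum>u\<in>U. of_bool (u = d') * int u) - 2 * (\<Sum>u\<in>U. of_bool (u = p) * int u)
        - (\<Sum>u\<in>U. of_bool (u = c) * int u) + (\<Sum>u\<in>U. of_bool (u = d) * int u)"
      unfolding sum_distrib_left sum.distrib[symmetric] sum_subtractf[symmetric]
      by (intro sum.cong refl) (simp add: f_def algebra_simps)
    also have "\<dots> = int c' + int d' - 2 * int p - int c + int d"
      using assms that by (simp only: sum_of_bool_eq_mult)
    finally have "(\<Sum>u\<in>U. f u * int u) = 0" using that by simp
    moreover have "\<bar>f u\<bar> \<le> 8" for u by (auto simp: f_def of_bool_def)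
    \<comment> \<open>At \<open>d\<close> the terms of \<open>c'\<close> and \<open>d'\<close> are
      nonnegative and \<open>d\<close> itself contributes 1, so only the -2 coming from
      \<open>p = d\<close> can cancel them.\<close>
    ultimately have "f d = 0"
      using assms(2)[unfolded small_indep_def, rule_format, of f d] that by blast
    thus "p = d" using \<open>c \<noteq> d\<close> by (auto simp: f_def of_bool_def split: if_splits)
  qed
  have v: "int v = int c' + int d' - int p" using y by (auto simp: hankel_index_def)
  have "int v - int p = int c - int d \<or> int v - int p = int d - int c"
    using x by (auto simp: toeplitz_index_def)
  thus ?thesis
  proof
    assume *: "int v - int p = int c - int d"
    hence "p = d" using core[of c d] v assms by simp
    thus ?thesis using * by simp
  next
    assume *: "int v - int p = int d - int c"
    hence "p = c" using core[of d c] v assms by simp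
    thus ?thesis using * by simp
  qed
qed

lemma walk_steps_flags_fresh:
  assumes "edge_key f" "finite U" "p \<in> U" "\<And>a b. (a, b) \<in> E \<Longrightarrow> a \<in> U \<and> b \<in> U"
  shows "flags_fresh (f ` E) (map (apsnd f) (walk_steps U p vs))"
  using assms(2-)
proof (induction vs arbitrary: U p E)
  case (Cons v vs)
  have "f (p, v) \<notin> f ` E" if "generic U v"
    using assms(1) Cons.prems that unfolding edge_key_def by fastforce
  moreover have "flags_fresh (f ` insert (p, v) E) (map (apsnd f) (walk_steps (insert v U) v vs))"
    by (rule Cons.IH) (use Cons.prems in auto)
  ultimately show ?case by simp
qed simp

text \<open>A key on the stack has been passed once, any other key twice or never.\<close>

definition stack_invariant :: "(nat \<times> nat \<Rightarrow> nat) \<Rightarrow> (nat \<times> nat) list \<Rightarrow> nat list \<Rightarrow> bool" where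
  "stack_invariant f E S \<longleftrightarrow>
     (\<forall>a. count_list (map f E) a + count_list (map f (walk_edges (hd S) (tl S))) a \<in> {0, 2})"

text \<open>The key of the new edge is absent from the past and from the stack, and a push adds one
  occurrence to each. The stack lists edges from child to parent, opposite to the step just made,
  which is where symmetry of the key enters.\<close>

lemma stack_invariant_push:
  assumes "stack_invariant f E (p # S)" "edge_key f" "finite U" "generic U v" "set (p # S) \<subseteq> U"
    and "\<And>a b. (a, b) \<in> set E \<Longrightarrow> a \<in> U \<and> b \<in> U"
  shows "stack_invariant f (E @ [(p, v)]) (v # p # S)"
  unfolding stack_invariant_def
proof
  fix a
  have sym: "f (v, p) = f (p, v)" using assms(2) by (simp add: edge_key_def)
  have "f (p, v) \<notin> set (map f E)"
    using assms(2-6) unfolding edge_key_def by fastforce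
  moreover have "f (p, v) \<notin> set (map f (walk_edges p S))"
  proof
    assume "f (p, v) \<in> set (map f (walk_edges p S))"
    then obtain c d where "(c, d) \<in> set (walk_edges p S)" "f (p, v) = f (c, d)" by auto
    moreover from this walk_edges_subset[of c d p S] assms(5) have "c \<in> U" "d \<in> U" by auto
    ultimately show False using assms(2-5) unfolding edge_key_def by auto
  qed
  ultimately have "count_list (map f E) (f (p, v)) = 0"
    "count_list (map f (walk_edges p S)) (f (p, v)) = 0" unfolding count_list_0_iff .
  thus "count_list (map f (E @ [(p, v)])) a
      + count_list (map f (walk_edges (hd (v # p # S)) (tl (v # p # S)))) a \<in> {0, 2}"
    using assms(1)[unfolded stack_invariant_def, rule_format, of a] sym by (auto simp: count_list_append)
qed

lemma stack_invariant_pop: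
  assumes "stack_invariant f E (p # q # S)"
  shows "stack_invariant f (E @ [(p, q)]) (q # S)"
  unfolding stack_invariant_def
proof
  fix a
  show "count_list (map f (E @ [(p, q)])) a
      + count_list (map f (walk_edges (hd (q # S)) (tl (q # S)))) a \<in> {0, 2}"
    using assms[unfolded stack_invariant_def, rule_format, of a]
    by (auto simp: count_list_append split: if_splits)
qed

text \<open>At the end of the walk the stack holds only the root, and the invariant then speaks of
  the walk alone. Each variable thus occurs squared or not at all, which makes the expectation equal
  to 1.\<close>

lemma tree_walk_counts:
  assumes "edge_key f" "finite U" "set (p # S) \<subseteq> U" "\<And>a b. (a, b) \<in> set E \<Longrightarrow> a \<in> U \<and> b \<in> U"
    and "stack_invariant f E (p # S)" "tree_walk U (p # S) vs"
  shows "count_list (map f (E @ walk_edges p vs)) a \<in> {0, 2}"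
  using assms(2-)
proof (induction vs arbitrary: U p S E)
  case Nil
  thus ?case by (auto simp: stack_invariant_def)
next
  case (Cons v vs)
  from Cons.prems(5) consider "generic U v" "tree_walk (insert v U) (v # p # S) vs"
    | "S \<noteq> []" "v = hd S" "tree_walk U S vs" by auto
  hence "count_list (map f ((E @ [(p, v)]) @ walk_edges v vs)) a \<in> {0, 2}"
  proof cases
    case 1
    show ?thesis
    proof (rule Cons.IH[OF _ _ _ _ 1(2)])
      show "stack_invariant f (E @ [(p, v)]) (v # p # S)"
        by (rule stack_invariant_push[OF Cons.prems(4) assms(1) Cons.prems(1) 1(1)])
          (use Cons.prems in auto)
    qed (use Cons.prems in auto)
  next
    case 2
    then obtain S' where S: "S = v # S'" by (cases S) auto
    show ?thesis
    proof (rule Cons.IH[of U v S'])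
      show "stack_invariant f (E @ [(p, v)]) (v # S')"
        using Cons.prems(4) unfolding S by (rule stack_invariant_pop)
    qed (use Cons.prems 2(3) S in auto)
  qed
  thus ?case by simp
qed

text \<open>Each vertex of a tree walk is generic when entered or already present. This provides the
  independent set from which the second walk of a pair starts.\<close>

lemma tree_walk_small_indep:
  assumes "finite U" "small_indep U" "set S \<subseteq> U" "tree_walk U S vs" "S \<noteq> []"
  shows "small_indep (U \<union> set vs)"
  using assms
proof (induction vs arbitrary: U S)
  case (Cons v vs)
  from Cons.prems(4) consider "generic U v" "tree_walk (insert v U) (v # S) vs"
    | "tl S \<noteq> []" "v = hd (tl S)" "tree_walk U (tl S) vs" by auto
  thus ?case
  proof cases
    case 1
    with Cons.IH[of "insert v U" "v # S"] Cons.prems small_indep_insert[of U v] show ?thesis by auto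
  next
    case 2
    hence "v \<in> U" using Cons.prems by (cases S; cases "tl S") auto
    moreover have "small_indep (U \<union> set vs)"
      by (rule Cons.IH[of U "tl S"]) (use Cons.prems 2 in \<open>auto dest: list.set_sel(2)\<close>)
    ultimately show ?thesis by (simp add: insert_absorb)
  qed
qed simp

text \<open>The root is never popped from the bottom of the stack.\<close>

lemma tree_walk_last:
  "tree_walk U (p # S) vs \<Longrightarrow> last (p # vs) = last (p # S)"
proof (induction vs arbitrary: U p S)
  case Nil
  thus ?case by simp
next
  case (Cons v vs)
  from Cons.prems consider "tree_walk (insert v U) (v # p # S) vs"
    | "S \<noteq> []" "v = hd S" "tree_walk U S vs" by auto
  thus ?case
  proof cases
    case 1
    from Cons.IH[OF this] show ?thesis by simp
  next
    case 2
    then obtain S' where S: "S = v # S'" by (cases S) auto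
    from Cons.IH[of U v S'] 2(3) S show ?thesis by simp
  qed
qed

text \<open>A generic step is a push. A nongeneric step repeats an old Toeplitz key; as no key
  occurs three times, that key has been passed once and so lies on the stack. Its Hankel key is old
  as well, so the step retraces an edge of the stack that ends in \<open>p\<close>, which can only
  be the top one: the walk returns to the parent.\<close>

lemma closed_walk_is_tree_walk:
  assumes "finite U" "small_indep U" "set (p # S) \<subseteq> U" "distinct (p # S)"
    and "\<And>a b. (a, b) \<in> set E \<Longrightarrow> a \<in> U \<and> b \<in> U"
    and "stack_invariant toeplitz_index E (p # S)"
    and "unflagged_old (toeplitz_index ` set E) (map (apsnd toeplitz_index) (walk_steps U p vs))"
    and "unflagged_old (hankel_index ` set E) (map (apsnd hankel_index) (walk_steps U p vs))"
    and "\<And>a. count_list (map toeplitz_index (E @ walk_edges p vs)) a \<le> 2"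
    and "last (p # vs) = last (p # S)"
  shows "tree_walk U (p # S) vs"
  using assms
proof (induction vs arbitrary: U p S E)
  case Nil
  \<comment> \<open>The walk is closed, so \<open>p\<close> is also the bottom of the stack, and the
    stack has no repetitions.\<close>
  have "S = []"
  proof (rule ccontr)
    assume "S \<noteq> []"
    hence "last S = p" using Nil.prems(10) by simp
    thus False using Nil.prems(4) \<open>S \<noteq> []\<close> last_in_set[of S] by simp
  qed
  thus ?case by simp
next
  case (Cons v vs)
  show ?case
  proof (cases "generic U v")
    case True
    have "tree_walk (insert v U) (v # p # S) vs"
    proof (rule Cons.IH[where E = "E @ [(p, v)]"])
      show "small_indep (insert v U)" by (rule small_indep_insert) (use Cons.prems True in auto)
      show "distinct (v # p # S)" using Cons.prems(1,3,4) True generic_notin by auto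
      show "stack_invariant toeplitz_index (E @ [(p, v)]) (v # p # S)"
        by (rule stack_invariant_push[OF Cons.prems(6) edge_key_toeplitz Cons.prems(1) True])
          (use Cons.prems in auto)
      show "unflagged_old (toeplitz_index ` set (E @ [(p, v)]))
          (map (apsnd toeplitz_index) (walk_steps (insert v U) v vs))"
        using Cons.prems(7) by simp
      show "unflagged_old (hankel_index ` set (E @ [(p, v)]))
          (map (apsnd hankel_index) (walk_steps (insert v U) v vs))"
        using Cons.prems(8) by simp
      show "count_list (map toeplitz_index ((E @ [(p, v)]) @ walk_edges v vs)) a \<le> 2" for a
        using Cons.prems(9)[of a] by simp
      show "a \<in> insert v U \<and> b \<in> insert v U" if "(a, b) \<in> set (E @ [(p, v)])" for a b
        using that Cons.prems(3,5) by auto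
    qed (use Cons.prems in auto)
    thus ?thesis using True by simp
  next
    case False
    let ?a = "toeplitz_index (p, v)"
    have x: "?a \<in> toeplitz_index ` set E" using Cons.prems(7) False by simp
    have "hankel_index (p, v) \<in> hankel_index ` set E" using Cons.prems(8) False by simp
    then obtain c' d' where y: "(c', d') \<in> set E" "hankel_index (p, v) = hankel_index (c', d')" by auto
    have "count_list (map toeplitz_index E) ?a \<noteq> 0" using x by (simp add: count_list_0_iff)
    \<comment> \<open>The present step takes one of the two admissible occurrences.\<close>
    moreover have "count_list (map toeplitz_index E) ?a \<le> 1"
      using Cons.prems(9)[of ?a] by (simp add: count_list_append)
    ultimately have "count_list (map toeplitz_index (walk_edges p S)) ?a \<noteq> 0"
      using Cons.prems(6)[unfolded stack_invariant_def, rule_format, of ?a] by auto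
    then obtain c d where cd: "(c, d) \<in> set (walk_edges p S)" "?a = toeplitz_index (c, d)"
      by (auto simp: count_list_0_iff)
    obtain q S' where S: "S = q # S'" using cd by (cases S) auto
    \<comment> \<open>Along a path of distinct vertices the starting point \<open>p\<close> lies on
      the first edge only.\<close>
    have edge: "c \<noteq> d" "p \<in> {c, d} \<Longrightarrow> (c, d) = (p, q)"
    proof -
      have "c \<noteq> d" if "(c, d) \<in> set (walk_edges p S)" "distinct (p # S)" for p S
        using that by (induction S arbitrary: p) auto
      thus "c \<noteq> d" using cd Cons.prems(4) by blast
      show "(c, d) = (p, q)" if "p \<in> {c, d}"
      proof (rule ccontr)
        assume "(c, d) \<noteq> (p, q)"
        hence "(c, d) \<in> set (walk_edges q S')" using cd(1) S by auto
        hence "c \<in> set S" "d \<in> set S" using walk_edges_subset[of c d q S'] S by auto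
        thus False using that Cons.prems(4) by auto
      qed
    qed
    have "c \<in> insert p (set S)" "d \<in> insert p (set S)" using walk_edges_subset[OF cd(1)] by auto
    hence cdU: "c \<in> U" "d \<in> U" using Cons.prems(3) by auto
    have "v = c \<and> p = d \<or> v = d \<and> p = c"
      by (rule indices_determine_edge[OF Cons.prems(1,2) _ cdU _ _ edge(1) cd(2) y(2)])
        (use Cons.prems(3,5) y in auto)
    hence v: "v = q" using edge by auto
    have vU: "insert v U = U" using v S Cons.prems(3) by auto
    have "tree_walk U (q # S') vs"
    proof (rule Cons.IH[where E = "E @ [(p, v)]"])
      show "stack_invariant toeplitz_index (E @ [(p, v)]) (q # S')"
        using Cons.prems(6) unfolding S v by (rule stack_invariant_pop)
      show "unflagged_old (toeplitz_index ` set (E @ [(p, v)]))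
          (map (apsnd toeplitz_index) (walk_steps U q vs))"
        using Cons.prems(7) vU v by simp
      show "unflagged_old (hankel_index ` set (E @ [(p, v)]))
          (map (apsnd hankel_index) (walk_steps U q vs))"
        using Cons.prems(8) vU v by simp
      show "count_list (map toeplitz_index ((E @ [(p, v)]) @ walk_edges q vs)) a \<le> 2" for a
        using Cons.prems(9)[of a] v by simp
      show "a \<in> U \<and> b \<in> U" if "(a, b) \<in> set (E @ [(p, v)])" for a b
        using that Cons.prems(3,5) v S by auto
    qed (use Cons.prems S v in auto)
    thus ?thesis using S v by simp
  qed
qed

text \<open>The second walk is generic over all vertices of the first, so the two trees are disjoint
  and all their free vertices can be chosen in succession.\<close>

definition tree_walk_pair :: "nat list \<Rightarrow> nat list \<Rightarrow> bool" where
  "tree_walk_pair vs ws \<longleftrightarrow>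
     generic {} (hd vs) \<and> tree_walk {hd vs} [hd vs] (tl vs) \<and>
     generic (set vs) (hd ws) \<and> tree_walk (insert (hd ws) (set vs)) [hd ws] (tl ws)"

definition pair_edges :: "nat list \<Rightarrow> nat list \<Rightarrow> (nat \<times> nat) list" where
  "pair_edges vs ws = walk_edges (hd vs) (tl vs) @ walk_edges (hd ws) (tl ws)"

lemma stack_invariant_singleton:
  "stack_invariant f E [v] \<longleftrightarrow> (\<forall>a. count_list (map f E) a \<in> {0, 2})"
  by (simp add: stack_invariant_def)

lemma tree_walk_pair_counts:
  assumes "tree_walk_pair vs ws" "edge_key f" "vs \<noteq> []"
  shows "count_list (map f (pair_edges vs ws)) a \<in> {0, 2}"
proof -
  obtain v vs' where vs: "vs = v # vs'" using assms(3) by (cases vs) auto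
  note P = assms(1)[unfolded tree_walk_pair_def]
  have 1: "count_list (map f ([] @ walk_edges v vs')) a \<in> {0, 2}" for a
    by (rule tree_walk_counts[where U = "{v}" and S = "[]"])
      (use P vs assms(2) in \<open>auto simp: stack_invariant_singleton\<close>)
  show ?thesis unfolding pair_edges_def
  proof (rule tree_walk_counts[where U = "insert (hd ws) (set vs)" and S = "[]"])
    show "stack_invariant f (walk_edges (hd vs) (tl vs)) [hd ws]"
      using 1 vs by (simp add: stack_invariant_singleton)
  qed (use P vs assms(2) in \<open>auto dest: walk_edges_subset\<close>)
qed

text \<open>If no index of either kind occurred exactly once, each would occur at least twice,
  leaving at most \<open>K\<close> generic steps. Then \<open>K + 2\<close> generic vertices force
  both roots to be generic and exactly \<open>K\<close> generic steps. This is the extremal case for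
  both indices, and there both walks are tree walks.\<close>

lemma closed_walk_pair_dichotomy:
  assumes "length vs = Suc h" "length ws = Suc h'" "h + h' = 2 * K"
    and "last vs = hd vs" "last ws = hd ws" "\<not> tree_walk_pair vs ws"
    and gen: "gencount {} (vs @ ws) \<ge> K + 2"
  shows "\<exists>f\<in>{toeplitz_index, hankel_index}. \<exists>a. count_list (map f (pair_edges vs ws)) a = 1"
proof (rule ccontr)
  assume "\<not> ?thesis"
  hence no1: "count_list (map f (pair_edges vs ws)) a \<noteq> 1"
    if "f \<in> {toeplitz_index, hankel_index}" for f a using that by blast
  obtain v vs' where vs: "vs = v # vs'" using assms(1) by (cases vs) auto
  obtain w ws' where ws: "ws = w # ws'" using assms(2) by (cases ws) auto
  define U where "U = insert w (set vs)"
  define st where "st = walk_steps {v} v vs' @ walk_steps U w ws'"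
  have st: "map snd st = pair_edges vs ws" by (simp add: st_def pair_edges_def vs ws)
  have len: "length st = 2 * K"
    using arg_cong[OF st, of length] assms(1-3) vs ws by (simp add: pair_edges_def)
  have fl: "length (filter fst st) = gencount {v} vs' + gencount U ws'"
    by (simp add: st_def length_filter_walk_steps)
  have g: "gencount {} (vs @ ws)
      = of_bool (generic {} v) + of_bool (generic (set vs) w) + length (filter fst st)"
    unfolding gencount_append fl by (simp add: vs ws U_def insert_commute)
  define zs where "zs f = map (apsnd f) st" for f :: "nat \<times> nat \<Rightarrow> nat"
  have snd_zs: "map snd (zs f) = map f (pair_edges vs ws)" for f
    unfolding zs_def st[symmetric] by simp
  have fst_zs: "length (filter fst (zs f)) = length (filter fst st)" for f
    by (simp add: zs_def filter_map comp_def)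
  have fresh: "flags_fresh {} (zs f)" if f: "edge_key f" for f
  proof -
    have 1: "flags_fresh (f ` {}) (map (apsnd f) (walk_steps {v} v vs'))"
      by (rule walk_steps_flags_fresh[OF f]) auto
    have "flags_fresh (f ` set (walk_edges v vs')) (map (apsnd f) (walk_steps U w ws'))"
      by (rule walk_steps_flags_fresh[OF f]) (auto simp: U_def vs dest: walk_edges_subset)
    moreover have "f ` set (walk_edges v vs') = snd ` set (map (apsnd f) (walk_steps {v} v vs'))"
      by (simp add: set_walk_edges[of v _ "{v}"] image_image)
    ultimately show ?thesis using 1 by (simp add: zs_def st_def flags_fresh_append)
  qed
  have two: "count_list (map snd (zs f)) a \<ge> 2"
    if "f \<in> {toeplitz_index, hankel_index}" "a \<in> snd ` set (zs f)" for f a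
  proof -
    have "count_list (map snd (zs f)) a \<noteq> 0" using that(2) by (simp add: count_list_0_iff)
    moreover have "count_list (map snd (zs f)) a \<noteq> 1" using no1[OF that(1)] by (simp add: snd_zs)
    ultimately show ?thesis by linarith
  qed
  have lenz: "length (zs f) = 2 * K" for f using len by (simp add: zs_def)
  have le: "length (filter fst st) \<le> K"
    using flags_fresh_doubled(1)[OF fresh[OF edge_key_toeplitz] two lenz] fst_zs by simp
  \<comment> \<open>The surplus of 2 over the \<open>K\<close> steps is used up by the two
    roots.\<close>
  with gen g have g1: "generic {} v" and g2: "generic (set vs) w" and K: "K \<le> length (filter fst st)"
    by (auto simp: of_bool_def split: if_splits)
  have old: "unflagged_old {} (zs f)" if "f \<in> {toeplitz_index, hankel_index}" for f
    by (rule flags_fresh_doubled(2)[OF fresh two lenz])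
      (use that edge_key_toeplitz edge_key_hankel K fst_zs in auto)
  have cnt: "count_list (map toeplitz_index (pair_edges vs ws)) a \<le> 2" for a
    using flags_fresh_doubled(3)[OF fresh[OF edge_key_toeplitz] two lenz] K fst_zs by (simp add: snd_zs)
  have old1: "unflagged_old (f ` set []) (map (apsnd f) (walk_steps {v} v vs'))"
    and old2: "unflagged_old (f ` set (walk_edges v vs')) (map (apsnd f) (walk_steps U w ws'))"
    if "f \<in> {toeplitz_index, hankel_index}" for f
  proof -
    have "f ` set (walk_edges v vs') = snd ` set (map (apsnd f) (walk_steps {v} v vs'))"
      by (simp add: set_walk_edges[of v _ "{v}"] image_image)
    thus "unflagged_old (f ` set []) (map (apsnd f) (walk_steps {v} v vs'))"
      "unflagged_old (f ` set (walk_edges v vs')) (map (apsnd f) (walk_steps U w ws'))"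
      using old[OF that] by (simp_all add: zs_def st_def unflagged_old_append)
  qed
  have iv: "small_indep {v}" using small_indep_insert[OF _ small_indep_empty g1] by simp
  have tw1: "tree_walk {v} [v] vs'"
  proof (rule closed_walk_is_tree_walk[where E = "[]"])
    show "count_list (map toeplitz_index ([] @ walk_edges v vs')) a \<le> 2" for a
      using cnt[of a] by (simp add: pair_edges_def vs count_list_append)
    show "last (v # vs') = last [v]" using assms(4) vs by simp
  qed (use iv old1 in \<open>auto simp: stack_invariant_singleton\<close>)
  have tw2: "tree_walk U [w] ws'"
  proof (rule closed_walk_is_tree_walk[where E = "walk_edges v vs'"])
    have "small_indep ({v} \<union> set vs')" by (rule tree_walk_small_indep[OF _ iv _ tw1]) auto
    thus "small_indep U" unfolding U_def using g2 vs by (intro small_indep_insert) auto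
    show "stack_invariant toeplitz_index (walk_edges v vs') [w]"
      unfolding stack_invariant_singleton
    proof
      fix a
      have "count_list (map toeplitz_index ([] @ walk_edges v vs')) a \<in> {0, 2}"
        by (rule tree_walk_counts[OF edge_key_toeplitz, where U = "{v}" and S = "[]"])
          (use tw1 in \<open>auto simp: stack_invariant_singleton\<close>)
      thus "count_list (map toeplitz_index (walk_edges v vs')) a \<in> {0, 2}" by simp
    qed
    show "count_list (map toeplitz_index (walk_edges v vs' @ walk_edges w ws')) a \<le> 2" for a
      using cnt[of a] by (simp add: pair_edges_def vs ws)
    show "last (w # ws') = last [w]" using assms(5) ws by simp
    show "a \<in> U \<and> b \<in> U" if "(a, b) \<in> set (walk_edges v vs')" for a b
      using walk_edges_subset[OF that] by (auto simp: U_def vs)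
  qed (use old2 in \<open>auto simp: U_def\<close>)
  show False using assms(6) g1 g2 tw1 tw2 by (simp add: tree_walk_pair_def vs ws U_def)
qed

subsection \<open>The spectral theorem for symmetric matrices\<close>

lemma orthogonal_transpose:
  fixes u :: "nat \<Rightarrow> nat \<Rightarrow> real"
  assumes "\<And>a b. a < n \<Longrightarrow> b < n \<Longrightarrow> (\<Sum>i<n. u i a * u i b) = of_bool (a = b)"
    and "i < n" "j < n"
  shows "(\<Sum>a<n. u i a * u j a) = of_bool (i = j)"
proof -
  define U where "U = Matrix.mat n n (\<lambda>(i, a). u i a)"
  have U: "U \<in> carrier_mat n n" by (simp add: U_def)
  have "transpose_mat U * U = 1\<^sub>m n"
    by (rule eq_matI) (auto simp: U_def scalar_prod_def assms(1) atLeast0LessThan)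
  from mat_mult_left_right_inverse[OF _ U this] U have "U * transpose_mat U = 1\<^sub>m n" by auto
  hence "(U * transpose_mat U) $$ (i, j) = of_bool (i = j)" using assms by auto
  thus ?thesis using assms(2,3) by (auto simp: U_def scalar_prod_def atLeast0LessThan)
qed

text \<open>The fundamental theorem of algebra yields a complex eigenvector. Symmetry makes the
  eigenvalue real, so real and imaginary parts satisfy the eigenvalue equation separately, and one
  of them is nonzero at \<open>k\<close>.\<close>

lemma symmetric_real_eigenvector:
  fixes A :: "nat \<Rightarrow> nat \<Rightarrow> real"
  assumes "n > 0" and sym: "\<And>i j. i < n \<Longrightarrow> j < n \<Longrightarrow> A i j = A j i"
  obtains e v k where "k < n" "v k \<noteq> 0" "\<And>i. i < n \<Longrightarrow> (\<Sum>j<n. A i j * v j) = e * v i"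
proof -
  define C where "C = Matrix.mat n n (\<lambda>(i, j). complex_of_real (A i j))"
  have C: "C \<in> carrier_mat n n" by (simp add: C_def)
  have "degree (char_poly C) = n" using degree_monic_char_poly[OF C] by simp
  hence "\<not> constant (poly (char_poly C))" using assms(1) by (simp add: constant_degree)
  then obtain z where "poly (char_poly C) z = 0"
    using fundamental_theorem_of_algebra by blast
  hence "eigenvalue C z" using eigenvalue_root_char_poly[OF C] by simp
  then obtain wv where wv: "wv \<in> carrier_vec n" "wv \<noteq> 0\<^sub>v n" "C *\<^sub>v wv = z \<cdot>\<^sub>v wv"
    unfolding eigenvalue_def eigenvector_def using C by auto
  define w where "w = vec_index wv"
  have ev: "(\<Sum>j<n. A i j * w j) = z * w i" if "i < n" for i
  proof -
    have "vec_index (C *\<^sub>v wv) i = vec_index (z \<cdot>\<^sub>v wv) i" using wv(3) by simp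
    thus ?thesis using that wv(1) C by (simp add: w_def C_def scalar_prod_def atLeast0LessThan)
  qed
  obtain k where k: "k < n" "w k \<noteq> 0"
    using wv(1,2) unfolding w_def by (metis carrier_vecD eq_vecI index_zero_vec)
  \<comment> \<open>The Hermitian form of \<open>A\<close> at \<open>w\<close>: real by symmetry,
    and equal to \<open>z\<close> times the squared norm of \<open>w\<close>.\<close>
  define S where "S = (\<Sum>i<n. cnj (w i) * (\<Sum>j<n. A i j * w j))"
  have S1: "S = z * of_real (\<Sum>i<n. (cmod (w i))\<^sup>2)"
  proof -
    have "S = (\<Sum>i<n. cnj (w i) * (z * w i))" by (simp add: S_def ev)
    also have "\<dots> = (\<Sum>i<n. z * of_real ((cmod (w i))\<^sup>2))"
      by (intro sum.cong) (auto simp: complex_norm_square mult_ac simp del: of_real_power)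
    finally show ?thesis by (simp add: sum_distrib_left)
  qed
  have "cnj S = (\<Sum>i<n. \<Sum>j<n. A i j * (w i * cnj (w j)))"
    by (simp add: S_def sum_distrib_left mult_ac)
  also have "\<dots> = (\<Sum>i<n. \<Sum>j<n. A j i * (w j * cnj (w i)))" by (rule sum.swap)
  also have "\<dots> = (\<Sum>i<n. \<Sum>j<n. A i j * (w j * cnj (w i)))"
    by (intro sum.cong refl) (use sym in auto)
  also have "\<dots> = S" by (simp add: S_def sum_distrib_left mult_ac)
  finally have S2: "cnj S = S" .
  have pos: "(\<Sum>i<n. (cmod (w i))\<^sup>2) > 0"
    by (rule sum_pos2[of _ k]) (use k in auto)
  define N where "N = (\<Sum>i<n. (cmod (w i))\<^sup>2)"
  have "cnj z * of_real N = z * of_real N"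
    using S1 S2 unfolding N_def by (metis complex_cnj_complex_of_real complex_cnj_mult)
  moreover have "N \<noteq> 0" using pos by (simp add: N_def)
  ultimately have "cnj z = z" by simp
  hence z: "z = of_real (Re z)" by (simp add: complex_eq_iff)
  have re: "(\<Sum>j<n. A i j * Re (w j)) = Re z * Re (w i)" if "i < n" for i
    using arg_cong[OF ev[OF that], of Re] arg_cong[OF z, of Im] by simp
  have im: "(\<Sum>j<n. A i j * Im (w j)) = Re z * Im (w i)" if "i < n" for i
    using arg_cong[OF ev[OF that], of Im] arg_cong[OF z, of Im] by simp
  show ?thesis
  proof (cases "Re (w k) = 0")
    case True
    hence "Im (w k) \<noteq> 0" using k by (simp add: complex_eq_iff)
    thus ?thesis using that[of k "\<lambda>j. Im (w j)" "Re z"] k im by simp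
  next
    case False
    thus ?thesis using that[of k "\<lambda>j. Re (w j)" "Re z"] k re by simp
  qed
qed

lemma sum_of_bool_left: "a < (n::nat) \<Longrightarrow> (\<Sum>i<n. of_bool (a = i) * f i) = (f a :: real)"
  by (simp add: sum.delta' of_bool_def if_distrib[of "\<lambda>x. x * _"] cong: if_cong)

text \<open>The reflection in the hyperplane orthogonal to \<open>w = v - e\<close>, with
  \<open>e\<close> the first unit vector, exchanges \<open>e\<close> and \<open>v\<close>. Since
  \<open>w\<close> has squared norm \<open>2 * s\<close> with \<open>s = 1 - v 0\<close>, the usual
  factor 2 cancels.\<close>

lemma householder_reflection:
  fixes v :: "nat \<Rightarrow> real"
  assumes n: "n > 0" and v: "(\<Sum>a<n. (v a)\<^sup>2) = 1"
  obtains H where "\<And>a b. H a b = H b a" "\<And>a. a < n \<Longrightarrow> H a 0 = v a"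
    "\<And>a b. a < n \<Longrightarrow> b < n \<Longrightarrow> (\<Sum>c<n. H a c * H b c) = of_bool (a = b)"
proof (cases "v 0 = 1")
  \<comment> \<open>Here \<open>v\<close> is the first unit vector and the reflection would divide
    by 0; the identity serves instead.\<close>
  case True
  have "(\<Sum>a<n. (v a)\<^sup>2) = (v 0)\<^sup>2 + (\<Sum>a\<in>{..<n}-{0}. (v a)\<^sup>2)"
    using n by (subst sum.remove[of _ 0]) auto
  hence "(\<Sum>a\<in>{..<n}-{0}. (v a)\<^sup>2) = 0" using v True by simp
  hence "v a = 0" if "a < n" "a \<noteq> 0" for a
    using that by (subst (asm) sum_nonneg_eq_0_iff) auto
  hence "v a = of_bool (a = 0)" if "a < n" for a using that True by (cases "a = 0") auto
  thus ?thesis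
    by (intro that[of "\<lambda>a b. of_bool (a = b)"]) (auto simp: sum_of_bool_left)
next
  case False
  define s where "s = 1 - v 0"
  have s: "s \<noteq> 0" using False by (simp add: s_def)
  define w where "w a = v a - of_bool (a = 0)" for a
  define H where "H a b = of_bool (a = b) - w a * w b / s" for a b :: nat
  have ww: "(\<Sum>c<n. w c * w c) = 2 * s"
  proof -
    have "(\<Sum>c<n. w c * w c) = (\<Sum>c<n. (v c)\<^sup>2 - 2 * (of_bool (0 = c) * v c) + of_bool (0 = c) * 1)"
      by (intro sum.cong) (auto simp: w_def power2_eq_square algebra_simps)
    also have "\<dots> = 1 - 2 * v 0 + 1"
      unfolding sum.distrib sum_subtractf sum_distrib_left[symmetric]
      using n v by (simp add: sum_of_bool_left del: mult_1_right)
    finally show ?thesis by (simp add: s_def)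
  qed
  show ?thesis
  proof (rule that)
    show "H a b = H b a" for a b by (auto simp: H_def)
    show "H a 0 = v a" if "a < n" for a
    proof -
      have "w 0 = - s" by (simp add: w_def s_def)
      thus ?thesis using s by (simp add: H_def w_def)
    qed
    show "(\<Sum>c<n. H a c * H b c) = of_bool (a = b)" if "a < n" "b < n" for a b
    proof -
      have "(\<Sum>c<n. H a c * H b c) = (\<Sum>c<n. of_bool (a = c) * of_bool (b = c)
          - of_bool (a = c) * (w b * w c / s) - of_bool (b = c) * (w a * w c / s)
          + (w a * w b / s\<^sup>2) * (w c * w c))"
        by (intro sum.cong) (auto simp: H_def algebra_simps power2_eq_square)
      also have "\<dots> = of_bool (b = a) - w b * w a / s - w a * w b / s + w a * w b / s\<^sup>2 * (2 * s)"
        unfolding sum.distrib sum_subtractf sum_distrib_left[symmetric] ww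
        using that by (simp only: sum_of_bool_left)
      also have "\<dots> = of_bool (a = b)" using s by (auto simp: field_simps power2_eq_square)
      finally show ?thesis .
    qed
  qed
qed

lemma orthogonal_apply_twice:
  fixes H :: "nat \<Rightarrow> nat \<Rightarrow> real"
  assumes "\<And>a b. a < n \<Longrightarrow> b < n \<Longrightarrow> (\<Sum>c<n. H a c * H b c) = of_bool (a = b)" "a < n"
  shows "(\<Sum>c<n. H a c * (\<Sum>p<n. H p c * f p)) = f a"
proof -
  have "(\<Sum>c<n. H a c * (\<Sum>p<n. H p c * f p)) = (\<Sum>c<n. \<Sum>p<n. H a c * H p c * f p)"
    by (simp add: sum_distrib_left mult_ac)
  also have "\<dots> = (\<Sum>p<n. (\<Sum>c<n. H a c * H p c) * f p)"
    by (subst sum.swap) (simp add: sum_distrib_right)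
  also have "\<dots> = (\<Sum>p<n. of_bool (a = p) * f p)" using assms by (intro sum.cong) auto
  finally show ?thesis using assms(2) by (simp add: sum_of_bool_left)
qed

lemma sum_bilinear_transform:
  fixes H :: "nat \<Rightarrow> nat \<Rightarrow> real"
  shows "(\<Sum>i<m. g i * (\<Sum>c<n. H a c * u i c) * (\<Sum>d<n. H b d * u i d))
    = (\<Sum>c<n. H a c * (\<Sum>d<n. H b d * (\<Sum>i<m. g i * u i c * u i d)))"
proof -
  have "(\<Sum>i<m. g i * (\<Sum>c<n. H a c * u i c) * (\<Sum>d<n. H b d * u i d))
    = (\<Sum>i<m. \<Sum>c<n. \<Sum>d<n. H a c * (H b d * (g i * u i c * u i d)))"
    by (simp add: sum_distrib_left sum_distrib_right mult_ac)
  also have "\<dots> = (\<Sum>c<n. \<Sum>i<m. \<Sum>d<n. H a c * (H b d * (g i * u i c * u i d)))"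
    by (rule sum.swap)
  also have "\<dots> = (\<Sum>c<n. \<Sum>d<n. \<Sum>i<m. H a c * (H b d * (g i * u i c * u i d)))"
    by (intro sum.cong refl, rule sum.swap)
  finally show ?thesis by (simp add: sum_distrib_left)
qed

text \<open>Induction on the dimension. A symmetric orthogonal \<open>H\<close> whose first column
  is a unit eigenvector conjugates \<open>A\<close> into a matrix \<open>B\<close> that splits off
  the eigenvalue; the remaining block is again symmetric.\<close>

lemma spectral_theorem_aux:
  fixes A :: "nat \<Rightarrow> nat \<Rightarrow> real"
  assumes "\<And>i j. i < n \<Longrightarrow> j < n \<Longrightarrow> A i j = A j i"
  shows "\<exists>u l. (\<forall>a<n. \<forall>b<n. (\<Sum>i<n. u i a * u i b) = of_bool (a = b)) \<and>
    (\<forall>a<n. \<forall>b<n. A a b = (\<Sum>i<n. l i * u i a * u i b))"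
  using assms
proof (induction n arbitrary: A)
  case 0
  show ?case by simp
next
  case (Suc m)
  let ?n = "Suc m"
  obtain e v0 k where k: "k < ?n" "v0 k \<noteq> 0"
    and ev0: "\<And>i. i < ?n \<Longrightarrow> (\<Sum>j<?n. A i j * v0 j) = e * v0 i"
    by (rule symmetric_real_eigenvector[of ?n A]) (use Suc.prems in auto)
  define r where "r = sqrt (\<Sum>a<?n. (v0 a)\<^sup>2)"
  have "(\<Sum>a<?n. (v0 a)\<^sup>2) > 0" by (rule sum_pos2[of _ k]) (use k in auto)
  hence r: "r \<noteq> 0" "r\<^sup>2 = (\<Sum>a<?n. (v0 a)\<^sup>2)" by (auto simp: r_def)
  define v where "v a = v0 a / r" for a
  have v1: "(\<Sum>a<?n. (v a)\<^sup>2) = 1"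
    unfolding v_def power_divide sum_divide_distrib[symmetric] r(2)[symmetric] using r(1) by simp
  have ev: "(\<Sum>j<?n. A i j * v j) = e * v i" if "i < ?n" for i
    using ev0[OF that] by (simp only: v_def times_divide_eq_right sum_divide_distrib[symmetric])
  obtain H where Hs: "\<And>a b. H a b = H b a" and H0: "\<And>a. a < ?n \<Longrightarrow> H a 0 = v a"
    and HH: "\<And>a b. a < ?n \<Longrightarrow> b < ?n \<Longrightarrow> (\<Sum>c<?n. H a c * H b c) = of_bool (a = b)"
    by (rule householder_reflection[OF _ v1]) auto
  define C where "C p d = (\<Sum>q<?n. H q d * A p q)" for p d
  define B where "B c d = (\<Sum>p<?n. H p c * C p d)" for c d
  have B0: "B a 0 = e * of_bool (a = 0)" if "a < ?n" for a
  proof -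
    have "C p 0 = e * H p 0" if "p < ?n" for p
      using ev[OF that] H0 that by (simp add: C_def mult.commute)
    hence "B a 0 = (\<Sum>p<?n. e * (H a p * H 0 p))"
      unfolding B_def using Hs by (intro sum.cong) auto
    also have "\<dots> = e * (\<Sum>p<?n. H a p * H 0 p)" by (simp only: sum_distrib_left)
    finally show ?thesis using HH[OF that, of 0] by simp
  qed
  have Bs: "B a b = B b a" for a b
  proof -
    have "B a b = (\<Sum>p<?n. \<Sum>q<?n. H p a * (H q b * A p q))"
      by (simp only: B_def C_def sum_distrib_left)
    also have "\<dots> = (\<Sum>q<?n. \<Sum>p<?n. H p a * (H q b * A p q))" by (rule sum.swap)
    also have "\<dots> = (\<Sum>q<?n. \<Sum>p<?n. H q b * (H p a * A q p))"
      by (intro sum.cong refl) (use Suc.prems in auto)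
    finally show ?thesis by (simp only: B_def C_def sum_distrib_left)
  qed
  have AB: "A a b = (\<Sum>c<?n. H a c * (\<Sum>d<?n. H b d * B c d))" if "a < ?n" "b < ?n" for a b
  proof -
    have "(\<Sum>c<?n. H a c * (\<Sum>d<?n. H b d * B c d)) = (\<Sum>d<?n. \<Sum>c<?n. H b d * (H a c * B c d))"
      by (subst sum.swap) (simp only: sum_distrib_left mult.left_commute)
    also have "\<dots> = (\<Sum>d<?n. H b d * (\<Sum>c<?n. H a c * B c d))"
      by (simp only: sum_distrib_left)
    also have "\<dots> = (\<Sum>d<?n. H b d * C a d)"
      unfolding B_def using that by (simp only: orthogonal_apply_twice[OF HH])
    also have "\<dots> = A a b"
      unfolding C_def using that by (simp only: orthogonal_apply_twice[OF HH])
    finally show ?thesis ..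
  qed
  from Suc.IH[of "\<lambda>i j. B (Suc i) (Suc j)", OF Bs] obtain u3 l3 where
    u3: "\<forall>a<m. \<forall>b<m. (\<Sum>i<m. u3 i a * u3 i b) = of_bool (a = b)"
    and B3: "\<forall>a<m. \<forall>b<m. B (Suc a) (Suc b) = (\<Sum>i<m. l3 i * u3 i a * u3 i b)"
    by blast
  \<comment> \<open>Eigenvectors of \<open>B\<close>: the first unit vector, and those of the block
    extended by a leading 0. Applying \<open>H\<close> gives those of \<open>A\<close>.\<close>
  define u :: "nat \<Rightarrow> nat \<Rightarrow> real" where "u i a = (case i of 0 \<Rightarrow> of_bool (a = 0)
      | Suc i' \<Rightarrow> (case a of 0 \<Rightarrow> 0 | Suc a' \<Rightarrow> u3 i' a'))" for i a
  define l where "l i = (case i of 0 \<Rightarrow> e | Suc i' \<Rightarrow> l3 i')" for i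
  have u1: "(\<Sum>i<?n. 1 * u i a * u i b) = of_bool (a = b)" if "a < ?n" "b < ?n" for a b
    unfolding sum.lessThan_Suc_shift
    using that u3 by (cases a; cases b) (simp_all add: u_def)
  have B1: "(\<Sum>i<?n. l i * u i a * u i b) = B a b" if "a < ?n" "b < ?n" for a b
    unfolding sum.lessThan_Suc_shift
    using that B3 B0[of a] B0[of b] Bs[of 0 b] by (cases a; cases b) (simp_all add: u_def l_def)
  define u' where "u' i a = (\<Sum>c<?n. H a c * u i c)" for i a
  have "(\<Sum>i<?n. u' i a * u' i b) = of_bool (a = b)" if "a < ?n" "b < ?n" for a b
  proof -
    have "(\<Sum>i<?n. u' i a * u' i b) = (\<Sum>i<?n. 1 * u' i a * u' i b)" by simp
    also have "\<dots> = (\<Sum>c<?n. H a c * (\<Sum>d<?n. H b d * (\<Sum>i<?n. 1 * u i c * u i d)))"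
      unfolding u'_def by (rule sum_bilinear_transform)
    also have "\<dots> = (\<Sum>c<?n. H a c * (\<Sum>d<?n. of_bool (c = d) * H b d))"
      using u1 by (intro sum.cong refl arg_cong[of _ _ "(*) _"]) auto
    also have "\<dots> = (\<Sum>c<?n. H a c * H b c)"
      by (intro sum.cong refl) (simp only: sum_of_bool_left lessThan_iff)
    finally show ?thesis using HH[OF that] by simp
  qed
  moreover have "A a b = (\<Sum>i<?n. l i * u' i a * u' i b)" if "a < ?n" "b < ?n" for a b
  proof -
    have "(\<Sum>i<?n. l i * u' i a * u' i b)
        = (\<Sum>c<?n. H a c * (\<Sum>d<?n. H b d * (\<Sum>i<?n. l i * u i c * u i d)))"
      unfolding u'_def by (rule sum_bilinear_transform)
    also have "\<dots> = (\<Sum>c<?n. H a c * (\<Sum>d<?n. H b d * B c d))"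
      using B1 by (intro sum.cong refl arg_cong[of _ _ "(*) _"]) auto
    finally show ?thesis using AB[OF that] by simp
  qed
  ultimately show ?case by blast
qed

definition spectral_decomp ::
    "nat \<Rightarrow> (nat \<Rightarrow> nat \<Rightarrow> real) \<Rightarrow> (nat \<Rightarrow> nat \<Rightarrow> real) \<Rightarrow> (nat \<Rightarrow> real) \<Rightarrow> bool" where
  "spectral_decomp n A u l \<longleftrightarrow>
    (\<forall>a<n. \<forall>b<n. (\<Sum>i<n. u i a * u i b) = of_bool (a = b)) \<and>
    (\<forall>i<n. \<forall>j<n. (\<Sum>a<n. u i a * u j a) = of_bool (i = j)) \<and>
    (\<forall>a<n. \<forall>b<n. A a b = (\<Sum>i<n. l i * u i a * u i b))"

theorem spectral_theorem:
  assumes "\<And>i j. i < n \<Longrightarrow> j < n \<Longrightarrow> A i j = A j i"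
  obtains u l where "spectral_decomp n A u l"
proof -
  obtain u l where *: "\<forall>a<n. \<forall>b<n. (\<Sum>i<n. u i a * u i b) = of_bool (a = b)"
    "\<forall>a<n. \<forall>b<n. A a b = (\<Sum>i<n. l i * u i a * u i b)"
    using spectral_theorem_aux[of n A, OF assms] by blast
  with orthogonal_transpose[of n u] show ?thesis
    by (intro that[of u l]) (auto simp: spectral_decomp_def)
qed

section \<open>Empirical distribution, stability of Lipschitz averages, and traces\<close>

lemma spectral_decomp_char_poly:
  assumes "spectral_decomp n A u l"
  shows "char_poly (Matrix.mat n n (\<lambda>(i, j). A i j)) = (\<Prod>i\<leftarrow>[0..<n]. [:- l i, 1:])"
proof -
  define U where "U = Matrix.mat n n (\<lambda>(i, a). u i a)"
  define D where "D = Matrix.mat n n (\<lambda>(i, j). if i = j then l i else 0)"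
  let ?A = "Matrix.mat n n (\<lambda>(i, j). A i j)"
  have U: "U \<in> carrier_mat n n" "transpose_mat U \<in> carrier_mat n n" by (auto simp: U_def)
  have D: "D \<in> carrier_mat n n" by (simp add: D_def)
  have 1: "transpose_mat U * U = 1\<^sub>m n" "U * transpose_mat U = 1\<^sub>m n"
    using assms unfolding spectral_decomp_def
    by (intro eq_matI; simp add: U_def scalar_prod_def atLeast0LessThan)+
  have DU: "D * U = Matrix.mat n n (\<lambda>(i, a). l i * u i a)"
    by (rule eq_matI) (auto simp: D_def U_def scalar_prod_def atLeast0LessThan
      if_distrib[of "\<lambda>x. x * _"] cong: if_cong)
  have "?A = transpose_mat U * (D * U)"
    unfolding DU using assms unfolding spectral_decomp_def
    by (intro eq_matI; simp add: U_def scalar_prod_def atLeast0LessThan mult_ac)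
  hence "?A = transpose_mat U * D * U" using U D by (simp add: assoc_mult_mat)
  hence "similar_mat_wit ?A D (transpose_mat U) U"
    using U D 1 by (auto simp: similar_mat_wit_def Let_def)
  hence "char_poly ?A = char_poly D"
    by (intro char_poly_similar) (auto simp: similar_mat_def)
  also have "\<dots> = (\<Prod>a\<leftarrow>diag_mat D. [:- a, 1:])"
    by (rule char_poly_upper_triangular[OF D]) (auto simp: D_def)
  also have "diag_mat D = map l [0..<n]"
    by (auto simp: diag_mat_def D_def intro!: nth_equalityI)
  finally show ?thesis by (simp add: comp_def)
qed

lemma proots_linear_product:
  "proots (\<Prod>i\<leftarrow>xs. [:- l i, 1::real:]) = image_mset l (mset xs)"
proof (induction xs)
  case (Cons a xs)
  have "monic (\<Prod>i\<leftarrow>xs. [:- l i, 1::real:])" by (rule monic_prod_list) auto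
  hence "(\<Prod>i\<leftarrow>xs. [:- l i, 1::real:]) \<noteq> 0" by auto
  thus ?case using Cons by (simp add: proots_mult del: mult_pCons_left)
qed simp

lemma esd_spectral:
  assumes "spectral_decomp n A u l"
  shows "esd (Matrix.mat n n (\<lambda>(i, j). A i j)) t = real (card {i. i < n \<and> l i \<le> t}) / real n"
proof -
  have "proots (char_poly (Matrix.mat n n (\<lambda>(i, j). A i j))) = image_mset l (mset [0..<n])"
    unfolding spectral_decomp_char_poly[OF assms] by (rule proots_linear_product)
  moreover have "size (filter_mset (\<lambda>x. x \<le> t) (image_mset l (mset [0..<n]))) =
      card {i. i < n \<and> l i \<le> t}"
    by (simp add: filter_mset_image_mset comp_def)
  ultimately show ?thesis by (simp add: esd_def)
qed

text \<open>With \<open>w i j = \<langle>u i, v j\<rangle>\<^sup>2\<close>, a doubly stochastic matrix, one has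
  \<open>\<Sum> f (l i) - \<Sum> f (m j) = \<Sum> w i j (f (l i) - f (m j))\<close> and
  \<open>\<Sum> w i j (l i - m j)\<^sup>2 = \<parallel>A - B\<parallel>\<^sup>2\<close> (Frobenius), so Cauchy-Schwarz applies.\<close>
lemma spectral_lipschitz:
  assumes A: "spectral_decomp n A u l" and B: "spectral_decomp n B v m"
    and L: "\<And>s t. \<bar>f s - f t\<bar> \<le> L * \<bar>s - t\<bar>"
  shows "\<bar>(\<Sum>i<n. f (l i)) - (\<Sum>i<n. f (m i))\<bar>
    \<le> L * sqrt (real n * (\<Sum>a<n. \<Sum>b<n. (A a b - B a b)\<^sup>2))"
proof -
  note SA = A[unfolded spectral_decomp_def] and SB = B[unfolded spectral_decomp_def]
  define p where "p i j = (\<Sum>a<n. u i a * v j a)" for i j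
  define w where "w i j = (p i j)\<^sup>2" for i j
  have parseval: "(\<Sum>i<n. (\<Sum>a<n. x i a * y a)\<^sup>2) = (\<Sum>a<n. (y a)\<^sup>2)"
    if "\<And>a b. a < n \<Longrightarrow> b < n \<Longrightarrow> (\<Sum>i<n. x i a * x i b) = of_bool (a = b)"
    for x :: "nat \<Rightarrow> nat \<Rightarrow> real" and y
  proof -
    have "(\<Sum>i<n. (\<Sum>a<n. x i a * y a)\<^sup>2) = (\<Sum>i<n. 1 * (\<Sum>a<n. y a * x i a) * (\<Sum>b<n. y b * x i b))"
      by (simp add: power2_eq_square mult_ac)
    also have "\<dots> = (\<Sum>a<n. y a * (\<Sum>b<n. y b * (\<Sum>i<n. 1 * x i a * x i b)))"
      by (rule sum_bilinear_transform[where H = "\<lambda>_. y"])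
    also have "\<dots> = (\<Sum>a<n. y a * (\<Sum>b<n. of_bool (a = b) * y b))"
      using that by (intro sum.cong refl arg_cong[of _ _ "(*) _"]) auto
    finally show ?thesis by (simp add: sum_of_bool_left power2_eq_square)
  qed
  have row: "(\<Sum>j<n. w i j) = 1" if "i < n" for i
  proof -
    have "(\<Sum>j<n. w i j) = (\<Sum>j<n. (\<Sum>a<n. v j a * u i a)\<^sup>2)"
      by (simp add: w_def p_def mult.commute)
    also have "\<dots> = (\<Sum>a<n. (u i a)\<^sup>2)" by (rule parseval) (use SB in auto)
    finally show ?thesis using SA that by (auto simp: power2_eq_square)
  qed
  have col: "(\<Sum>i<n. w i j) = 1" if "j < n" for j
  proof -
    have "(\<Sum>i<n. w i j) = (\<Sum>a<n. (v j a)\<^sup>2)"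
      unfolding w_def p_def by (rule parseval) (use SA in auto)
    thus ?thesis using SB that by (auto simp: power2_eq_square)
  qed
  \<comment> \<open>\<open>p i j * (l i - m j)\<close> is the entry of \<open>A - B\<close> in the
    two eigenbases, so Parseval applies once in each index.\<close>
  have frob: "(\<Sum>i<n. \<Sum>j<n. w i j * (l i - m j)\<^sup>2) = (\<Sum>a<n. \<Sum>b<n. (A a b - B a b)\<^sup>2)"
  proof -
    have act: "(\<Sum>a<n. x i a * (\<Sum>k<n. q k * x k a * x k b)) = q i * x i b"
      if "\<And>i j. i < n \<Longrightarrow> j < n \<Longrightarrow> (\<Sum>a<n. x i a * x j a) = of_bool (i = j)" "i < n"
      for x :: "nat \<Rightarrow> nat \<Rightarrow> real" and q i b
    proof -
      have "(\<Sum>a<n. x i a * (\<Sum>k<n. q k * x k a * x k b))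
          = (\<Sum>a<n. \<Sum>k<n. x i a * x k a * (q k * x k b))" by (simp add: sum_distrib_left mult_ac)
      also have "\<dots> = (\<Sum>k<n. (\<Sum>a<n. x i a * x k a) * (q k * x k b))"
        by (subst sum.swap) (simp add: sum_distrib_right)
      also have "\<dots> = (\<Sum>k<n. of_bool (i = k) * (q k * x k b))"
        using that by (intro sum.cong) auto
      finally show ?thesis using that by (simp add: sum_of_bool_left)
    qed
    have key: "(\<Sum>b<n. v j b * (\<Sum>a<n. u i a * (A a b - B a b))) = p i j * (l i - m j)"
      if "i < n" "j < n" for i j
    proof -
      have "(\<Sum>b<n. v j b * (\<Sum>a<n. u i a * A a b)) = (\<Sum>b<n. v j b * (l i * u i b))"
      proof (intro sum.cong refl)
        fix b assume "b \<in> {..<n}"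
        hence "(\<Sum>a<n. u i a * A a b) = (\<Sum>a<n. u i a * (\<Sum>k<n. l k * u k a * u k b))"
          using SA by (intro sum.cong) auto
        also have "\<dots> = l i * u i b" by (rule act) (use SA that in auto)
        finally show "v j b * (\<Sum>a<n. u i a * A a b) = v j b * (l i * u i b)" by simp
      qed
      also have "\<dots> = l i * p i j" by (simp add: p_def sum_distrib_left mult_ac)
      finally have 1: "(\<Sum>b<n. v j b * (\<Sum>a<n. u i a * A a b)) = l i * p i j" .
      have "(\<Sum>b<n. v j b * (\<Sum>a<n. u i a * B a b)) = (\<Sum>b<n. \<Sum>a<n. u i a * (v j b * B a b))"
        by (simp add: sum_distrib_left mult_ac)
      also have "\<dots> = (\<Sum>a<n. u i a * (\<Sum>b<n. v j b * B a b))"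
        by (subst sum.swap) (simp add: sum_distrib_left)
      also have "\<dots> = (\<Sum>a<n. u i a * (m j * v j a))"
      proof (intro sum.cong refl)
        fix a assume "a \<in> {..<n}"
        hence "(\<Sum>b<n. v j b * B a b) = (\<Sum>b<n. v j b * (\<Sum>k<n. m k * v k b * v k a))"
          using SB by (intro sum.cong) (auto simp: mult_ac)
        also have "\<dots> = m j * v j a" by (rule act) (use SB that in auto)
        finally show "u i a * (\<Sum>b<n. v j b * B a b) = u i a * (m j * v j a)" by simp
      qed
      also have "\<dots> = m j * p i j" by (simp add: p_def sum_distrib_left mult_ac)
      finally have 2: "(\<Sum>b<n. v j b * (\<Sum>a<n. u i a * B a b)) = m j * p i j" .
      show ?thesis using 1 2 by (simp add: right_diff_distrib sum_subtractf mult_ac)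
    qed
    have "(\<Sum>i<n. \<Sum>j<n. w i j * (l i - m j)\<^sup>2)
        = (\<Sum>i<n. \<Sum>j<n. (\<Sum>b<n. v j b * (\<Sum>a<n. u i a * (A a b - B a b)))\<^sup>2)"
      by (intro sum.cong refl) (auto simp: key w_def power_mult_distrib)
    also have "\<dots> = (\<Sum>i<n. \<Sum>b<n. (\<Sum>a<n. u i a * (A a b - B a b))\<^sup>2)"
      by (intro sum.cong refl parseval) (use SB in auto)
    also have "\<dots> = (\<Sum>b<n. \<Sum>i<n. (\<Sum>a<n. u i a * (A a b - B a b))\<^sup>2)" by (rule sum.swap)
    also have "\<dots> = (\<Sum>b<n. \<Sum>a<n. (A a b - B a b)\<^sup>2)"
      by (intro sum.cong refl parseval) (use SA in auto)
    also have "\<dots> = (\<Sum>a<n. \<Sum>b<n. (A a b - B a b)\<^sup>2)" by (rule sum.swap)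
    finally show ?thesis .
  qed
  have L0: "L \<ge> 0" using L[of 0 1] by simp
  have "(\<Sum>i<n. f (l i)) - (\<Sum>j<n. f (m j))
      = (\<Sum>i<n. \<Sum>j<n. w i j * f (l i)) - (\<Sum>j<n. \<Sum>i<n. w i j * f (m j))"
    using row col by (simp flip: sum_distrib_right)
  also have "\<dots> = (\<Sum>i<n. \<Sum>j<n. w i j * (f (l i) - f (m j)))"
    by (subst (2) sum.swap) (simp add: right_diff_distrib sum_subtractf)
  finally have "\<bar>(\<Sum>i<n. f (l i)) - (\<Sum>i<n. f (m i))\<bar> \<le> (\<Sum>i<n. \<Sum>j<n. w i j * \<bar>f (l i) - f (m j)\<bar>)"
    by (auto intro!: order.trans[OF sum_abs] sum_mono simp: abs_mult w_def)
  also have "\<dots> \<le> (\<Sum>i<n. \<Sum>j<n. w i j * (L * \<bar>l i - m j\<bar>))"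
    by (intro sum_mono mult_left_mono L) (simp add: w_def)
  \<comment> \<open>One factor \<open>\<bar>p i j\<bar>\<close> goes to each side of Cauchy-Schwarz:
    the squares of the first side add up to \<open>n\<close>, as the rows of \<open>w\<close> sum to
    1, those of the second to the squared Frobenius norm.\<close>
  also have "\<dots> = L * (\<Sum>i<n. \<Sum>j<n. \<bar>p i j\<bar> * (\<bar>p i j\<bar> * \<bar>l i - m j\<bar>))"
    unfolding sum_distrib_left
    by (intro sum.cong refl) (simp add: w_def flip: power2_eq_square mult.assoc)
  also have "\<dots> \<le> L * sqrt (real n * (\<Sum>i<n. \<Sum>j<n. w i j * (l i - m j)\<^sup>2))"
  proof (intro mult_left_mono L0)
    let ?I = "{..<n} \<times> {..<n}"
    have "(\<Sum>z\<in>?I. (case z of (i, j) \<Rightarrow> \<bar>p i j\<bar>) * (case z of (i, j) \<Rightarrow> \<bar>p i j\<bar> * \<bar>l i - m j\<bar>))\<^sup>2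
        \<le> (\<Sum>z\<in>?I. (case z of (i, j) \<Rightarrow> \<bar>p i j\<bar>)\<^sup>2) *
          (\<Sum>z\<in>?I. (case z of (i, j) \<Rightarrow> \<bar>p i j\<bar> * \<bar>l i - m j\<bar>)\<^sup>2)"
      by (rule Cauchy_Schwarz_ineq_sum)
    also have "(\<Sum>z\<in>?I. (case z of (i, j) \<Rightarrow> \<bar>p i j\<bar>)\<^sup>2) = real n"
    proof -
      have "(\<Sum>z\<in>?I. (case z of (i, j) \<Rightarrow> \<bar>p i j\<bar>)\<^sup>2) = (\<Sum>i<n. \<Sum>j<n. w i j)"
        by (subst sum.cartesian_product) (auto simp: w_def intro!: sum.cong)
      thus ?thesis using row by simp
    qed
    also have "(\<Sum>z\<in>?I. (case z of (i, j) \<Rightarrow> \<bar>p i j\<bar> * \<bar>l i - m j\<bar>)\<^sup>2)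
        = (\<Sum>i<n. \<Sum>j<n. w i j * (l i - m j)\<^sup>2)"
      by (subst sum.cartesian_product) (auto simp: w_def power_mult_distrib intro!: sum.cong)
    also have "(\<Sum>z\<in>?I. (case z of (i, j) \<Rightarrow> \<bar>p i j\<bar>) * (case z of (i, j) \<Rightarrow> \<bar>p i j\<bar> * \<bar>l i - m j\<bar>))
        = (\<Sum>i<n. \<Sum>j<n. \<bar>p i j\<bar> * (\<bar>p i j\<bar> * \<bar>l i - m j\<bar>))"
      by (subst sum.cartesian_product) (auto intro!: sum.cong)
    finally show "(\<Sum>i<n. \<Sum>j<n. \<bar>p i j\<bar> * (\<bar>p i j\<bar> * \<bar>l i - m j\<bar>))
        \<le> sqrt (real n * (\<Sum>i<n. \<Sum>j<n. w i j * (l i - m j)\<^sup>2))"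
      by (rule real_le_rsqrt)
  qed
  finally show ?thesis by (simp only: frob)
qed

fun mat_power_entry :: "nat \<Rightarrow> (nat \<Rightarrow> nat \<Rightarrow> real) \<Rightarrow> nat \<Rightarrow> nat \<Rightarrow> nat \<Rightarrow> real" where
  "mat_power_entry n A 0 a b = of_bool (a = b)"
| "mat_power_entry n A (Suc h) a b = (\<Sum>c<n. A a c * mat_power_entry n A h c b)"

lemma trace_mat_power_spectral:
  assumes "spectral_decomp n A u l"
  shows "(\<Sum>a<n. mat_power_entry n A h a a) = (\<Sum>i<n. l i ^ h)"
proof -
  note SA = assms[unfolded spectral_decomp_def]
  have *: "mat_power_entry n A h a b = (\<Sum>i<n. l i ^ h * u i a * u i b)" if "a < n" "b < n" for a b
    using that
  proof (induction h arbitrary: a)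
    case 0
    thus ?case using SA by simp
  next
    case (Suc h)
    have "mat_power_entry n A (Suc h) a b
        = (\<Sum>c<n. (\<Sum>i<n. l i * u i a * u i c) * (\<Sum>j<n. l j ^ h * u j c * u j b))"
      using Suc SA by (simp only: mat_power_entry.simps) (auto intro!: sum.cong)
    also have "\<dots> = (\<Sum>c<n. \<Sum>i<n. \<Sum>j<n. l i * u i a * (l j ^ h * u j b) * (u i c * u j c))"
      unfolding sum_product by (simp add: mult_ac)
    also have "\<dots> = (\<Sum>i<n. \<Sum>c<n. \<Sum>j<n. l i * u i a * (l j ^ h * u j b) * (u i c * u j c))"
      by (rule sum.swap)
    also have "\<dots> = (\<Sum>i<n. \<Sum>j<n. l i * u i a * (l j ^ h * u j b) * (\<Sum>c<n. u i c * u j c))"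
      by (rule sum.cong[OF refl], subst sum.swap) (simp add: sum_distrib_left)
    also have "\<dots> = (\<Sum>i<n. \<Sum>j<n. of_bool (i = j) * (l i * u i a * (l j ^ h * u j b)))"
      using SA by (intro sum.cong refl) auto
    also have "\<dots> = (\<Sum>i<n. l i * u i a * (l i ^ h * u i b))"
      by (intro sum.cong refl) (simp only: sum_of_bool_left lessThan_iff)
    finally show ?case by (simp add: mult_ac)
  qed
  have "(\<Sum>a<n. mat_power_entry n A h a a) = (\<Sum>a<n. \<Sum>i<n. l i ^ h * (u i a * u i a))"
    by (auto simp: * mult_ac intro!: sum.cong)
  also have "\<dots> = (\<Sum>i<n. l i ^ h * (\<Sum>a<n. u i a * u i a))"
    by (subst sum.swap) (simp add: sum_distrib_left)
  also have "\<dots> = (\<Sum>i<n. l i ^ h)" using SA by (intro sum.cong) auto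
  finally show ?thesis .
qed

subsection \<open>Sums over pairs of closed walks\<close>

text \<open>Both ends are stored, so \<open>h\<close> steps take \<open>Suc h\<close> entries and
  length 0 gives the single vertices.\<close>

definition closed_walks :: "nat \<Rightarrow> nat \<Rightarrow> nat list set" where
  "closed_walks n h = {vs \<in> lists_below n (Suc h). last vs = hd vs}"

lemma finite_closed_walks [simp]: "finite (closed_walks n h)"
  by (simp add: closed_walks_def)

definition walk_weight :: "(nat \<times> nat \<Rightarrow> real) \<Rightarrow> nat list \<Rightarrow> real" where
  "walk_weight A vs = prod_list (map A (walk_edges (hd vs) (tl vs)))"

lemma mat_power_entry_walks:
  assumes "a < n"
  shows "mat_power_entry n A h a b = (\<Sum>vs\<in>lists_below n h.
    of_bool (last (a # vs) = b) * prod_list (map (case_prod A) (walk_edges a vs)))"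
  using assms
proof (induction h arbitrary: a)
  case 0
  thus ?case by simp
next
  case (Suc h)
  have "mat_power_entry n A (Suc h) a b = (\<Sum>c<n. A a c * (\<Sum>vs\<in>lists_below n h.
      of_bool (last (c # vs) = b) * prod_list (map (case_prod A) (walk_edges c vs))))"
    using Suc by simp
  also have "\<dots> = (\<Sum>c<n. \<Sum>vs\<in>lists_below n h. of_bool (last (a # c # vs) = b) *
      prod_list (map (case_prod A) (walk_edges a (c # vs))))"
    unfolding sum_distrib_left by (intro sum.cong refl) (simp add: mult_ac)
  finally show ?case unfolding sum_lists_below_Suc .
qed

lemma trace_mat_power_walks:
  "(\<Sum>a<n. mat_power_entry n A h a a) = (\<Sum>vs\<in>closed_walks n h. walk_weight (case_prod A) vs)"
proof -
  have "(\<Sum>a<n. mat_power_entry n A h a a) = (\<Sum>vs\<in>lists_below n (Suc h).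
      of_bool (last vs = hd vs) * walk_weight (case_prod A) vs)"
    unfolding sum_lists_below_Suc by (intro sum.cong) (auto simp: mat_power_entry_walks walk_weight_def)
  also have "\<dots> = (\<Sum>vs\<in>closed_walks n h. walk_weight (case_prod A) vs)"
    unfolding closed_walks_def by (intro sum.mono_neutral_cong_right) auto
  finally show ?thesis .
qed

section \<open>Counting pairs of tree walks\<close>

definition rooted_tree_walk :: "nat set \<Rightarrow> nat list \<Rightarrow> bool" where
  "rooted_tree_walk U vs \<longleftrightarrow> generic U (hd vs) \<and> tree_walk (insert (hd vs) U) [hd vs] (tl vs)"

lemma tree_walk_pair_rooted:
  "tree_walk_pair vs ws \<longleftrightarrow> rooted_tree_walk {} vs \<and> rooted_tree_walk (set vs) ws"
  by (simp add: tree_walk_pair_def rooted_tree_walk_def)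

lemma rooted_tree_walk_last: "rooted_tree_walk U vs \<Longrightarrow> vs \<noteq> [] \<Longrightarrow> last vs = hd vs"
  using tree_walk_last[of "insert (hd vs) U" "hd vs" "[]" "tl vs"]
  by (cases vs) (auto simp: rooted_tree_walk_def)

lemma card_rooted_tree_walk_le:
  "real (card {vs \<in> lists_below n (Suc h). rooted_tree_walk U vs}) \<le> real n * dyck_weight h 0 (real n)"
proof -
  have "real (card {vs \<in> lists_below n h. rooted_tree_walk U (v # vs)}) \<le> dyck_weight h 0 (real n)" for v
  proof -
    have "card {vs \<in> lists_below n h. rooted_tree_walk U (v # vs)}
        \<le> card {vs \<in> lists_below n h. tree_walk (insert v U) [v] vs}"
      by (intro card_mono) (auto simp: rooted_tree_walk_def)
    also have "real \<dots> \<le> dyck_weight h 0 (real n)"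
      using card_tree_walk_le[of "[v]" n h "insert v U"] by simp
    finally show ?thesis by simp
  qed
  hence "(\<Sum>v<n. real (card {vs \<in> lists_below n h. rooted_tree_walk U (v # vs)}))
      \<le> (\<Sum>v<n. dyck_weight h 0 (real n))" by (intro sum_mono)
  thus ?thesis unfolding card_lists_below_Suc of_nat_sum by simp
qed

lemma card_rooted_tree_walk_ge:
  assumes "finite U" "card U + Suc h \<le> N" "17 ^ Suc N \<le> n"
  shows "(real n - 17 ^ Suc N) * dyck_weight h 0 (real n - 17 ^ Suc N)
    \<le> real (card {vs \<in> lists_below n (Suc h). rooted_tree_walk U vs})"
proof -
  define q where "q = real n - 17 ^ Suc N"
  have "real (17 ^ Suc N) \<le> real n" using assms(3) by (simp only: of_nat_le_iff)
  hence q: "q \<ge> 0" by (simp add: q_def)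
  have "of_bool (generic U v) * dyck_weight h 0 q
      \<le> real (card {vs \<in> lists_below n h. rooted_tree_walk U (v # vs)})" if "v < n" for v
  proof (cases "generic U v")
    case True
    have "card (insert v U) + h \<le> N" using assms(1,2) by (simp add: card_insert_if)
    hence "dyck_weight h 0 q \<le> real (card {vs \<in> lists_below n h. tree_walk (insert v U) [v] vs})"
      using card_tree_walk_ge[of "[v]" "insert v U" h N n] assms that by (simp add: q_def)
    thus ?thesis using True by (simp add: rooted_tree_walk_def)
  qed simp
  hence "(\<Sum>v<n. of_bool (generic U v) * dyck_weight h 0 q)
      \<le> (\<Sum>v<n. real (card {vs \<in> lists_below n h. rooted_tree_walk U (v # vs)}))"
    by (intro sum_mono) auto
  moreover have "q \<le> (\<Sum>v<n. of_bool (generic U v))"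
    unfolding q_def using assms(1,2) by (intro sum_generic_ge) auto
  hence "q * dyck_weight h 0 q \<le> (\<Sum>v<n. of_bool (generic U v)) * dyck_weight h 0 q"
    by (intro mult_right_mono dyck_weight_nonneg q)
  ultimately show ?thesis
    unfolding card_lists_below_Suc of_nat_sum q_def[symmetric] by (simp add: sum_distrib_right)
qed

text \<open>Bernoulli's inequality in homogeneous form: a bounded loss in each free choice costs
  only one order of magnitude.\<close>

lemma power_diff_ge:
  fixes x q :: real
  assumes "0 \<le> q" "q \<le> x"
  shows "x ^ Suc m - real (Suc m) * q * x ^ m \<le> (x - q) ^ Suc m"
proof (induction m)
  case (Suc m)
  have "x ^ Suc (Suc m) - real (Suc (Suc m)) * q * x ^ Suc m
      \<le> (x - q) * (x ^ Suc m - real (Suc m) * q * x ^ m)"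
    using assms by (simp add: algebra_simps)
  also have "\<dots> \<le> (x - q) * (x - q) ^ Suc m" using Suc assms by (intro mult_left_mono) auto
  finally show ?case by simp
qed simp

text \<open>For even lengths the two trees have \<open>h div 2 + h' div 2 = K\<close> pushes and two
  roots, hence \<open>K + 2\<close> free vertices; their shapes are counted by the product of the
  Dyck path numbers. Each free choice loses at most \<open>17 ^ Suc N\<close> vertices.\<close>

lemma card_tree_walk_pairs:
  fixes h h' K n :: nat
  assumes "h + h' = 2 * K"
  defines "N \<equiv> Suc h + Suc h'" and "cc \<equiv> semicircle_moment h * semicircle_moment h'"
  defines "T \<equiv> {(vs, ws). vs \<in> lists_below n (Suc h) \<and> ws \<in> lists_below n (Suc h') \<and> tree_walk_pair vs ws}"
  shows "real (card T) \<le> cc * real n ^ (K + 2)"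
    and "cc * real n ^ (K + 2) - cc * real (K + 2) * 17 ^ Suc N * real n ^ (K + 1) \<le> real (card T)"
proof -
  have cc: "cc \<ge> 0" by (simp add: cc_def semicircle_moment_nonneg)
  have hom: "q * dyck_weight h 0 q * (q * dyck_weight h' 0 q) = cc * q ^ (K + 2)" for q
  proof (cases "even h")
    case True
    hence "even h'" using assms(1) by presburger
    hence "h div 2 + h' div 2 = K" using True assms(1) by auto
    hence "q ^ (h div 2) * q ^ (h' div 2) = q ^ K" by (metis power_add)
    moreover have "q * dyck_weight h 0 q * (q * dyck_weight h' 0 q)
        = cc * (q * q) * (q ^ (h div 2) * q ^ (h' div 2))"
      unfolding dyck_weight_homogeneous[of h] dyck_weight_homogeneous[of h'] cc_def
      by (simp only: mult_ac)
    ultimately show ?thesis by (simp add: power_add power2_eq_square)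
  next
    case False
    thus ?thesis by (simp add: cc_def semicircle_moment_odd dyck_weight_vanish)
  qed
  define R where "R = {vs \<in> lists_below n (Suc h). rooted_tree_walk {} vs}"
  have T: "T = Sigma R (\<lambda>vs. {ws \<in> lists_below n (Suc h'). rooted_tree_walk (set vs) ws})"
    by (auto simp: T_def R_def tree_walk_pair_rooted)
  have R: "finite R" by (simp add: R_def)
  have cT: "real (card T)
      = (\<Sum>vs\<in>R. real (card {ws \<in> lists_below n (Suc h'). rooted_tree_walk (set vs) ws}))"
    unfolding T by (subst card_SigmaI) (use R in auto)
  have "real (card T) \<le> (\<Sum>vs\<in>R. real n * dyck_weight h' 0 (real n))"
    unfolding cT by (intro sum_mono card_rooted_tree_walk_le)
  also have "\<dots> = real (card R) * (real n * dyck_weight h' 0 (real n))" by simp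
  also have "\<dots> \<le> (real n * dyck_weight h 0 (real n)) * (real n * dyck_weight h' 0 (real n))"
    unfolding R_def by (intro mult_right_mono card_rooted_tree_walk_le) (auto simp: dyck_weight_nonneg)
  finally show "real (card T) \<le> cc * real n ^ (K + 2)" unfolding hom .
  define q where "q = real n - 17 ^ Suc N"
  show "cc * real n ^ (K + 2) - cc * real (K + 2) * 17 ^ Suc N * real n ^ (K + 1) \<le> real (card T)"
  proof (cases "17 ^ Suc N \<le> n")
    case True
    hence "real (17 ^ Suc N) \<le> real n" by (simp only: of_nat_le_iff)
    hence Q: "17 ^ Suc N \<le> real n" by simp
    hence q: "q \<ge> 0" by (simp add: q_def)
    have "cc * real n ^ (K + 2) - cc * real (K + 2) * 17 ^ Suc N * real n ^ (K + 1)
        = cc * (real n ^ Suc (K + 1) - real (Suc (K + 1)) * 17 ^ Suc N * real n ^ (K + 1))"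
      by (simp add: algebra_simps)
    also have "\<dots> \<le> cc * q ^ (K + 2)"
      using power_diff_ge[OF _ Q, of "K + 1"] cc unfolding q_def
      by (intro mult_left_mono) auto
    also have "\<dots> = q * dyck_weight h 0 q * (q * dyck_weight h' 0 q)" by (simp only: hom)
    also have "\<dots> \<le> real (card R) * (q * dyck_weight h' 0 q)"
      using card_rooted_tree_walk_ge[of "{}" h N n] True q unfolding R_def q_def[symmetric]
      by (intro mult_right_mono) (auto simp: N_def dyck_weight_nonneg)
    also have "\<dots> = (\<Sum>vs\<in>R. q * dyck_weight h' 0 q)" by simp
    also have "\<dots> \<le> real (card T)"
      unfolding cT
    proof (intro sum_mono)
      fix vs assume "vs \<in> R"
      hence "card (set vs) \<le> Suc h" using card_length[of vs] by (auto simp: R_def lists_below_def)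
      thus "q * dyck_weight h' 0 q \<le> real (card {ws \<in> lists_below n (Suc h'). rooted_tree_walk (set vs) ws})"
        unfolding q_def by (intro card_rooted_tree_walk_ge) (use True in \<open>auto simp: N_def\<close>)
    qed
    finally show ?thesis .
  next
    case False
    \<comment> \<open>For small \<open>n\<close> the claimed lower bound is not positive.\<close>
    hence "real n \<le> real (17 ^ Suc N)" by (simp only: of_nat_le_iff)
    moreover have "1 * 17 ^ Suc N \<le> real (K + 2) * 17 ^ Suc N" by (rule mult_right_mono) auto
    ultimately have "real n \<le> real (K + 2) * 17 ^ Suc N"
      by (simp only: of_nat_power of_nat_numeral mult_1)
    hence "cc * (real n ^ (K + 1) * real n) \<le> cc * (real n ^ (K + 1) * (real (K + 2) * 17 ^ Suc N))"
      using cc by (intro mult_left_mono) auto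
    hence "cc * real n ^ (K + 2) - cc * real (K + 2) * 17 ^ Suc N * real n ^ (K + 1) \<le> 0"
      by (simp add: mult_ac)
    thus ?thesis by linarith
  qed
qed

text \<open>Tree pairs contribute 1 each. A pair that is no tree pair has value 0 if it has at least
  \<open>K + 2\<close> generic vertices, by the dichotomy; those with fewer are O(n ^ (K + 1)) in
  number, with values at most \<open>D\<close>. The function \<open>e\<close> is arbitrary so that
  this stays free of probability, and \<open>C\<close> is chosen before \<open>n\<close> and
  \<open>e\<close>.\<close>

lemma pair_sum_asymptotics:
  assumes K: "h + h' = 2 * K" and "D \<ge> 0"
  obtains C where "\<And>n e. n > 0 \<Longrightarrow>
      (\<And>vs ws. vs \<in> closed_walks n h \<Longrightarrow> ws \<in> closed_walks n h' \<Longrightarrow> \<bar>e vs ws\<bar> \<le> D) \<Longrightarrow>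
      (\<And>vs ws. vs \<in> closed_walks n h \<Longrightarrow> ws \<in> closed_walks n h' \<Longrightarrow> tree_walk_pair vs ws \<Longrightarrow> e vs ws = 1) \<Longrightarrow>
      (\<And>vs ws f a. vs \<in> closed_walks n h \<Longrightarrow> ws \<in> closed_walks n h' \<Longrightarrow> f \<in> {toeplitz_index, hankel_index} \<Longrightarrow>
         count_list (map f (pair_edges vs ws)) a = 1 \<Longrightarrow> e vs ws = 0) \<Longrightarrow>
      \<bar>(\<Sum>vs\<in>closed_walks n h. \<Sum>ws\<in>closed_walks n h'. e vs ws)
         - semicircle_moment h * semicircle_moment h' * real n ^ (K + 2)\<bar> \<le> C * real n ^ (K + 1)"
proof -
  define N where "N = Suc h + Suc h'"
  define cc where "cc = semicircle_moment h * semicircle_moment h'"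
  define C1 where "C1 = real (Suc (K + 1) * (1 + 17 ^ Suc N) ^ N)"
  have cc: "cc \<ge> 0" by (simp add: cc_def semicircle_moment_nonneg)
  show ?thesis
  proof (rule that[of "D * C1 + cc * real (K + 2) * 17 ^ Suc N"])
    fix n :: nat and e :: "nat list \<Rightarrow> nat list \<Rightarrow> real"
    assume n: "n > 0"
      and bd: "\<And>vs ws. vs \<in> closed_walks n h \<Longrightarrow> ws \<in> closed_walks n h' \<Longrightarrow> \<bar>e vs ws\<bar> \<le> D"
      and one: "\<And>vs ws. vs \<in> closed_walks n h \<Longrightarrow> ws \<in> closed_walks n h' \<Longrightarrow> tree_walk_pair vs ws \<Longrightarrow> e vs ws = 1"
      and zero: "\<And>vs ws f a. vs \<in> closed_walks n h \<Longrightarrow> ws \<in> closed_walks n h' \<Longrightarrow> f \<in> {toeplitz_index, hankel_index} \<Longrightarrow>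
         count_list (map f (pair_edges vs ws)) a = 1 \<Longrightarrow> e vs ws = 0"
    define P where "P = closed_walks n h \<times> closed_walks n h'"
    define T where "T = {(vs, ws). vs \<in> lists_below n (Suc h) \<and> ws \<in> lists_below n (Suc h') \<and> tree_walk_pair vs ws}"
    have TP: "T \<subseteq> P"
    proof
      fix z assume "z \<in> T"
      then obtain vs ws where z: "z = (vs, ws)" "vs \<in> lists_below n (Suc h)" "ws \<in> lists_below n (Suc h')"
        "rooted_tree_walk {} vs" "rooted_tree_walk (set vs) ws"
        by (auto simp: T_def tree_walk_pair_rooted)
      moreover have "vs \<noteq> []" "ws \<noteq> []" using z by (auto simp: lists_below_def)
      ultimately show "z \<in> P" by (auto simp: P_def closed_walks_def dest: rooted_tree_walk_last)
    qed
    have P: "finite P" by (simp add: P_def)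
    define Q where "Q = {(vs, ws) \<in> P. gencount {} (vs @ ws) \<le> K + 1}"
    have Q: "card Q \<le> (Suc (K + 1) * (1 + 17 ^ Suc N) ^ N) * n ^ (K + 1)"
    proof -
      have inj: "inj_on (\<lambda>(vs, ws). vs @ ws) Q"
        by (auto simp: inj_on_def Q_def P_def closed_walks_def lists_below_def)
      have "card Q = card ((\<lambda>(vs, ws). vs @ ws) ` Q)" by (rule card_image[OF inj, symmetric])
      also have "\<dots> \<le> card {us \<in> lists_below n N. gencount {} us \<le> K + 1}"
      proof (rule card_mono)
        show "finite {us \<in> lists_below n N. gencount {} us \<le> K + 1}" by simp
      qed (auto simp: Q_def P_def closed_walks_def lists_below_def N_def)
      also have "\<dots> \<le> (Suc (K + 1) * (1 + 17 ^ Suc N) ^ N) * n ^ (K + 1)"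
        by (rule card_gencount_le[OF n])
      finally show ?thesis .
    qed
    have "(\<Sum>vs\<in>closed_walks n h. \<Sum>ws\<in>closed_walks n h'. e vs ws) = (\<Sum>(vs, ws)\<in>P. e vs ws)"
      unfolding P_def by (rule sum.cartesian_product)
    also have "\<dots> = (\<Sum>(vs, ws)\<in>T. e vs ws) + (\<Sum>(vs, ws)\<in>P - T. e vs ws)"
      using sum.subset_diff[OF TP P, of "\<lambda>(vs, ws). e vs ws"] by simp
    also have "(\<Sum>(vs, ws)\<in>T. e vs ws) = (\<Sum>z\<in>T. 1)"
      using TP one by (intro sum.cong) (auto simp: T_def P_def)
    finally have eq: "(\<Sum>vs\<in>closed_walks n h. \<Sum>ws\<in>closed_walks n h'. e vs ws)
        = real (card T) + (\<Sum>(vs, ws)\<in>P - T. e vs ws)" by simp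
    have "\<bar>\<Sum>(vs, ws)\<in>P - T. e vs ws\<bar> \<le> (\<Sum>(vs, ws)\<in>P - T. \<bar>e vs ws\<bar>)"
      by (rule order.trans[OF sum_abs]) (simp add: case_prod_beta)
    also have "\<dots> \<le> (\<Sum>z\<in>P - T. of_bool (z \<in> Q) * D)"
    proof (intro sum_mono)
      fix z assume z: "z \<in> P - T"
      obtain vs ws where zz: "z = (vs, ws)" by (cases z)
      have *: "vs \<in> closed_walks n h" "ws \<in> closed_walks n h'" using z zz by (auto simp: P_def)
      have "e vs ws = 0" if "z \<notin> Q"
      proof -
        have "\<exists>f\<in>{toeplitz_index, hankel_index}. \<exists>a. count_list (map f (pair_edges vs ws)) a = 1"
        proof (rule closed_walk_pair_dichotomy[OF _ _ K])
          show "\<not> tree_walk_pair vs ws" using z zz * by (auto simp: T_def closed_walks_def)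
          show "K + 2 \<le> gencount {} (vs @ ws)" using that z zz by (auto simp: Q_def)
        qed (use * in \<open>auto simp: closed_walks_def lists_below_def\<close>)
        thus ?thesis using zero[OF *] by blast
      qed
      thus "(case z of (vs, ws) \<Rightarrow> \<bar>e vs ws\<bar>) \<le> of_bool (z \<in> Q) * D"
        using bd[OF *] by (auto simp: zz)
    qed
    also have "\<dots> \<le> (\<Sum>z\<in>P. of_bool (z \<in> Q) * D)"
      using P assms(2) by (intro sum_mono2) auto
    also have "\<dots> = real (card Q) * D"
    proof -
      have "P \<inter> Q = Q" by (auto simp: Q_def)
      thus ?thesis using P by (simp add: of_bool_def sum.If_cases flip: sum_distrib_right)
    qed
    also have "\<dots> \<le> (C1 * real n ^ (K + 1)) * D"
    proof (intro mult_right_mono assms(2))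
      have "real (card Q) \<le> real ((Suc (K + 1) * (1 + 17 ^ Suc N) ^ N) * n ^ (K + 1))"
        using Q by (simp only: of_nat_le_iff)
      thus "real (card Q) \<le> C1 * real n ^ (K + 1)" by (simp only: C1_def of_nat_mult of_nat_power)
    qed
    finally have rest: "\<bar>\<Sum>(vs, ws)\<in>P - T. e vs ws\<bar> \<le> D * C1 * real n ^ (K + 1)" by (simp add: mult_ac)
    have "cc * real n ^ (K + 2) - cc * real (K + 2) * 17 ^ Suc N * real n ^ (K + 1) \<le> real (card T)"
      "real (card T) \<le> cc * real n ^ (K + 2)"
      using card_tree_walk_pairs[OF K, of n] by (simp_all only: cc_def N_def T_def)
    hence "\<bar>real (card T) - cc * real n ^ (K + 2)\<bar> \<le> cc * real (K + 2) * 17 ^ Suc N * real n ^ (K + 1)"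
      by linarith
    with rest show "\<bar>(\<Sum>vs\<in>closed_walks n h. \<Sum>ws\<in>closed_walks n h'. e vs ws)
         - semicircle_moment h * semicircle_moment h' * real n ^ (K + 2)\<bar>
        \<le> (D * C1 + cc * real (K + 2) * 17 ^ Suc N) * real n ^ (K + 1)"
      unfolding eq cc_def[symmetric] distrib_right by linarith
  qed
qed

subsection \<open>Bounded input sequences\<close>

lemma prod_list_map_count:
  fixes f :: "'b \<Rightarrow> 'c::comm_semiring_1"
  assumes "finite A" "set xs \<subseteq> A"
  shows "prod_list (map f xs) = (\<Prod>x\<in>A. f x ^ count_list xs x)"
  using assms(2)
proof (induction xs)
  case (Cons a xs)
  have "(\<Prod>x\<in>A. f x ^ count_list (a # xs) x) = (\<Prod>x\<in>A. (if x = a then f a else 1) * f x ^ count_list xs x)"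
    by (intro prod.cong) auto
  also have "\<dots> = f a * (\<Prod>x\<in>A. f x ^ count_list xs x)"
    using Cons.prems assms(1) by (simp add: prod.distrib)
  finally show ?case using Cons by simp
qed simp

lemma abs_prod_list_le:
  fixes f :: "'b \<Rightarrow> real"
  assumes "\<And>x. \<bar>f x\<bar> \<le> B"
  shows "\<bar>prod_list (map f xs)\<bar> \<le> B ^ length xs"
proof (induction xs)
  case (Cons a xs)
  have "0 \<le> B" using assms[of undefined] by linarith
  thus ?case using Cons assms[of a] by (simp add: abs_mult mult_mono)
qed simp

lemma prod_list_map_mult:
  fixes f g :: "'b \<Rightarrow> 'c::comm_monoid_mult"
  shows "prod_list (map (\<lambda>x. f x * g x) xs) = prod_list (map f xs) * prod_list (map g xs)"
  by (induction xs) (auto simp: mult_ac)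

text \<open>By monotone convergence the sum of all \<open>f j\<close> has finite expectation, so the
  series converges almost surely.\<close>

lemma (in prob_space) AE_tendsto_0_of_summable_expectation:
  fixes f :: "nat \<Rightarrow> 'a \<Rightarrow> real"
  assumes int: "\<And>j. integrable M (f j)" and nonneg: "\<And>j \<omega>. f j \<omega> \<ge> 0"
    and sum: "summable (\<lambda>j. expectation (f j))"
  shows "AE \<omega> in M. (\<lambda>j. f j \<omega>) \<longlonglongrightarrow> 0"
proof -
  have [measurable]: "f j \<in> borel_measurable M" for j using int by auto
  have "(\<integral>\<^sup>+ \<omega>. (\<Sum>j. ennreal (f j \<omega>)) \<partial>M) = (\<Sum>j. \<integral>\<^sup>+ \<omega>. ennreal (f j \<omega>) \<partial>M)"
    by (rule nn_integral_suminf) simp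
  also have "\<dots> = (\<Sum>j. ennreal (expectation (f j)))"
    using int nonneg by (intro suminf_cong nn_integral_eq_integral) auto
  also have "\<dots> = ennreal (\<Sum>j. expectation (f j))"
    using sum nonneg by (intro suminf_ennreal2) (auto intro: integral_nonneg_AE)
  also have "\<dots> \<noteq> \<infinity>" by simp
  finally have "AE \<omega> in M. (\<Sum>j. ennreal (f j \<omega>)) \<noteq> \<infinity>"
    by (intro nn_integral_PInf_AE) auto
  thus ?thesis
  proof eventually_elim
    case (elim \<omega>)
    hence "summable (\<lambda>j. f j \<omega>)" using nonneg by (intro summable_suminf_not_top) auto
    thus ?case by (rule summable_LIMSEQ_zero)
  qed
qed

text \<open>The bound holds at every point, not just almost surely, which is what truncation
  produces and what makes every product of entries integrable.\<close>

definition standardized_bounded :: "'a measure \<Rightarrow> (nat \<Rightarrow> 'a \<Rightarrow> real) \<Rightarrow> real \<Rightarrow> bool" where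
  "standardized_bounded M X B \<longleftrightarrow> prob_space.indep_vars M (\<lambda>_. borel) X UNIV \<and>
     (\<forall>t \<omega>. \<bar>X t \<omega>\<bar> \<le> B) \<and> (\<forall>t. integral\<^sup>L M (X t) = 0) \<and> (\<forall>t. integral\<^sup>L M (\<lambda>\<omega>. (X t \<omega>)\<^sup>2) = 1)"

context prob_space
begin

lemma standardized_bounded_measurable:
  assumes "standardized_bounded M X B"
  shows "X t \<in> borel_measurable M"
  using assms by (auto simp: standardized_bounded_def indep_vars_def)

lemma expectation_prod_list:
  assumes X: "standardized_bounded M X B"
  shows "expectation (\<lambda>\<omega>. prod_list (map (\<lambda>t. X t \<omega>) ts))
    = (\<Prod>t\<in>set ts. expectation (\<lambda>\<omega>. X t \<omega> ^ count_list ts t))"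
proof -
  note [measurable] = standardized_bounded_measurable[OF X]
  have "expectation (\<lambda>\<omega>. prod_list (map (\<lambda>t. X t \<omega>) ts))
      = expectation (\<lambda>\<omega>. \<Prod>t\<in>set ts. X t \<omega> ^ count_list ts t)"
    by (simp add: prod_list_map_count[OF finite_set order.refl])
  also have "\<dots> = (\<Prod>t\<in>set ts. expectation (\<lambda>\<omega>. X t \<omega> ^ count_list ts t))"
  proof (rule indep_vars_lebesgue_integral)
    have "indep_vars (\<lambda>_. borel) (\<lambda>t \<omega>. X t \<omega> ^ count_list ts t) UNIV"
      by (rule indep_vars_compose2[where Y = "\<lambda>t z. z ^ count_list ts t" and M' = "\<lambda>_. borel"])
        (use X in \<open>auto simp: standardized_bounded_def\<close>)
    thus "indep_vars (\<lambda>_. borel) (\<lambda>t \<omega>. X t \<omega> ^ count_list ts t) (set ts)"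
      by (rule indep_vars_subset) auto
    show "integrable M (\<lambda>\<omega>. X t \<omega> ^ count_list ts t)" for t
    proof (rule integrable_const_bound[where B = "B ^ count_list ts t"])
      show "AE \<omega> in M. norm (X t \<omega> ^ count_list ts t) \<le> B ^ count_list ts t"
        using X by (auto simp: standardized_bounded_def power_abs intro!: power_mono)
    qed simp
  qed auto
  finally show ?thesis .
qed

lemma expectation_prod_list_eq_0:
  assumes "standardized_bounded M X B" "count_list ts t = 1"
  shows "expectation (\<lambda>\<omega>. prod_list (map (\<lambda>t. X t \<omega>) ts)) = 0"
proof -
  have "t \<in> set ts" using assms(2) by (metis count_list_0_iff zero_neq_one)
  moreover have "expectation (\<lambda>\<omega>. X t \<omega> ^ count_list ts t) = 0"
    using assms by (simp add: standardized_bounded_def)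
  ultimately show ?thesis unfolding expectation_prod_list[OF assms(1)] by (intro prod_zero) auto
qed

lemma expectation_prod_list_eq_1:
  assumes "standardized_bounded M X B" "\<And>t. count_list ts t \<in> {0, 2}"
  shows "expectation (\<lambda>\<omega>. prod_list (map (\<lambda>t. X t \<omega>) ts)) = 1"
  unfolding expectation_prod_list[OF assms(1)]
proof (rule prod.neutral, safe)
  fix t assume "t \<in> set ts"
  hence "count_list ts t \<noteq> 0" by (simp add: count_list_0_iff)
  hence "count_list ts t = 2" using assms(2)[of t] by auto
  thus "expectation (\<lambda>\<omega>. X t \<omega> ^ count_list ts t) = 1"
    using assms(1) by (simp add: standardized_bounded_def)
qed

end

locale bounded_array = prob_space M for M :: "'a measure" +
  fixes X Y :: "nat \<Rightarrow> 'a \<Rightarrow> real" and B :: real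
  assumes X: "standardized_bounded M X B" and Y: "standardized_bounded M Y B"
    and XY: "indep_sequences M X Y"
begin

definition entry :: "'a \<Rightarrow> nat \<times> nat \<Rightarrow> real" where
  "entry \<omega> e = X (toeplitz_index e) \<omega> * Y (hankel_index e) \<omega>"

definition walk_sum :: "nat \<Rightarrow> nat \<Rightarrow> 'a \<Rightarrow> real" where
  "walk_sum h n \<omega> = (\<Sum>vs\<in>closed_walks n h. walk_weight (entry \<omega>) vs)"

lemma measurable_entry [measurable]: "(\<lambda>\<omega>. entry \<omega> e) \<in> borel_measurable M"
  unfolding entry_def
  using standardized_bounded_measurable[OF X] standardized_bounded_measurable[OF Y] by simp

lemma entry_bounded: "\<bar>entry \<omega> e\<bar> \<le> B * B"
  using X Y unfolding entry_def abs_mult standardized_bounded_def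
  by (intro mult_mono) (auto intro: order.trans[OF abs_ge_zero])

lemma measurable_prod_list_entry [measurable]:
  "(\<lambda>\<omega>. prod_list (map (entry \<omega>) es)) \<in> borel_measurable M"
  by (induction es) auto

lemma prod_list_entry_bounded: "\<bar>prod_list (map (entry \<omega>) es)\<bar> \<le> (B * B) ^ length es"
  by (rule abs_prod_list_le[OF entry_bounded])

lemma integrable_prod_list_entry: "integrable M (\<lambda>\<omega>. prod_list (map (entry \<omega>) es))"
  by (rule integrable_const_bound[where B = "(B * B) ^ length es"])
    (simp_all add: prod_list_entry_bounded)

lemma walk_weight_mult:
  "walk_weight A vs * walk_weight A ws = prod_list (map A (pair_edges vs ws))"
  by (simp add: walk_weight_def pair_edges_def)

text \<open>The two products are measurable functions of the two independent sequences. Consequently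
  a single unpaired index, of either kind, annihilates the expectation.\<close>

lemma expectation_pair:
  "expectation (\<lambda>\<omega>. prod_list (map (entry \<omega>) es))
    = expectation (\<lambda>\<omega>. prod_list (map (\<lambda>t. X t \<omega>) (map toeplitz_index es)))
      * expectation (\<lambda>\<omega>. prod_list (map (\<lambda>t. Y t \<omega>) (map hankel_index es)))"
proof -
  define F :: "nat list \<Rightarrow> (nat \<Rightarrow> real) \<Rightarrow> real" where "F ts z = prod_list (map z ts)" for ts z
  have F [measurable]: "F ts \<in> borel_measurable (PiM UNIV (\<lambda>_. borel))" for ts
    unfolding F_def by (induction ts) auto
  have "indep_var borel (F (map toeplitz_index es) \<circ> (\<lambda>\<omega> t. X t \<omega>))
      borel (F (map hankel_index es) \<circ> (\<lambda>\<omega> t. Y t \<omega>))"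
    by (rule indep_var_compose[OF XY[unfolded indep_sequences_def] F F])
  hence ind: "indep_var borel (\<lambda>\<omega>. prod_list (map (\<lambda>t. X t \<omega>) (map toeplitz_index es)))
      borel (\<lambda>\<omega>. prod_list (map (\<lambda>t. Y t \<omega>) (map hankel_index es)))"
    by (simp add: F_def comp_def)
  have int: "integrable M (\<lambda>\<omega>. prod_list (map (\<lambda>t. Z t \<omega>) ts))"
    if Z: "standardized_bounded M Z B" for Z ts
  proof (rule integrable_const_bound[where B = "B ^ length ts"])
    show "AE \<omega> in M. norm (prod_list (map (\<lambda>t. Z t \<omega>) ts)) \<le> B ^ length ts"
      using abs_prod_list_le[of "\<lambda>t. Z t _" B ts] Z by (auto simp: standardized_bounded_def)
    show "(\<lambda>\<omega>. prod_list (map (\<lambda>t. Z t \<omega>) ts)) \<in> borel_measurable M"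
      using standardized_bounded_measurable[OF Z] by (induction ts) auto
  qed
  have "expectation (\<lambda>\<omega>. prod_list (map (\<lambda>t. X t \<omega>) (map toeplitz_index es))
        * prod_list (map (\<lambda>t. Y t \<omega>) (map hankel_index es)))
      = expectation (\<lambda>\<omega>. prod_list (map (\<lambda>t. X t \<omega>) (map toeplitz_index es)))
      * expectation (\<lambda>\<omega>. prod_list (map (\<lambda>t. Y t \<omega>) (map hankel_index es)))"
    by (rule indep_var_lebesgue_integral[OF ind int[OF X] int[OF Y]])
  moreover have "prod_list (map (entry \<omega>) es) = prod_list (map (\<lambda>t. X t \<omega>) (map toeplitz_index es))
        * prod_list (map (\<lambda>t. Y t \<omega>) (map hankel_index es))" for \<omega>
    unfolding map_map comp_def prod_list_map_mult[symmetric] by (simp add: entry_def[abs_def])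
  ultimately show ?thesis by simp
qed

lemma integrable_walk_weight: "integrable M (\<lambda>\<omega>. walk_weight (entry \<omega>) vs)"
  unfolding walk_weight_def by (rule integrable_prod_list_entry)

lemma integrable_walk_sum: "integrable M (walk_sum h n)"
  unfolding walk_sum_def[abs_def] by (intro Bochner_Integration.integrable_sum integrable_walk_weight)

lemma integrable_walk_sum_mult: "integrable M (\<lambda>\<omega>. walk_sum h n \<omega> * walk_sum h' n \<omega>)"
  unfolding walk_sum_def sum_product walk_weight_mult
  by (intro Bochner_Integration.integrable_sum integrable_prod_list_entry)

lemma expectation_walk_sum_mult:
  assumes K: "h + h' = 2 * K"
  shows "\<exists>C. \<forall>n>0. \<bar>expectation (\<lambda>\<omega>. walk_sum h n \<omega> * walk_sum h' n \<omega>)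
      - semicircle_moment h * semicircle_moment h' * real n ^ (K + 2)\<bar> \<le> C * real n ^ (K + 1)"
proof -
  define e where "e vs ws = expectation (\<lambda>\<omega>. prod_list (map (entry \<omega>) (pair_edges vs ws)))" for vs ws
  have D: "(B * B) ^ (h + h') \<ge> 0" by simp
  show ?thesis
  proof (rule pair_sum_asymptotics[OF K D], intro exI allI impI)
    fix C n
    assume C: "\<And>n e. n > 0 \<Longrightarrow>
      (\<And>vs ws. vs \<in> closed_walks n h \<Longrightarrow> ws \<in> closed_walks n h' \<Longrightarrow> \<bar>e vs ws\<bar> \<le> (B * B) ^ (h + h')) \<Longrightarrow>
      (\<And>vs ws. vs \<in> closed_walks n h \<Longrightarrow> ws \<in> closed_walks n h' \<Longrightarrow> tree_walk_pair vs ws \<Longrightarrow> e vs ws = 1) \<Longrightarrow>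
      (\<And>vs ws f a. vs \<in> closed_walks n h \<Longrightarrow> ws \<in> closed_walks n h' \<Longrightarrow> f \<in> {toeplitz_index, hankel_index} \<Longrightarrow>
         count_list (map f (pair_edges vs ws)) a = 1 \<Longrightarrow> e vs ws = 0) \<Longrightarrow>
      \<bar>(\<Sum>vs\<in>closed_walks n h. \<Sum>ws\<in>closed_walks n h'. e vs ws)
         - semicircle_moment h * semicircle_moment h' * real n ^ (K + 2)\<bar> \<le> C * real n ^ (K + 1)"
    assume n: "(n::nat) > 0"
    have "expectation (\<lambda>\<omega>. walk_sum h n \<omega> * walk_sum h' n \<omega>)
        = (\<Sum>vs\<in>closed_walks n h. \<Sum>ws\<in>closed_walks n h'. e vs ws)"
      unfolding walk_sum_def sum_product walk_weight_mult e_def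
      by (subst Bochner_Integration.integral_sum,
          intro Bochner_Integration.integrable_sum integrable_prod_list_entry,
          intro sum.cong refl Bochner_Integration.integral_sum integrable_prod_list_entry)
    moreover have "\<bar>e vs ws\<bar> \<le> (B * B) ^ (h + h')"
      if "vs \<in> closed_walks n h" "ws \<in> closed_walks n h'" for vs ws
    proof -
      have len: "length (pair_edges vs ws) = h + h'"
        using that by (simp add: pair_edges_def closed_walks_def lists_below_def)
      have "\<bar>e vs ws\<bar> \<le> expectation (\<lambda>\<omega>. \<bar>prod_list (map (entry \<omega>) (pair_edges vs ws))\<bar>)"
        unfolding e_def by (rule integral_abs_bound)
      also have "\<dots> \<le> (B * B) ^ (h + h')"
        using prod_list_entry_bounded[of _ "pair_edges vs ws"] len
        by (intro integral_le_const integrable_abs integrable_prod_list_entry) simp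
      finally show ?thesis .
    qed
    moreover have "e vs ws = 1" if "vs \<in> closed_walks n h" "tree_walk_pair vs ws" for vs ws
    proof -
      have "vs \<noteq> []" using that(1) by (auto simp: closed_walks_def lists_below_def)
      thus ?thesis unfolding e_def expectation_pair
        using expectation_prod_list_eq_1[OF X tree_walk_pair_counts[OF that(2) edge_key_toeplitz]]
          expectation_prod_list_eq_1[OF Y tree_walk_pair_counts[OF that(2) edge_key_hankel]]
        by simp
    qed
    moreover have "e vs ws = 0" if "f \<in> {toeplitz_index, hankel_index}"
      "count_list (map f (pair_edges vs ws)) a = 1" for vs ws f a
      unfolding e_def expectation_pair
      using that expectation_prod_list_eq_0[OF X, of "map toeplitz_index (pair_edges vs ws)" a]
        expectation_prod_list_eq_0[OF Y, of "map hankel_index (pair_edges vs ws)" a] by auto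
    ultimately show "\<bar>expectation (\<lambda>\<omega>. walk_sum h n \<omega> * walk_sum h' n \<omega>)
      - semicircle_moment h * semicircle_moment h' * real n ^ (K + 2)\<bar> \<le> C * real n ^ (K + 1)"
      using C[OF n, of e] by simp
  qed
qed

text \<open>Paired with walks of length 0, the estimate for products of two traces becomes one for
  the mean of a single trace.\<close>

lemma walk_sum_0: "walk_sum 0 n \<omega> = real n"
proof -
  have "closed_walks n 0 = (\<lambda>v. [v]) ` {..<n}"
    by (auto simp: closed_walks_def lists_below_def length_Suc_conv)
  thus ?thesis by (simp add: walk_sum_def walk_weight_def sum.reindex inj_on_def)
qed

text \<open>In the expansion of the square all terms of order \<open>n ^ (h + 2)\<close> cancel.
  After division by \<open>n ^ (h + 2)\<close> the mean square deviation is thus O(1/n).\<close>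

lemma walk_sum_mean_square:
  "\<exists>C. \<forall>n>0. expectation (\<lambda>\<omega>. (walk_sum h n \<omega> - semicircle_moment h * real n ^ (h div 2 + 1))\<^sup>2) \<le> C * real n ^ (h + 1)"
proof -
  let ?c = "semicircle_moment h"
  obtain C2 where C2: "\<forall>n>0. \<bar>expectation (\<lambda>\<omega>. walk_sum h n \<omega> * walk_sum h n \<omega>)
      - ?c * ?c * real n ^ (h + 2)\<bar> \<le> C2 * real n ^ (h + 1)"
    using expectation_walk_sum_mult[OF mult_2[symmetric], of h] by blast
  have expand: "expectation (\<lambda>\<omega>. (walk_sum h n \<omega> - a)\<^sup>2)
      = expectation (\<lambda>\<omega>. walk_sum h n \<omega> * walk_sum h n \<omega>) - 2 * a * expectation (walk_sum h n) + a\<^sup>2"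
    for n a
  proof -
    have "expectation (\<lambda>\<omega>. (walk_sum h n \<omega> - a)\<^sup>2)
        = expectation (\<lambda>\<omega>. walk_sum h n \<omega> * walk_sum h n \<omega> - 2 * a * walk_sum h n \<omega> + a\<^sup>2)"
      by (simp add: power2_eq_square algebra_simps)
    also have "\<dots> = expectation (\<lambda>\<omega>. walk_sum h n \<omega> * walk_sum h n \<omega>)
        - expectation (\<lambda>\<omega>. 2 * a * walk_sum h n \<omega>) + a\<^sup>2"
      using integrable_walk_sum_mult[of h n h] integrable_walk_sum[of h n]
      by (subst Bochner_Integration.integral_add; (subst Bochner_Integration.integral_diff)?)
        (auto simp: prob_space)
    finally show ?thesis by simp
  qed
  show ?thesis
  proof (cases "even h")
    case True
    then obtain k where k: "h = 2 * k" by blast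
    have K: "h + 0 = 2 * k" using k by simp
    have m0: "semicircle_moment 0 = 1" by (simp add: semicircle_moment_def)
    obtain C1 where C1: "\<forall>n>0. \<bar>expectation (\<lambda>\<omega>. walk_sum h n \<omega> * walk_sum 0 n \<omega>)
      - ?c * semicircle_moment 0 * real n ^ (k + 2)\<bar> \<le> C1 * real n ^ (k + 1)"
      using expectation_walk_sum_mult[OF K] by blast
    show ?thesis
    proof (intro exI[of _ "C2 + 2 * ?c * C1"] allI impI)
      fix n :: nat assume n: "n > 0"
      define a where "a = ?c * real n ^ (k + 1)"
      have A: "expectation (\<lambda>\<omega>. walk_sum h n \<omega> * walk_sum 0 n \<omega>) = real n * expectation (walk_sum h n)"
        by (simp add: walk_sum_0 mult.commute)
      have B: "?c * semicircle_moment 0 * real n ^ (k + 2) = real n * a"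
        by (simp add: a_def m0)
      have "real n * \<bar>expectation (walk_sum h n) - a\<bar> = \<bar>real n * expectation (walk_sum h n) - real n * a\<bar>"
        by (simp add: abs_mult flip: right_diff_distrib)
      also have "\<dots> \<le> C1 * real n ^ (k + 1)"
        using C1[rule_format, OF n] unfolding A B .
      also have "\<dots> = real n * (C1 * real n ^ k)" by simp
      finally have "\<bar>expectation (walk_sum h n) - a\<bar> \<le> C1 * real n ^ k" using n by simp
      \<comment> \<open>A lower bound for the mean suffices: it enters with the factor
        \<open>- 2 * a\<close>, and \<open>a \<ge> 0\<close>.\<close>
      hence "- (C1 * real n ^ k) \<le> expectation (walk_sum h n) - a" by linarith
      moreover have a0: "a \<ge> 0" by (simp add: a_def semicircle_moment_nonneg)
      ultimately have "a * (- (C1 * real n ^ k)) \<le> a * (expectation (walk_sum h n) - a)"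
        by (intro mult_left_mono)
      moreover have "a * (C1 * real n ^ k) = ?c * C1 * real n ^ (h + 1)"
        by (simp add: a_def k mult_2 power_add)
      moreover have "a\<^sup>2 = ?c * ?c * real n ^ (h + 2)"
        by (simp add: a_def k mult_2 power_add power2_eq_square)
      moreover have "expectation (\<lambda>\<omega>. walk_sum h n \<omega> * walk_sum h n \<omega>)
          \<le> ?c * ?c * real n ^ (h + 2) + C2 * real n ^ (h + 1)" using C2[rule_format, OF n] by linarith
      ultimately have "expectation (\<lambda>\<omega>. (walk_sum h n \<omega> - a)\<^sup>2) \<le> C2 * real n ^ (h + 1)
          + 2 * (?c * C1 * real n ^ (h + 1))"
        unfolding expand by (simp add: right_diff_distrib power2_eq_square)
      thus "expectation (\<lambda>\<omega>. (walk_sum h n \<omega> - ?c * real n ^ (h div 2 + 1))\<^sup>2)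
          \<le> (C2 + 2 * ?c * C1) * real n ^ (h + 1)"
        by (simp add: a_def k algebra_simps)
    qed
  next
    case False
    \<comment> \<open>For odd \<open>h\<close> the target is 0 and the second moment alone decides;
      a partner of length 0 would give an odd total length.\<close>
    hence c: "?c = 0" by (rule semicircle_moment_odd)
    show ?thesis
    proof (intro exI[of _ C2] allI impI)
      fix n :: nat assume "n > 0"
      from C2[rule_format, OF this] show "expectation (\<lambda>\<omega>. (walk_sum h n \<omega> - ?c * real n ^ (h div 2 + 1))\<^sup>2)
          \<le> C2 * real n ^ (h + 1)" by (simp add: c power2_eq_square)
    qed
  qed
qed

text \<open>At size \<open>j ^ 2\<close> the normalization \<open>n ^ (h / 2 + 1)\<close> becomes
  \<open>j ^ (h + 2)\<close>, and the mean square deviation is O(1 / j ^ 2), which is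
  summable.\<close>

theorem walk_sum_converges:
  "AE \<omega> in M. \<forall>h. (\<lambda>j. walk_sum h (j\<^sup>2) \<omega> / real j ^ (h + 2)) \<longlonglongrightarrow> semicircle_moment h"
  unfolding AE_all_countable
proof
  fix h
  let ?c = "semicircle_moment h"
  obtain C where C: "\<forall>n>0.
    expectation (\<lambda>\<omega>. (walk_sum h n \<omega> - ?c * real n ^ (h div 2 + 1))\<^sup>2) \<le> C * real n ^ (h + 1)"
    using walk_sum_mean_square[of h] by blast
  \<comment> \<open>At \<open>j = 0\<close> the quotient is 0 by convention, and the factor
    \<open>of_bool\<close> makes the whole term vanish there.\<close>
  define f where "f j \<omega> = (walk_sum h (j\<^sup>2) \<omega> / real j ^ (h + 2) - of_bool (j > 0) * ?c)\<^sup>2" for j \<omega>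
  have int: "integrable M (f j)" for j
  proof -
    have "f j = (\<lambda>\<omega>. walk_sum h (j\<^sup>2) \<omega> * walk_sum h (j\<^sup>2) \<omega> / (real j ^ (h + 2))\<^sup>2
        - 2 * (of_bool (j > 0) * ?c) / real j ^ (h + 2) * walk_sum h (j\<^sup>2) \<omega> + (of_bool (j > 0) * ?c)\<^sup>2)"
    proof -
      have "(a / p - c)\<^sup>2 = a * a / p\<^sup>2 - 2 * c / p * a + c\<^sup>2" for a p c :: real
        by (simp add: power2_eq_square algebra_simps)
      thus ?thesis by (simp only: f_def[abs_def])
    qed
    thus ?thesis using integrable_walk_sum_mult[of h "j\<^sup>2" h] integrable_walk_sum[of h "j\<^sup>2"]
      by simp
  qed
  have bound: "expectation (f j) \<le> C / real j ^ 2" if "j > 0" for j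
  proof -
    define p where "p = real j ^ (h + 2)"
    have p: "p \<noteq> 0" using that by (simp add: p_def)
    have fj: "f j \<omega> = (walk_sum h (j\<^sup>2) \<omega> - ?c * real (j\<^sup>2) ^ (h div 2 + 1))\<^sup>2 / p\<^sup>2" for \<omega>
    proof -
      have "?c * real (j\<^sup>2) ^ (h div 2 + 1) = ?c * p"
      proof (cases "even h")
        case True
        hence "2 * (h div 2 + 1) = h + 2" by simp
        moreover have "real (j\<^sup>2) ^ m = real j ^ (2 * m)" for m
          by (simp only: of_nat_power power_mult)
        ultimately show ?thesis by (simp only: p_def)
      qed (simp add: semicircle_moment_odd)
      moreover have "(a - ?c * p)\<^sup>2 / p\<^sup>2 = (a / p - ?c)\<^sup>2" for a
        using p by (simp add: power_divide[symmetric] diff_divide_distrib)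
      moreover have "f j \<omega> = (walk_sum h (j\<^sup>2) \<omega> / p - ?c)\<^sup>2"
        using that by (simp add: f_def p_def)
      ultimately show ?thesis by (simp only:)
    qed
    have "expectation (f j)
        = expectation (\<lambda>\<omega>. (walk_sum h (j\<^sup>2) \<omega> - ?c * real (j\<^sup>2) ^ (h div 2 + 1))\<^sup>2 / p\<^sup>2)"
      by (rule Bochner_Integration.integral_cong[OF refl fj])
    also have "\<dots> = expectation (\<lambda>\<omega>. (walk_sum h (j\<^sup>2) \<omega> - ?c * real (j\<^sup>2) ^ (h div 2 + 1))\<^sup>2) / p\<^sup>2"
      by (rule integral_divide_zero)
    also have "\<dots> \<le> C * real (j\<^sup>2) ^ (h + 1) / p\<^sup>2"
      using that by (intro divide_right_mono C[rule_format]) auto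
    also have "real (j\<^sup>2) ^ (h + 1) = (real j ^ (h + 1))\<^sup>2"
      by (simp add: power2_eq_square power_mult_distrib)
    also have "C * (real j ^ (h + 1))\<^sup>2 / p\<^sup>2 = C / real j ^ 2"
      using that by (simp add: p_def field_simps power2_eq_square)
    finally show ?thesis .
  qed
  have "AE \<omega> in M. (\<lambda>j. f j \<omega>) \<longlonglongrightarrow> 0"
  proof (rule AE_tendsto_0_of_summable_expectation[OF int])
    show "f j \<omega> \<ge> 0" for j \<omega> by (simp add: f_def)
    show "summable (\<lambda>j. expectation (f j))"
    proof (rule summable_comparison_test_ev)
      show "summable (\<lambda>j. C * (1 / real j ^ 2))"
        using inverse_power_summable[of 2] by (intro summable_mult) (simp add: inverse_eq_divide)
      show "eventually (\<lambda>j. norm (expectation (f j)) \<le> C * (1 / real j ^ 2)) sequentially"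
        using eventually_gt_at_top[of 0]
      proof eventually_elim
        case (elim j)
        have "expectation (f j) \<ge> 0" by (rule integral_nonneg_AE) (simp add: f_def)
        thus ?case using bound[OF elim] by simp
      qed
    qed
  qed
  thus "AE \<omega> in M. (\<lambda>j. walk_sum h (j\<^sup>2) \<omega> / real j ^ (h + 2)) \<longlonglongrightarrow> ?c"
  proof eventually_elim
    case (elim \<omega>)
    hence "(\<lambda>j. sqrt (f j \<omega>)) \<longlonglongrightarrow> sqrt 0" by (intro tendsto_real_sqrt)
    hence "(\<lambda>j. walk_sum h (j\<^sup>2) \<omega> / real j ^ (h + 2) - of_bool (j > 0) * ?c) \<longlonglongrightarrow> 0"
      by (simp add: f_def tendsto_rabs_zero_iff)
    hence "(\<lambda>j. walk_sum h (j\<^sup>2) \<omega> / real j ^ (h + 2) - ?c) \<longlonglongrightarrow> 0"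
      by (rule Lim_transform_eventually)
        (auto intro!: eventually_mono[OF eventually_gt_at_top[of 0]])
    thus ?case by (simp add: LIM_zero_iff)
  qed
qed

end

subsection \<open>The semicircle law\<close>

text \<open>The law with density \<open>sqrt (4 - x ^ 2) / (2 * pi)\<close> on
  \<open>[-2, 2]\<close>, after the substitution \<open>x = 2 * sin t\<close>. In this form its
  moments are trigonometric integrals without square roots.\<close>

definition semicircle_measure :: "real measure" where
  "semicircle_measure = distr (density lborel
     (\<lambda>t. ennreal (indicator {- pi / 2..pi / 2} t * (2 / pi * (cos t)\<^sup>2)))) borel (\<lambda>t. 2 * sin t)"

definition sin_moment :: "nat \<Rightarrow> real" where
  "sin_moment j = integral {- pi / 2..pi / 2} (\<lambda>t. sin t ^ j * (cos t)\<^sup>2)"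

lemma sin_moment_has_integral:
  "((\<lambda>t. sin t ^ j * (cos t)\<^sup>2) has_integral sin_moment j) {- pi / 2..pi / 2}"
  unfolding sin_moment_def
  by (intro integrable_integral integrable_continuous_interval continuous_intros)

lemma sin_moment_0: "sin_moment 0 = pi / 2"
proof -
  have "((\<lambda>t. sin t ^ 0 * (cos t)\<^sup>2) has_integral
      (pi / 2 / 2 + sin (pi / 2) * cos (pi / 2) / 2) - (- pi / 2 / 2 + sin (- pi / 2) * cos (- pi / 2) / 2))
      {- pi / 2..pi / 2}"
  proof (rule fundamental_theorem_of_calculus)
    fix t :: real
    have "((\<lambda>t. t / 2 + sin t * cos t / 2) has_real_derivative
        1 / 2 + (cos t * cos t + sin t * - sin t) / 2) (at t within {- pi / 2..pi / 2})"
      by (auto intro!: derivative_eq_intros)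
    moreover have "1 / 2 + (cos t * cos t + sin t * - sin t) / 2 = sin t ^ 0 * (cos t)\<^sup>2"
      using sin_cos_squared_add[of t] by (simp add: power2_eq_square field_simps)
    ultimately show "((\<lambda>t. t / 2 + sin t * cos t / 2) has_vector_derivative sin t ^ 0 * (cos t)\<^sup>2)
        (at t within {- pi / 2..pi / 2})"
      by (simp add: has_real_derivative_iff_has_vector_derivative)
  qed simp
  from has_integral_unique[OF sin_moment_has_integral this] show ?thesis by simp
qed

lemma sin_moment_1: "sin_moment 1 = 0"
proof -
  have "((\<lambda>t. sin t ^ 1 * (cos t)\<^sup>2) has_integral
      (- (cos (pi / 2) ^ 3) / 3) - (- (cos (- pi / 2) ^ 3) / 3)) {- pi / 2..pi / 2}"
  proof (rule fundamental_theorem_of_calculus)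
    fix t :: real
    have "((\<lambda>t. - (cos t ^ 3) / 3) has_real_derivative sin t ^ 1 * (cos t)\<^sup>2)
        (at t within {- pi / 2..pi / 2})"
      by (auto intro!: derivative_eq_intros)
    thus "((\<lambda>t. - (cos t ^ 3) / 3) has_vector_derivative sin t ^ 1 * (cos t)\<^sup>2)
        (at t within {- pi / 2..pi / 2})"
      by (simp add: has_real_derivative_iff_has_vector_derivative)
  qed simp
  from has_integral_unique[OF sin_moment_has_integral this] show ?thesis by simp
qed

text \<open>Integration of the derivative of \<open>sin\<^sup>j\<^sup>+\<^sup>1 cos\<^sup>3\<close>.\<close>
lemma sin_moment_rec: "real (j + 4) * sin_moment (j + 2) = real (j + 1) * sin_moment j"
proof -
  let ?I = "{- pi / 2..pi / 2::real}"
  have "((\<lambda>t. real (j + 1) * (sin t ^ j * (cos t)\<^sup>2) - real (j + 4) * (sin t ^ (j + 2) * (cos t)\<^sup>2)) has_integral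
      sin (pi / 2) ^ (j + 1) * cos (pi / 2) ^ 3 - sin (- pi / 2) ^ (j + 1) * cos (- pi / 2) ^ 3) ?I"
  proof (rule fundamental_theorem_of_calculus)
    fix t :: real
    have d1: "((\<lambda>t. sin t ^ Suc j) has_real_derivative (1 + real j) * (cos t * sin t ^ j)) (at t within ?I)"
      by (rule DERIV_power_Suc) (auto intro!: derivative_eq_intros)
    have d2: "((\<lambda>t. cos t ^ 3) has_real_derivative 3 * cos t ^ 2 * - sin t) (at t within ?I)"
      by (auto intro!: derivative_eq_intros)
    have "((\<lambda>t. sin t ^ (j + 1) * cos t ^ 3) has_real_derivative
        (1 + real j) * (cos t * sin t ^ j) * cos t ^ 3 + 3 * cos t ^ 2 * - sin t * sin t ^ Suc j) (at t within ?I)"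
      using DERIV_mult[OF d1 d2] by simp
    moreover have "(1 + real j) * (cos t * sin t ^ j) * cos t ^ 3 + 3 * cos t ^ 2 * - sin t * sin t ^ Suc j
       = real (j + 1) * (sin t ^ j * (cos t)\<^sup>2) - real (j + 4) * (sin t ^ (j + 2) * (cos t)\<^sup>2)"
    proof -
      have "(1 - (sin t)\<^sup>2) = (cos t)\<^sup>2" by (simp add: cos_squared_eq)
      hence "cos t * cos t ^ 3 = (cos t)\<^sup>2 * (1 - (sin t)\<^sup>2)"
        by (simp only:) (simp add: power2_eq_square power3_eq_cube)
      moreover have "(1 + real j) * (cos t * sin t ^ j) * cos t ^ 3
          = (1 + real j) * (sin t ^ j * (cos t * cos t ^ 3))" by (simp only: mult_ac)
      ultimately have "(1 + real j) * (cos t * sin t ^ j) * cos t ^ 3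
          = (1 + real j) * (sin t ^ j * ((cos t)\<^sup>2 * (1 - (sin t)\<^sup>2)))"
        by (simp only:)
      thus ?thesis by (simp add: power_add power2_eq_square algebra_simps)
    qed
    ultimately show "((\<lambda>t. sin t ^ (j + 1) * cos t ^ 3) has_vector_derivative
       real (j + 1) * (sin t ^ j * (cos t)\<^sup>2) - real (j + 4) * (sin t ^ (j + 2) * (cos t)\<^sup>2)) (at t within ?I)"
      by (simp add: has_real_derivative_iff_has_vector_derivative)
  qed simp
  moreover have "((\<lambda>t. real (j + 1) * (sin t ^ j * (cos t)\<^sup>2) - real (j + 4) * (sin t ^ (j + 2) * (cos t)\<^sup>2))
      has_integral real (j + 1) * sin_moment j - real (j + 4) * sin_moment (j + 2)) ?I"
    by (intro has_integral_diff has_integral_mult_right sin_moment_has_integral)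
  ultimately have "real (j + 1) * sin_moment j - real (j + 4) * sin_moment (j + 2)
      = sin (pi / 2) ^ (j + 1) * cos (pi / 2) ^ 3 - sin (- pi / 2) ^ (j + 1) * cos (- pi / 2) ^ 3"
    by (rule has_integral_unique[rotated])
  thus ?thesis by simp
qed

text \<open>Twice the Catalan recursion, in the form that \<open>sin_moment_rec\<close> takes at
  \<open>2 * k\<close>; the factor 4 is the quotient of consecutive scalings \<open>2 ^ j\<close>
  for even \<open>j\<close>.\<close>

lemma semicircle_moment_rec:
  "real (2 * k + 4) * semicircle_moment (2 * (k + 1)) = 4 * real (2 * k + 1) * semicircle_moment (2 * k)"
proof -
  have 1: "Suc k * (2 * k + 2 choose Suc k) = (2 * k + 2) * (2 * k + 1 choose k)"
    using Suc_times_binomial_eq[of "2 * k + 1" k] by (simp del: binomial_Suc_Suc)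
  have 2: "Suc k * (2 * k + 1 choose Suc k) = (2 * k + 1) * (2 * k choose k)"
    using Suc_times_binomial_eq[of "2 * k" k] by (simp del: binomial_Suc_Suc)
  have 3: "2 * k + 1 choose Suc k = 2 * k + 1 choose k"
    using binomial_symmetric[of "Suc k" "2 * k + 1"] by simp
  define a b c where "a = real (2 * k + 2 choose Suc k)" and "b = real (2 * k + 1 choose k)"
    and "c = real (2 * k choose k)"
  have "real (Suc k) * a = real (2 * k + 2) * b"
    unfolding a_def b_def of_nat_mult[symmetric] 1 ..
  also have "real (2 * k + 2) = real (Suc k) * 2" by simp
  finally have a: "a = 2 * b" by (simp only: mult.assoc mult_left_cancel of_nat_eq_0_iff nat.distinct simp_thms)
  have b: "real (Suc k) * b = real (2 * k + 1) * c"
    unfolding b_def c_def of_nat_mult[symmetric] 2[unfolded 3] ..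
  have "semicircle_moment (2 * (k + 1)) = a / real (k + 2)"
    unfolding semicircle_moment_even a_def by (simp add: mult_2 del: binomial_Suc_Suc)
  hence "real (2 * k + 4) * semicircle_moment (2 * (k + 1)) = 2 * a" by (simp add: field_simps)
  also have "\<dots> = 4 * (real (2 * k + 1) * c / real (Suc k))"
    unfolding a b[symmetric] by (simp del: of_nat_Suc)
  also have "\<dots> = 4 * real (2 * k + 1) * semicircle_moment (2 * k)"
    unfolding semicircle_moment_even c_def by simp
  finally show ?thesis .
qed

text \<open>Both sides satisfy the same recursion of step 2, so the values at 0 and 1
  decide.\<close>

lemma semicircle_moment_sin: "2 ^ j * (2 / pi) * sin_moment j = semicircle_moment j"
proof (induction j rule: less_induct)
  case (less j)
  consider "j = 0" | "j = 1" | i where "j = i + 2" by (metis One_nat_def add_2_eq_Suc' not0_implies_Suc)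
  thus ?case
  proof cases
    case 1
    thus ?thesis by (simp add: sin_moment_0 semicircle_moment_def)
  next
    case 2
    thus ?thesis by (simp add: sin_moment_1[simplified] semicircle_moment_odd)
  next
    case 3
    have "real (i + 4) * (2 ^ j * (2 / pi) * sin_moment j)
        = 2 ^ j * (2 / pi) * (real (i + 4) * sin_moment (i + 2))" unfolding 3 by (simp only: mult_ac)
    also have "\<dots> = 4 * real (i + 1) * (2 ^ i * (2 / pi) * sin_moment i)"
      unfolding sin_moment_rec by (simp add: 3 power_add)
    also have "\<dots> = 4 * real (i + 1) * semicircle_moment i" using less.IH[of i] 3 by simp
    also have "\<dots> = real (i + 4) * semicircle_moment j"
    proof (cases "even i")
      case True
      then obtain k where k: "i = 2 * k" by blast
      have "j = 2 * (k + 1)" using 3 k by simp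
      thus ?thesis using semicircle_moment_rec[of k] k by simp
    next
      case False
      thus ?thesis using 3 by (simp add: semicircle_moment_odd)
    qed
    finally show ?thesis by (subst (asm) mult_left_cancel) auto
  qed
qed

lemma semicircle_density_moment:
  "has_bochner_integral lborel (\<lambda>t. (indicator {- pi / 2..pi / 2} t * (2 / pi * (cos t)\<^sup>2)) *\<^sub>R (2 * sin t) ^ j)
    (semicircle_moment j)"
proof -
  define g where "g t = (2 * sin t) ^ j * (2 / pi * (cos t)\<^sup>2)" for t :: real
  let ?I = "{- pi / 2..pi / 2::real}"
  have int: "set_integrable lborel ?I g"
    unfolding g_def set_integrable_def by (intro borel_integrable_compact continuous_intros) auto
  have "(LINT t:?I|lborel. g t) = integral ?I g"
    by (rule set_borel_integral_eq_integral(2)[OF int])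
  also have "\<dots> = integral ?I (\<lambda>t. 2 ^ j * (2 / pi) * (sin t ^ j * (cos t)\<^sup>2))"
    by (simp add: g_def[abs_def] power_mult_distrib mult_ac)
  also have "\<dots> = 2 ^ j * (2 / pi) * sin_moment j"
    by (simp only: integral_mult_right sin_moment_def)
  finally have "(LINT t:?I|lborel. g t) = semicircle_moment j" by (simp only: semicircle_moment_sin)
  hence "has_bochner_integral lborel (\<lambda>t. indicator ?I t *\<^sub>R g t) (semicircle_moment j)"
    using int by (simp add: has_bochner_integral_iff set_integrable_def set_lebesgue_integral_def)
  thus ?thesis by (simp add: g_def mult_ac)
qed

lemma semicircle_measure_moment:
  "has_bochner_integral semicircle_measure (\<lambda>u. u ^ j) (semicircle_moment j)"
proof -
  have "has_bochner_integral (density lborel (\<lambda>t. ennreal (indicator {- pi / 2..pi / 2} t * (2 / pi * (cos t)\<^sup>2))))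
      (\<lambda>t. (2 * sin t) ^ j) (semicircle_moment j)"
    using semicircle_density_moment by (intro has_bochner_integral_density) auto
  thus ?thesis unfolding semicircle_measure_def
    by (intro has_bochner_integral_distr) auto
qed

lemma real_distribution_semicircle_measure: "real_distribution semicircle_measure"
proof -
  define d where "d t = indicator {- pi / 2..pi / 2} t * (2 / pi * (cos t)\<^sup>2)" for t :: real
  have d [measurable]: "d \<in> borel_measurable lborel" unfolding d_def by measurable
  have "has_bochner_integral lborel d 1"
    using semicircle_density_moment[of 0] unfolding d_def[abs_def] by (simp add: semicircle_moment_def)
  hence "(\<integral>\<^sup>+ t. ennreal (d t) \<partial>lborel) = 1"
    by (subst nn_integral_eq_integral) (auto simp: has_bochner_integral_iff d_def)
  hence "prob_space (density lborel (\<lambda>t. ennreal (d t)))"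
    by (intro prob_spaceI) (simp add: emeasure_density)
  hence "prob_space semicircle_measure"
    unfolding semicircle_measure_def d_def by (rule prob_space.prob_space_distr) simp
  thus ?thesis
    by (intro real_distribution.intro real_distribution_axioms.intro)
      (auto simp: semicircle_measure_def)
qed

theorem semicircular_law_semicircle_measure: "semicircular_law semicircle_measure"
  using real_distribution_semicircle_measure semicircle_measure_moment semicircle_moment_odd
    semicircle_moment_even
  by (auto simp: semicircular_law_def has_bochner_integral_iff)

section \<open>From convergence of moments to convergence of distribution functions\<close>

lemma semicircle_moment_even_le: "semicircle_moment (2 * k) \<le> 4 ^ k"
proof -
  have "semicircle_moment (2 * k) \<le> real (2 * k choose k)"
    unfolding semicircle_moment_even by (simp add: divide_le_eq algebra_simps)
  also have "\<dots> \<le> real (2 ^ (2 * k))" by (intro of_nat_mono binomial_le_pow2)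
  finally show ?thesis by (simp add: power_mult)
qed

text \<open>On \<open>[-3, 3]\<close> a polynomial \<open>g\<close> replaces \<open>f\<close>.
  Outside, the error is dominated by a high even power, whose averages are known: the even moments
  grow at most like \<open>4 ^ k\<close>, and 3 exceeds 2, so the factor \<open>(4 / 9) ^ K\<close>
  makes this part small.\<close>

lemma semicircle_moment_convergence:
  fixes a :: "nat \<Rightarrow> nat \<Rightarrow> real" and f :: "real \<Rightarrow> real"
  assumes mom: "\<And>h. (\<lambda>n. (\<Sum>i<n. a n i ^ h) / real n) \<longlonglongrightarrow> semicircle_moment h"
    and f: "continuous_on UNIV f" "\<And>x. 0 \<le> f x" "\<And>x. f x \<le> 1"
  shows "(\<lambda>n. (\<Sum>i<n. f (a n i)) / real n) \<longlonglongrightarrow> integral\<^sup>L semicircle_measure f"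
proof (rule LIMSEQ_I)
  fix r :: real assume r: "r > 0"
  \<comment> \<open>The errors add up to less than \<open>6 * \<epsilon>\<close>: 3 for
    \<open>f\<close> against \<open>g\<close> in the average, 1 for the average of \<open>g\<close>,
    2 for \<open>g\<close> against \<open>f\<close> in the integral.\<close>
  define \<epsilon> where "\<epsilon> = r / 7"
  have \<epsilon>: "\<epsilon> > 0" using r by (simp add: \<epsilon>_def)
  interpret real_distribution semicircle_measure by (rule real_distribution_semicircle_measure)
  define avg where "avg g n = (\<Sum>i<n. g (a n i)) / real n" for g n
  obtain g where g: "real_polynomial_function g" "\<And>x. x \<in> {-3..3} \<Longrightarrow> \<bar>f x - g x\<bar> < \<epsilon>"
    using Stone_Weierstrass_real_polynomial_function[of "{-3..3}" f \<epsilon>] \<epsilon> f(1)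
      continuous_on_subset by (metis compact_Icc subset_UNIV)
  then obtain c d where gc: "g = (\<lambda>x. \<Sum>i\<le>d. c i * x ^ i)"
    using real_polynomial_function_iff_sum by auto
  define D where "D = 1 + (\<Sum>i\<le>d. \<bar>c i\<bar>)"
  have D: "D \<ge> 1" by (simp add: D_def sum_nonneg)
  have "(\<lambda>K. D * 4 ^ d * (4 / 9) ^ K) \<longlonglongrightarrow> D * 4 ^ d * 0"
    by (intro tendsto_intros LIMSEQ_realpow_zero) auto
  hence "eventually (\<lambda>K. D * 4 ^ d * (4 / 9) ^ K < \<epsilon>) sequentially"
    using \<epsilon> by (intro order_tendstoD(2)[where a = \<epsilon>]) auto
  then obtain K where K: "D * 4 ^ d * (4 / 9) ^ K < \<epsilon>" by (auto simp: eventually_sequentially)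
  \<comment> \<open>Beyond 3 the error \<open>D * \<bar>x\<bar> ^ d\<close> is enlarged to
    \<open>D * \<bar>x\<bar> ^ (2 * d) * (\<bar>x\<bar> / 3) ^ (2 * K)\<close>; the exponents add up
    to \<open>m\<close>, and \<open>3 ^ (2 * K)\<close> is the denominator
    \<open>9 ^ K\<close>.\<close>
  define m where "m = 2 * (d + K)"
  have tail: "D / 9 ^ K * semicircle_moment m \<le> \<epsilon>"
  proof -
    have "D / 9 ^ K * semicircle_moment m \<le> D / 9 ^ K * 4 ^ (d + K)"
      unfolding m_def by (intro mult_left_mono semicircle_moment_even_le) (use D in auto)
    also have "\<dots> = D * 4 ^ d * (4 / 9) ^ K" by (simp add: power_add power_divide)
    finally show ?thesis using K by simp
  qed
  have fg: "\<bar>f x - g x\<bar> \<le> \<epsilon> + D / 9 ^ K * x ^ m" for x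
  proof (cases "x \<in> {-3..3}")
    case True
    have "even m" by (simp add: m_def)
    hence "0 \<le> D / 9 ^ K * x ^ m" using D by (intro mult_nonneg_nonneg zero_le_even_power) auto
    thus ?thesis using g(2)[OF True] by linarith
  next
    case False
    hence x: "\<bar>x\<bar> > 3" by auto
    have "\<bar>g x\<bar> \<le> (\<Sum>i\<le>d. \<bar>c i\<bar> * \<bar>x\<bar> ^ d)"
      unfolding gc
    proof (rule order.trans[OF sum_abs], rule sum_mono)
      fix i assume "i \<in> {..d}"
      hence "\<bar>x\<bar> ^ i \<le> \<bar>x\<bar> ^ d" using x by (intro power_increasing) auto
      thus "\<bar>c i * x ^ i\<bar> \<le> \<bar>c i\<bar> * \<bar>x\<bar> ^ d" by (simp add: abs_mult power_abs mult_left_mono)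
    qed
    moreover have "1 \<le> \<bar>x\<bar> ^ d" using x by (intro one_le_power) auto
    moreover have "\<bar>f x\<bar> \<le> 1" using f(2,3)[of x] by simp
    ultimately have "\<bar>f x - g x\<bar> \<le> D * \<bar>x\<bar> ^ d"
      unfolding D_def distrib_right sum_distrib_right by linarith
    also have "\<dots> \<le> D * \<bar>x\<bar> ^ (2 * d)"
      using x D by (intro mult_left_mono power_increasing) auto
    also have "\<dots> \<le> D * \<bar>x\<bar> ^ (2 * d) * (\<bar>x\<bar> / 3) ^ (2 * K)"
    proof -
      have "1 \<le> (\<bar>x\<bar> / 3) ^ (2 * K)" using x by (intro one_le_power) auto
      thus ?thesis using mult_left_mono[of 1 "(\<bar>x\<bar> / 3) ^ (2 * K)" "D * \<bar>x\<bar> ^ (2 * d)"] D by simp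
    qed
    also have "\<dots> = D / 9 ^ K * x ^ m"
      by (simp add: m_def power_add power_divide power_mult power2_eq_square)
    finally show ?thesis using \<epsilon> by linarith
  qed
  have avg_pow: "avg (\<lambda>x. x ^ h) \<longlonglongrightarrow> semicircle_moment h" for h
    using mom[of h] by (simp add: avg_def[abs_def])
  have avg_g: "avg g \<longlonglongrightarrow> (\<Sum>i\<le>d. c i * semicircle_moment i)"
  proof -
    have "avg g = (\<lambda>n. \<Sum>i\<le>d. c i * avg (\<lambda>x. x ^ i) n)"
    proof
      fix n
      have "(\<Sum>k<n. g (a n k)) = (\<Sum>i\<le>d. c i * (\<Sum>k<n. a n k ^ i))"
        unfolding gc sum_distrib_left by (rule sum.swap)
      thus "avg g n = (\<Sum>i\<le>d. c i * avg (\<lambda>x. x ^ i) n)"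
        by (simp only: avg_def sum_divide_distrib[where A = "{..d}"] times_divide_eq_right)
    qed
    thus ?thesis by (simp only:) (intro tendsto_intros avg_pow)
  qed
  have int_pow: "integrable semicircle_measure (\<lambda>x. x ^ h)"
    "integral\<^sup>L semicircle_measure (\<lambda>x. x ^ h) = semicircle_moment h" for h
    using semicircle_measure_moment[of h] by (auto simp: has_bochner_integral_iff)
  have int_g: "integrable semicircle_measure g"
    "integral\<^sup>L semicircle_measure g = (\<Sum>i\<le>d. c i * semicircle_moment i)"
    unfolding gc using int_pow by (auto simp: Bochner_Integration.integral_sum)
  have f_meas: "f \<in> borel_measurable borel" using f(1) by (rule borel_measurable_continuous_onI)
  have int_f: "integrable semicircle_measure f"
    by (rule integrable_const_bound[where B = 1]) (use f f_meas in auto)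
  have "\<bar>integral\<^sup>L semicircle_measure f - integral\<^sup>L semicircle_measure g\<bar>
      \<le> expectation (\<lambda>x. \<bar>f x - g x\<bar>)"
    using int_f int_g(1) integral_abs_bound[of semicircle_measure "\<lambda>x. f x - g x"]
    by (simp add: Bochner_Integration.integral_diff)
  also have "\<dots> \<le> expectation (\<lambda>x. \<epsilon> + D / 9 ^ K * x ^ m)"
    using fg int_f int_g int_pow by (intro integral_mono) auto
  also have "\<dots> = \<epsilon> + D / 9 ^ K * semicircle_moment m"
    using int_pow by (subst Bochner_Integration.integral_add) (auto simp: prob_space[simplified])
  finally have I: "\<bar>integral\<^sup>L semicircle_measure f - (\<Sum>i\<le>d. c i * semicircle_moment i)\<bar> \<le> 2 * \<epsilon>"
    using tail int_g by linarith
  have A: "\<bar>avg f n - avg g n\<bar> \<le> \<epsilon> + D / 9 ^ K * avg (\<lambda>x. x ^ m) n" if "n > 0" for n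
  proof -
    have "\<bar>(\<Sum>i<n. f (a n i)) - (\<Sum>i<n. g (a n i))\<bar> \<le> (\<Sum>i<n. \<bar>f (a n i) - g (a n i)\<bar>)"
      unfolding sum_subtractf[symmetric] by (rule sum_abs)
    also have "\<dots> \<le> (\<Sum>i<n. \<epsilon> + D / 9 ^ K * a n i ^ m)" by (intro sum_mono fg)
    also have "\<dots> = real n * \<epsilon> + D / 9 ^ K * (\<Sum>i<n. a n i ^ m)"
      by (simp add: sum.distrib sum_distrib_left)
    finally have "\<bar>(\<Sum>i<n. f (a n i)) - (\<Sum>i<n. g (a n i))\<bar> / real n
        \<le> (real n * \<epsilon> + D / 9 ^ K * (\<Sum>i<n. a n i ^ m)) / real n"
      by (rule divide_right_mono) simp
    moreover have "\<bar>avg f n - avg g n\<bar> = \<bar>(\<Sum>i<n. f (a n i)) - (\<Sum>i<n. g (a n i))\<bar> / real n"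
      by (simp add: avg_def diff_divide_distrib[symmetric])
    moreover have "(real n * \<epsilon> + D / 9 ^ K * (\<Sum>i<n. a n i ^ m)) / real n = \<epsilon> + D / 9 ^ K * avg (\<lambda>x. x ^ m) n"
      using that by (simp add: avg_def add_divide_distrib)
    ultimately show ?thesis by linarith
  qed
  have "(\<lambda>n. \<epsilon> + D / 9 ^ K * avg (\<lambda>x. x ^ m) n) \<longlonglongrightarrow> \<epsilon> + D / 9 ^ K * semicircle_moment m"
    by (intro tendsto_intros avg_pow)
  hence "eventually (\<lambda>n. \<epsilon> + D / 9 ^ K * avg (\<lambda>x. x ^ m) n < 3 * \<epsilon>) sequentially"
    using tail \<epsilon> by (intro order_tendstoD(2)) auto
  moreover have "eventually (\<lambda>n. \<bar>avg g n - (\<Sum>i\<le>d. c i * semicircle_moment i)\<bar> < \<epsilon>) sequentially"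
    using tendstoD[OF avg_g \<epsilon>] by (simp add: dist_real_def)
  ultimately have "eventually (\<lambda>n. \<bar>avg f n - integral\<^sup>L semicircle_measure f\<bar> < r) sequentially"
    using eventually_gt_at_top[of 0]
  proof eventually_elim
    case (elim n)
    have "7 * \<epsilon> = r" by (simp add: \<epsilon>_def)
    thus ?case using elim(1,2) A[OF elim(3)] I \<epsilon> unfolding abs_le_iff abs_less_iff by linarith
  qed
  thus "\<exists>no. \<forall>n\<ge>no. norm ((\<Sum>i<n. f (a n i)) / real n - integral\<^sup>L semicircle_measure f) < r"
    by (simp add: avg_def eventually_sequentially)
qed

lemma cts_step_lipschitz:
  assumes "p < q"
  shows "\<bar>cts_step p q s - cts_step p q t\<bar> \<le> 1 / (q - p) * \<bar>s - t\<bar>"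
proof -
  have alt: "cts_step p q x = max 0 (min 1 ((q - x) / (q - p)))" for x
    using assms by (auto simp: cts_step_def max_def min_def field_simps)
  have "\<bar>cts_step p q s - cts_step p q t\<bar> \<le> \<bar>(q - s) / (q - p) - (q - t) / (q - p)\<bar>"
    unfolding alt by (auto simp: max_def min_def)
  also have "\<dots> = 1 / (q - p) * \<bar>s - t\<bar>"
    using assms by (simp add: diff_divide_distrib[symmetric] abs_divide abs_minus_commute)
  finally show ?thesis .
qed

lemma cts_step_range: "p < q \<Longrightarrow> 0 \<le> cts_step p q x \<and> cts_step p q x \<le> 1"
  by (auto simp: cts_step_def field_simps)

text \<open>The indicator of a half-line lies between two Lipschitz ramps, whose averages change
  little when \<open>A\<close> is replaced by \<open>A'\<close> and converge for \<open>A'\<close>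
  by the moments. At a continuity point the integrals of the two ramps are close to each
  other.\<close>

theorem esd_semicircle_limit:
  fixes A :: "nat \<Rightarrow> nat \<Rightarrow> nat \<Rightarrow> real"
  assumes sym: "\<And>n i j. A n i j = A n j i"
    and approx: "\<And>\<delta>. \<delta> > 0 \<Longrightarrow> \<exists>A'. (\<forall>n i j. A' n i j = A' n j i) \<and>
      eventually (\<lambda>n. (\<Sum>a<n. \<Sum>b<n. (A n a b - A' n a b)\<^sup>2) / real n \<le> \<delta>) sequentially \<and>
      (\<forall>h. (\<lambda>n. (\<Sum>a<n. mat_power_entry n (A' n) h a a) / real n) \<longlonglongrightarrow> semicircle_moment h)"
    and cont: "isCont (cdf semicircle_measure) u"
  shows "(\<lambda>n. esd (Matrix.mat n n (\<lambda>(i, j). A n i j)) u) \<longlonglongrightarrow> cdf semicircle_measure u"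
proof -
  interpret real_distribution semicircle_measure by (rule real_distribution_semicircle_measure)
  have ex: "\<exists>l v. spectral_decomp n (B n) v l" if "\<forall>n i j. B n i j = B n j i"
    for B :: "nat \<Rightarrow> nat \<Rightarrow> nat \<Rightarrow> real" and n
    using spectral_theorem[of n "B n"] that by metis
  obtain l v where l: "\<And>n. spectral_decomp n (A n) (v n) (l n)"
    using ex[of A] sym by metis
  have step: "(\<lambda>n. (\<Sum>i<n. cts_step p q (l n i)) / real n) \<longlonglongrightarrow> integral\<^sup>L semicircle_measure (cts_step p q)"
    if pq: "p < q" for p q
  proof (rule LIMSEQ_I)
    fix r :: real assume r: "r > 0"
    define L where "L = 1 / (q - p)"
    have L: "L > 0" using pq by (simp add: L_def)
    \<comment> \<open>Chosen so that the Lipschitz estimate \<open>L * sqrt \<delta>\<close> is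
      exactly \<open>r / 2\<close>.\<close>
    define \<delta> where "\<delta> = (r / (2 * L))\<^sup>2"
    have \<delta>: "\<delta> > 0" using r L by (simp add: \<delta>_def)
    have Ld: "L * sqrt \<delta> = r / 2" using r L by (simp add: \<delta>_def)
    obtain A' where A': "\<forall>n i j. A' n i j = A' n j i"
      "eventually (\<lambda>n. (\<Sum>a<n. \<Sum>b<n. (A n a b - A' n a b)\<^sup>2) / real n \<le> \<delta>) sequentially"
      "\<forall>h. (\<lambda>n. (\<Sum>a<n. mat_power_entry n (A' n) h a a) / real n) \<longlonglongrightarrow> semicircle_moment h"
      using approx[OF \<delta>] by blast
    obtain l' v' where l': "\<And>n. spectral_decomp n (A' n) (v' n) (l' n)"
      using ex[OF A'(1)] by metis
    have "(\<lambda>n. (\<Sum>i<n. cts_step p q (l' n i)) / real n) \<longlonglongrightarrow> integral\<^sup>L semicircle_measure (cts_step p q)"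
    proof (rule semicircle_moment_convergence)
      show "(\<lambda>n. (\<Sum>i<n. l' n i ^ h) / real n) \<longlonglongrightarrow> semicircle_moment h" for h
        using A'(3) by (simp add: trace_mat_power_spectral[OF l'])
      show "continuous_on UNIV (cts_step p q)"
        using cts_step_uniformly_continuous[OF pq]
        by (simp add: isUCont_isCont continuous_at_imp_continuous_on)
    qed (use cts_step_range[OF pq] in auto)
    from tendstoD[OF this, of "r / 2"] r
    have "eventually (\<lambda>n. \<bar>(\<Sum>i<n. cts_step p q (l' n i)) / real n
        - integral\<^sup>L semicircle_measure (cts_step p q)\<bar> < r / 2) sequentially"
      by (simp add: dist_real_def)
    with A'(2) eventually_gt_at_top[of 0]
    have "eventually (\<lambda>n. \<bar>(\<Sum>i<n. cts_step p q (l n i)) / real n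
        - integral\<^sup>L semicircle_measure (cts_step p q)\<bar> < r) sequentially"
    proof eventually_elim
      case (elim n)
      define F where "F = (\<Sum>a<n. \<Sum>b<n. (A n a b - A' n a b)\<^sup>2)"
      have n: "real n > 0" using elim(2) by simp
      have "\<bar>(\<Sum>i<n. cts_step p q (l n i)) - (\<Sum>i<n. cts_step p q (l' n i))\<bar> \<le> L * sqrt (real n * F)"
        unfolding F_def L_def by (rule spectral_lipschitz[OF l l' cts_step_lipschitz[OF pq]])
      hence "\<bar>(\<Sum>i<n. cts_step p q (l n i)) - (\<Sum>i<n. cts_step p q (l' n i))\<bar> / real n
          \<le> L * sqrt (real n * F) / real n" using n by (intro divide_right_mono) auto
      also have "L * sqrt (real n * F) / real n = L * sqrt (F / real n)"
      proof -
        have "real n * F = (real n)\<^sup>2 * (F / real n)" using n by (simp add: power2_eq_square)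
        hence "sqrt (real n * F) = real n * sqrt (F / real n)" using n by (simp only: real_sqrt_mult) simp
        thus ?thesis using n by simp
      qed
      also have "\<dots> \<le> L * sqrt \<delta>" using elim(1) L by (intro mult_left_mono) (auto simp: F_def)
      also have "\<dots> = r / 2" by (rule Ld)
      finally have "\<bar>(\<Sum>i<n. cts_step p q (l n i)) / real n - (\<Sum>i<n. cts_step p q (l' n i)) / real n\<bar> \<le> r / 2"
        by (simp add: diff_divide_distrib[symmetric])
      thus ?case using elim(3) by linarith
    qed
    thus "\<exists>no. \<forall>n\<ge>no. norm ((\<Sum>i<n. cts_step p q (l n i)) / real n
        - integral\<^sup>L semicircle_measure (cts_step p q)) < r"
      by (simp add: eventually_sequentially)
  qed
  define E where "E n = esd (Matrix.mat n n (\<lambda>(i, j). A n i j)) u" for n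
  have E: "E n = (\<Sum>i<n. of_bool (l n i \<le> u)) / real n" for n
  proof -
    have "(\<Sum>i<n. of_bool (l n i \<le> u)) = real (card {i. i < n \<and> l n i \<le> u})"
      by (simp add: of_bool_def sum.If_cases Int_def)
    thus ?thesis unfolding E_def esd_spectral[OF l] by simp
  qed
  have up: "E n \<le> (\<Sum>i<n. cts_step u q (l n i)) / real n" if "u < q" for n q
    unfolding E using cts_step_range[OF that]
    by (intro divide_right_mono sum_mono) (auto simp: cts_step_def)
  have lo: "(\<Sum>i<n. cts_step p u (l n i)) / real n \<le> E n" if "p < u" for n p
    unfolding E using cts_step_range[OF that] that
    by (intro divide_right_mono sum_mono) (auto simp: cts_step_def)
  have "E \<longlonglongrightarrow> cdf semicircle_measure u"
  proof (rule LIMSEQ_I)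
    fix r :: real assume r: "r > 0"
    then obtain d where d: "d > 0" "\<And>x. \<bar>x - u\<bar> < d \<Longrightarrow>
        \<bar>cdf semicircle_measure x - cdf semicircle_measure u\<bar> < r / 2"
      using cont[unfolded continuous_at_eps_delta, rule_format, of "r / 2"] by (auto simp: dist_real_def)
    define e where "e = d / 2"
    have e: "e > 0" "e < d" using d by (auto simp: e_def)
    have "\<bar>u + e - u\<bar> < d" "\<bar>u - e - u\<bar> < d" using e by auto
    note d2 = this[THEN d(2), unfolded abs_less_iff]
    have 1: "integral\<^sup>L semicircle_measure (cts_step u (u + e)) < cdf semicircle_measure u + r / 2"
      using cdf_cts_step(2)[of u "u + e"] d2(1) e by linarith
    have 2: "cdf semicircle_measure u - r / 2 < integral\<^sup>L semicircle_measure (cts_step (u - e) u)"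
      using cdf_cts_step(1)[of "u - e" u] d2(2) e by linarith
    have "eventually (\<lambda>n. (\<Sum>i<n. cts_step u (u + e) (l n i)) / real n < cdf semicircle_measure u + r / 2) sequentially"
      using step[of u "u + e"] 1 e by (intro order_tendstoD(2)) auto
    moreover have "eventually (\<lambda>n. cdf semicircle_measure u - r / 2 < (\<Sum>i<n. cts_step (u - e) u (l n i)) / real n) sequentially"
      using step[of "u - e" u] 2 e by (intro order_tendstoD(1)) auto
    ultimately have "eventually (\<lambda>n. \<bar>E n - cdf semicircle_measure u\<bar> < r) sequentially"
    proof eventually_elim
      case (elim n)
      have "E n \<le> (\<Sum>i<n. cts_step u (u + e) (l n i)) / real n"
        "(\<Sum>i<n. cts_step (u - e) u (l n i)) / real n \<le> E n" using up lo e by auto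
      thus ?case using elim r unfolding abs_less_iff by linarith
    qed
    thus "\<exists>no. \<forall>n\<ge>no. norm (E n - cdf semicircle_measure u) < r"
      by (simp add: eventually_sequentially)
  qed
  thus ?thesis by (simp add: E_def[abs_def])
qed

subsection \<open>A law of large numbers and truncation\<close>

context prob_space
begin

lemma expectation_sum_square:
  fixes U :: "nat \<Rightarrow> 'a \<Rightarrow> real"
  assumes indep: "indep_vars (\<lambda>_. borel) U UNIV" and bd: "\<And>t \<omega>. \<bar>U t \<omega>\<bar> \<le> c t"
    and mean: "\<And>t. expectation (U t) = 0"
  shows "expectation (\<lambda>\<omega>. (\<Sum>t<N. U t \<omega>)\<^sup>2) = (\<Sum>t<N. expectation (\<lambda>\<omega>. (U t \<omega>)\<^sup>2))"
    and "integrable M (\<lambda>\<omega>. (\<Sum>t<N. U t \<omega>)\<^sup>2)"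
proof -
  have [measurable]: "U t \<in> borel_measurable M" for t
    using indep by (auto simp: indep_vars_def)
  have c: "c t \<ge> 0" for t using bd[of t undefined] by linarith
  have int1: "integrable M (U t)" for t
    by (rule integrable_const_bound[where B = "c t"]) (use bd in auto)
  have int2: "integrable M (\<lambda>\<omega>. U s \<omega> * U t \<omega>)" for s t
    by (rule integrable_const_bound[where B = "c s * c t"])
      (use bd c in \<open>auto simp: abs_mult intro!: mult_mono\<close>)
  have cross: "expectation (\<lambda>\<omega>. U s \<omega> * U t \<omega>) = 0" if "s \<noteq> t" for s t
  proof -
    have "expectation (\<lambda>\<omega>. \<Prod>i\<in>{s, t}. U i \<omega>) = (\<Prod>i\<in>{s, t}. expectation (U i))"
      by (rule indep_vars_lebesgue_integral) (use indep_vars_subset[OF indep] int1 in auto)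
    thus ?thesis using that mean by simp
  qed
  have eq: "(\<lambda>\<omega>. (\<Sum>t<N. U t \<omega>)\<^sup>2) = (\<lambda>\<omega>. \<Sum>s<N. \<Sum>t<N. U s \<omega> * U t \<omega>)"
    by (simp add: power2_eq_square sum_product)
  show "integrable M (\<lambda>\<omega>. (\<Sum>t<N. U t \<omega>)\<^sup>2)"
    unfolding eq by (intro Bochner_Integration.integrable_sum int2)
  have "expectation (\<lambda>\<omega>. (\<Sum>t<N. U t \<omega>)\<^sup>2) = (\<Sum>s<N. \<Sum>t<N. expectation (\<lambda>\<omega>. U s \<omega> * U t \<omega>))"
    unfolding eq
    by (subst Bochner_Integration.integral_sum,
        intro Bochner_Integration.integrable_sum int2,
        intro sum.cong refl Bochner_Integration.integral_sum int2)
  also have "\<dots> = (\<Sum>s<N. \<Sum>t<N. if t = s then expectation (\<lambda>\<omega>. (U s \<omega>)\<^sup>2) else 0)"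
    using cross by (intro sum.cong) (auto simp: power2_eq_square)
  also have "\<dots> = (\<Sum>t<N. expectation (\<lambda>\<omega>. (U t \<omega>)\<^sup>2))" by simp
  finally show "expectation (\<lambda>\<omega>. (\<Sum>t<N. U t \<omega>)\<^sup>2) = (\<Sum>t<N. expectation (\<lambda>\<omega>. (U t \<omega>)\<^sup>2))" .
qed

end

text \<open>The term \<open>a t\<close> enters from the first power of 2 above \<open>t\<close> on,
  with weights \<open>4 ^ (- k)\<close>; their geometric sum is comparable to
  \<open>1 / (t + 1) ^ 2\<close>. The proof replaces the exchange of sums by a recursion for the
  averages.\<close>

lemma summable_dyadic_averages:
  fixes a :: "nat \<Rightarrow> real"
  assumes nonneg: "\<And>t. a t \<ge> 0" and sum: "summable (\<lambda>t. a t / (real t + 1)\<^sup>2)"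
  shows "summable (\<lambda>k. (\<Sum>t<2 ^ k. a t) / 4 ^ k)"
proof -
  define q where "q k = (\<Sum>t<2 ^ k. a t) / 4 ^ k" for k :: nat
  define \<Phi> where "\<Phi> k = (\<Sum>t<2 ^ k. a t / (real t + 1)\<^sup>2)" for k :: nat
  have q0: "q k \<ge> 0" for k unfolding q_def using nonneg by (intro divide_nonneg_nonneg sum_nonneg) auto
  have rec: "q (Suc k) \<le> q k / 4 + (\<Phi> (Suc k) - \<Phi> k)" for k
  proof -
    have split: "{..<2 ^ Suc k} = {..<2 ^ k} \<union> {2 ^ k..<(2::nat) ^ Suc k}" by auto
    have sp: "(\<Sum>t<2 ^ Suc k. f t) = (\<Sum>t<2 ^ k. f t) + (\<Sum>t\<in>{2 ^ k..<2 ^ Suc k}. f t)" for f :: "nat \<Rightarrow> real"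
      unfolding split by (rule sum.union_disjoint) auto
    have "(\<Sum>t\<in>{2 ^ k..<2 ^ Suc k}. a t / 4 ^ Suc k) \<le> (\<Sum>t\<in>{2 ^ k..<2 ^ Suc k}. a t / (real t + 1)\<^sup>2)"
    proof (intro sum_mono divide_left_mono nonneg)
      fix t :: nat assume "t \<in> {2 ^ k..<2 ^ Suc k}"
      hence "t + 1 \<le> 2 ^ Suc k" by auto
      hence "real (t + 1) \<le> real (2 ^ Suc k)" by (simp only: of_nat_le_iff)
      hence "(real t + 1)\<^sup>2 \<le> (2 ^ Suc k)\<^sup>2" by (intro power_mono) auto
      also have "\<dots> = 4 ^ Suc k" by (simp add: power2_eq_square flip: power_mult_distrib)
      finally show "(real t + 1)\<^sup>2 \<le> 4 ^ Suc k" .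
    qed auto
    moreover have "q (Suc k) = q k / 4 + (\<Sum>t\<in>{2 ^ k..<2 ^ Suc k}. a t / 4 ^ Suc k)"
      unfolding q_def sp add_divide_distrib sum_divide_distrib
      by (simp add: sum_divide_distrib mult.commute)
    moreover have "\<Phi> (Suc k) - \<Phi> k = (\<Sum>t\<in>{2 ^ k..<2 ^ Suc k}. a t / (real t + 1)\<^sup>2)"
      unfolding \<Phi>_def sp by simp
    ultimately show ?thesis by simp
  qed
  have \<Phi>0: "\<Phi> k \<ge> 0" for k unfolding \<Phi>_def using nonneg by (intro sum_nonneg) auto
  define S where "S = (\<Sum>t. a t / (real t + 1)\<^sup>2)"
  have \<Phi>: "\<Phi> k \<le> S" for k
    unfolding \<Phi>_def S_def using nonneg by (intro sum_le_suminf sum) auto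
  \<comment> \<open>The extra \<open>q N / 3\<close> absorbs the term \<open>q N / 4\<close> of the
    recursion after multiplication by 4/3.\<close>
  have bound: "(\<Sum>k\<le>N. q k) + q N / 3 \<le> 4 / 3 * (q 0 + \<Phi> N)" for N
  proof (induction N)
    case 0
    thus ?case using \<Phi>0[of 0] by simp
  next
    case (Suc N)
    thus ?case using rec[of N] by simp
  qed
  have "summable q"
  proof (rule summableI_nonneg_bounded[OF q0])
    fix n
    have "(\<Sum>k<n. q k) \<le> (\<Sum>k\<le>n. q k)" using q0 by (intro sum_mono2) auto
    also have "\<dots> \<le> 4 / 3 * (q 0 + S)" using bound[of n] q0[of n] \<Phi>[of n] by argo
    finally show "(\<Sum>k<n. q k) \<le> 4 / 3 * (q 0 + S)" .
  qed
  thus ?thesis by (simp add: q_def[abs_def])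
qed

text \<open>Etemadi's argument: truncation, variances along the dyadic subsequence, and monotonicity
  of the partial sums.\<close>
lemma (in prob_space) slln_upper_bound:
  fixes W :: "nat \<Rightarrow> 'a \<Rightarrow> real"
  assumes indep: "indep_vars (\<lambda>_. borel) W UNIV" and nonneg: "\<And>t \<omega>. W t \<omega> \<ge> 0"
    and int: "\<And>t. integrable M (W t)" and mean: "\<And>t. expectation (W t) \<le> \<epsilon>" and \<epsilon>: "\<epsilon> > 0"
    and tail: "summable (\<lambda>t. prob {\<omega> \<in> space M. W t \<omega> > real t + 1})"
    and var: "summable (\<lambda>t. expectation (\<lambda>\<omega>. (if W t \<omega> \<le> real t + 1 then W t \<omega> else 0)\<^sup>2) / (real t + 1)\<^sup>2)"
  shows "AE \<omega> in M. eventually (\<lambda>n. (\<Sum>t<n. W t \<omega>) \<le> 3 * \<epsilon> * real n) sequentially"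
proof -
  have [measurable]: "W t \<in> borel_measurable M" for t
    using indep by (auto simp: indep_vars_def)
  define V where "V t \<omega> = (if W t \<omega> \<le> real t + 1 then W t \<omega> else 0)" for t \<omega>
  have V_meas [measurable]: "V t \<in> borel_measurable M" for t unfolding V_def by measurable
  have V0: "0 \<le> V t \<omega>" and V1: "V t \<omega> \<le> real t + 1" and VW: "V t \<omega> \<le> W t \<omega>" for t \<omega>
    using nonneg by (auto simp: V_def)
  have intV: "integrable M (V t)" for t
    by (rule integrable_const_bound[where B = "real t + 1"]) (use V0 V1 in auto)
  have EV: "0 \<le> expectation (V t)" "expectation (V t) \<le> \<epsilon>" "expectation (V t) \<le> real t + 1" for t
  proof -
    show "0 \<le> expectation (V t)" using V0 by (intro integral_nonneg_AE) auto
    show "expectation (V t) \<le> \<epsilon>"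
      using integral_mono[OF intV[of t] int[of t] VW] mean[of t] by linarith
    show "expectation (V t) \<le> real t + 1" using V1 by (intro integral_le_const intV) auto
  qed
  define U where "U t \<omega> = V t \<omega> - expectation (V t)" for t \<omega>
  have U_bd: "\<bar>U t \<omega>\<bar> \<le> real t + 1" for t \<omega>
    using V0[of t \<omega>] V1[of t \<omega>] EV[of t] by (auto simp: U_def abs_le_iff)
  have U_mean: "expectation (U t) = 0" for t
    unfolding U_def by (subst Bochner_Integration.integral_diff) (auto simp: intV prob_space)
  have U_indep: "indep_vars (\<lambda>_. borel) U UNIV"
  proof -
    have "indep_vars (\<lambda>_. borel)
        (\<lambda>t \<omega>. (\<lambda>w. (if w \<le> real t + 1 then w else 0) - expectation (V t)) (W t \<omega>)) UNIV"
      by (rule indep_vars_compose2[OF indep]) measurable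
    thus ?thesis by (simp add: U_def[abs_def] V_def)
  qed
  have U2: "expectation (\<lambda>\<omega>. (U t \<omega>)\<^sup>2) \<le> expectation (\<lambda>\<omega>. (V t \<omega>)\<^sup>2)" for t
  proof -
    have "integrable M (\<lambda>\<omega>. (V t \<omega>)\<^sup>2)"
      by (rule integrable_const_bound[where B = "(real t + 1)\<^sup>2"])
        (use V0 V1 in \<open>auto intro!: power_mono\<close>)
    thus ?thesis unfolding U_def using variance_eq[OF intV] by simp
  qed
  define f where "f k \<omega> = ((\<Sum>t<2 ^ k. U t \<omega>) / 2 ^ k)\<^sup>2" for k :: nat and \<omega>
  have "AE \<omega> in M. (\<lambda>k. f k \<omega>) \<longlonglongrightarrow> 0"
  proof (rule AE_tendsto_0_of_summable_expectation)
    show "integrable M (f k)" for k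
      unfolding f_def power_divide using expectation_sum_square(2)[OF U_indep U_bd U_mean] by simp
    show "f k \<omega> \<ge> 0" for k \<omega> by (simp add: f_def)
    show "summable (\<lambda>k. expectation (f k))"
    proof (rule summable_comparison_test_ev[OF always_eventually])
      show "summable (\<lambda>k. (\<Sum>t<2 ^ k. expectation (\<lambda>\<omega>. (V t \<omega>)\<^sup>2)) / 4 ^ k)"
        by (rule summable_dyadic_averages) (use var in \<open>auto simp: V_def\<close>)
      show "\<forall>k. norm (expectation (f k)) \<le> (\<Sum>t<2 ^ k. expectation (\<lambda>\<omega>. (V t \<omega>)\<^sup>2)) / 4 ^ k"
      proof
        fix k
        have "0 \<le> expectation (f k)" by (rule integral_nonneg_AE) (simp add: f_def)
        have "expectation (f k) = expectation (\<lambda>\<omega>. (\<Sum>t<2 ^ k. U t \<omega>)\<^sup>2) / (2 ^ k)\<^sup>2"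
          unfolding f_def power_divide by (rule integral_divide_zero)
        also have "(2 ^ k)\<^sup>2 = (4::real) ^ k" by (simp add: power2_eq_square flip: power_mult_distrib)
        also have "expectation (\<lambda>\<omega>. (\<Sum>t<2 ^ k. U t \<omega>)\<^sup>2) = (\<Sum>t<2 ^ k. expectation (\<lambda>\<omega>. (U t \<omega>)\<^sup>2))"
          by (rule expectation_sum_square(1)[OF U_indep U_bd U_mean])
        also have "(\<Sum>t<2 ^ k. expectation (\<lambda>\<omega>. (U t \<omega>)\<^sup>2)) / 4 ^ k
            \<le> (\<Sum>t<2 ^ k. expectation (\<lambda>\<omega>. (V t \<omega>)\<^sup>2)) / 4 ^ k"
          by (intro divide_right_mono sum_mono U2) auto
        finally show "norm (expectation (f k)) \<le> (\<Sum>t<2 ^ k. expectation (\<lambda>\<omega>. (V t \<omega>)\<^sup>2)) / 4 ^ k"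
          using \<open>0 \<le> expectation (f k)\<close> by simp
      qed
    qed
  qed
  \<comment> \<open>Borel-Cantelli: truncation changes only finitely many of the \<open>W t\<close>,
    collected in \<open>R\<close> below.\<close>
  moreover have "AE \<omega> in M. eventually (\<lambda>t. \<omega> \<in> space M - {\<omega> \<in> space M. W t \<omega> > real t + 1}) sequentially"
    by (rule borel_cantelli_AE1) (use tail in \<open>auto simp: less_top[symmetric]\<close>)
  ultimately show ?thesis
  proof eventually_elim
    case (elim \<omega>)
    from elim(2) obtain t0 where t0: "\<And>t. t \<ge> t0 \<Longrightarrow> W t \<omega> \<le> real t + 1"
      by (fastforce simp: eventually_sequentially)
    define R where "R = (\<Sum>t<t0. W t \<omega>)"
    have WV: "(\<Sum>t<n. W t \<omega>) \<le> R + (\<Sum>t<n. V t \<omega>)" for n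
    proof -
      have "(\<Sum>t<n. W t \<omega>) \<le> (\<Sum>t<n. (if t < t0 then W t \<omega> else 0) + V t \<omega>)"
        using t0 nonneg V0 by (intro sum_mono) (auto simp: V_def)
      also have "\<dots> = (\<Sum>t<n. if t < t0 then W t \<omega> else 0) + (\<Sum>t<n. V t \<omega>)" by (rule sum.distrib)
      also have "(\<Sum>t<n. if t < t0 then W t \<omega> else 0) = (\<Sum>t\<in>{..<n} \<inter> {..<t0}. W t \<omega>)"
        by (simp add: sum.If_cases lessThan_def)
      also have "\<dots> \<le> R" unfolding R_def using nonneg by (intro sum_mono2) auto
      finally show ?thesis by simp
    qed
    have "(\<lambda>k. sqrt (f k \<omega>)) \<longlonglongrightarrow> sqrt 0" using elim(1) by (intro tendsto_real_sqrt)
    hence "eventually (\<lambda>k. sqrt (f k \<omega>) < \<epsilon> / 8) sequentially"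
      using \<epsilon> by (intro order_tendstoD(2)) auto
    then obtain k0 where k0: "\<And>k. k \<ge> k0 \<Longrightarrow> sqrt (f k \<omega>) < \<epsilon> / 8" by (auto simp: eventually_sequentially)
    \<comment> \<open>The means contribute at most \<open>\<epsilon>\<close> per term, the
      fluctuation at most \<open>\<epsilon> / 8\<close>.\<close>
    have T: "(\<Sum>t<2 ^ k. V t \<omega>) \<le> 9 / 8 * \<epsilon> * 2 ^ k" if "k \<ge> k0" for k
    proof -
      have "sqrt (f k \<omega>) = \<bar>(\<Sum>t<2 ^ k. U t \<omega>) / 2 ^ k\<bar>" unfolding f_def by (rule real_sqrt_abs)
      hence "(\<Sum>t<2 ^ k. U t \<omega>) / 2 ^ k \<le> \<epsilon> / 8" using k0[OF that] by linarith
      hence "(\<Sum>t<2 ^ k. U t \<omega>) \<le> \<epsilon> / 8 * 2 ^ k" by (simp add: divide_le_eq)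
      moreover have "(\<Sum>t<2 ^ k. V t \<omega>) = (\<Sum>t<2 ^ k. U t \<omega>) + (\<Sum>t<2 ^ k. expectation (V t))"
        by (simp add: U_def sum_subtractf)
      moreover have "(\<Sum>t<2 ^ k. expectation (V t)) \<le> (\<Sum>t<(2::nat) ^ k. \<epsilon>)" by (intro sum_mono EV)
      moreover have "(\<Sum>t<(2::nat) ^ k. \<epsilon>) = 2 ^ k * \<epsilon>" by simp
      ultimately have "(\<Sum>t<2 ^ k. V t \<omega>) \<le> \<epsilon> / 8 * 2 ^ k + 2 ^ k * \<epsilon>" by linarith
      also have "\<dots> = 9 / 8 * \<epsilon> * 2 ^ k" by (simp add: field_simps)
      finally show ?thesis .
    qed
    have "eventually (\<lambda>n. R * 4 / (3 * \<epsilon>) \<le> real n) sequentially"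
      by (rule eventually_sequentiallyI[of "nat \<lceil>R * 4 / (3 * \<epsilon>)\<rceil>"]) linarith
    with eventually_ge_at_top[of "2 ^ k0"]
    show "eventually (\<lambda>n. (\<Sum>t<n. W t \<omega>) \<le> 3 * \<epsilon> * real n) sequentially"
    proof eventually_elim
      case (elim n)
      have n: "n > 0" using elim(1) by (metis gr0I not_le zero_less_numeral zero_less_power)
      \<comment> \<open>Rounding \<open>n\<close> up to a power of 2 at most doubles the bound, from
        9/8 to 9/4; the remaining 3/4 up to the constant 3 is left for \<open>R\<close>.\<close>
      obtain k where k: "2 ^ k \<le> n" "n < 2 ^ (k + 1)" using ex_power_ivl1[of 2 n] n by auto
      have "2 ^ k0 < (2::nat) ^ (k + 1)" using elim(1) k(2) by linarith
      hence "k0 < k + 1" by (intro power_less_imp_less_exp[of 2]) auto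
      hence "k + 1 \<ge> k0" by simp
      have "(\<Sum>t<n. V t \<omega>) \<le> (\<Sum>t<2 ^ (k + 1). V t \<omega>)"
        using k(2) V0 by (intro sum_mono2) auto
      also have "\<dots> \<le> 9 / 8 * \<epsilon> * 2 ^ (k + 1)" by (rule T) fact
      also have "\<dots> = 9 / 4 * \<epsilon> * real (2 ^ k)" by simp
      also have "\<dots> \<le> 9 / 4 * \<epsilon> * real n"
        using k(1) \<epsilon> by (intro mult_left_mono of_nat_mono) auto
      finally have "(\<Sum>t<n. V t \<omega>) \<le> 9 / 4 * \<epsilon> * real n" .
      moreover have "R \<le> 3 / 4 * \<epsilon> * real n" using elim(2) \<epsilon> by (simp add: field_simps)
      ultimately show ?case using WV[of n] by linarith
    qed
  qed
qed

text \<open>Only the terms with \<open>t + 1 \<ge> w\<close> count, and a tail of the series of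
  \<open>1 / t ^ 2\<close> beyond \<open>w\<close> is of order \<open>1 / w\<close>. For identically
  distributed variables this bounds the sum of truncated variances by a multiple of the
  mean.\<close>

lemma truncated_square_sum_le:
  fixes w :: real
  assumes "w \<ge> 0"
  shows "(\<Sum>t<N. (if w \<le> real t + 1 then w else 0)\<^sup>2 / (real t + 1)\<^sup>2) \<le> 2 * w"
proof (cases "w = 0")
  case False
  hence w: "w > 0" using assms by simp
  have "(\<Sum>t<N. (if w \<le> real t + 1 then w else 0)\<^sup>2 / (real t + 1)\<^sup>2)
      \<le> (if w \<le> real N then 2 * w - w\<^sup>2 / real N else 0)"
  proof (induction N)
    case 0
    thus ?case using w by simp
  next
    case (Suc N)
    show ?case
    proof (cases "w \<le> real N")
      case True
      hence N: "real N > 0" using w by linarith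
      have "w\<^sup>2 / (real N + 1)\<^sup>2 \<le> w\<^sup>2 / (real N * (real N + 1))"
        using N by (intro divide_left_mono) (auto simp: power2_eq_square)
      also have "\<dots> = w\<^sup>2 / real N - w\<^sup>2 / (real N + 1)" using N by (simp add: field_simps)
      finally show ?thesis using Suc True by (simp add: add_ac)
    next
      case False
      show ?thesis
      proof (cases "w \<le> real N + 1")
        case True
        have "w\<^sup>2 / (real N + 1)\<^sup>2 \<le> w\<^sup>2 / (real N + 1)"
          by (intro divide_left_mono) (auto simp: power2_eq_square)
        moreover have "w\<^sup>2 / (real N + 1) \<le> w"
          using True w by (simp add: divide_le_eq power2_eq_square mult_left_mono)
        ultimately have "w\<^sup>2 / (real N + 1)\<^sup>2 \<le> 2 * w - w\<^sup>2 / (real N + 1)" by linarith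
        thus ?thesis using Suc False True by (simp add: add_ac)
      next
        case False
        thus ?thesis using Suc \<open>\<not> w \<le> real N\<close> by (simp add: add_ac)
      qed
    qed
  qed
  also have "\<dots> \<le> 2 * w" using w by auto
  finally show ?thesis .
qed simp

text \<open>The sum counts the positive integers up to \<open>N\<close> below \<open>w\<close>. In
  expectation it bounds the sum of tail probabilities by the mean.\<close>

lemma sum_exceedances_le:
  fixes w :: real
  assumes "w \<ge> 0"
  shows "(\<Sum>t<N. of_bool (real t + 1 < w)) \<le> w"
proof -
  have "(\<Sum>t<N. of_bool (real t + 1 < w)) \<le> min (real N) w"
  proof (induction N)
    case (Suc N)
    have step: "s + of_bool (real N + 1 < w) \<le> min (real (Suc N)) w" if "s \<le> min (real N) w" for s
      using that by (auto simp: min_def of_bool_def split: if_splits)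
    show ?case unfolding sum.lessThan_Suc by (rule step[OF Suc])
  qed (use assms in simp)
  thus ?thesis by simp
qed

context prob_space
begin

section \<open>The three assumptions on the input sequences\<close>

lemma assumption_A1_imp_A3:
  assumes "assumption_A1 M x"
  shows "assumption_A3 M x"
proof -
  from assms obtain B where B: "\<And>t. AE \<omega> in M. \<bar>x t \<omega>\<bar> \<le> B" and s: "indep_standardized M x"
    by (auto simp: assumption_A1_def)
  have [measurable]: "x t \<in> borel_measurable M" for t
    using s by (auto simp: indep_standardized_def standardized_def)
  have "integrable M (\<lambda>\<omega>. \<bar>x t \<omega>\<bar> ^ k) \<and> expectation (\<lambda>\<omega>. \<bar>x t \<omega>\<bar> ^ k) \<le> B ^ k" for t k
  proof
    have bd: "AE \<omega> in M. \<bar>x t \<omega>\<bar> ^ k \<le> B ^ k"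
      using B[of t] by eventually_elim (auto intro: power_mono)
    show int: "integrable M (\<lambda>\<omega>. \<bar>x t \<omega>\<bar> ^ k)"
      by (rule integrable_const_bound[where B = "B ^ k"]) (use bd in auto)
    show "expectation (\<lambda>\<omega>. \<bar>x t \<omega>\<bar> ^ k) \<le> B ^ k" by (rule integral_le_const[OF int bd])
  qed
  thus ?thesis using s unfolding assumption_A3_def by blast
qed

text \<open>Beyond independence and standardization, the truncation arguments draw only on identical
  distribution or on uniformly bounded fourth moments.\<close>

lemma input_sequence_cases:
  assumes "input_sequence M x"
  obtains "\<And>s t. distr M borel (x s) = distr M borel (x t)"
  | C where "\<And>t. integrable M (\<lambda>\<omega>. x t \<omega> ^ 4)" "\<And>t. expectation (\<lambda>\<omega>. x t \<omega> ^ 4) \<le> C"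
proof -
  have "assumption_A2 M x \<or> assumption_A3 M x"
    using assms assumption_A1_imp_A3 by (auto simp: input_sequence_def)
  thus ?thesis
  proof
    assume "assumption_A2 M x"
    thus ?thesis using that(1) by (auto simp: assumption_A2_def)
  next
    assume "assumption_A3 M x"
    then obtain C where "\<forall>t. integrable M (\<lambda>\<omega>. \<bar>x t \<omega>\<bar> ^ 4) \<and> expectation (\<lambda>\<omega>. \<bar>x t \<omega>\<bar> ^ 4) \<le> C"
      unfolding assumption_A3_def by blast
    thus ?thesis using that(2)[of C] by simp
  qed
qed

lemma input_sequence_facts:
  assumes "input_sequence M x"
  shows "indep_vars (\<lambda>_. borel) x UNIV" "x t \<in> borel_measurable M" "integrable M (x t)"
    "integrable M (\<lambda>\<omega>. (x t \<omega>)\<^sup>2)" "expectation (x t) = 0" "expectation (\<lambda>\<omega>. (x t \<omega>)\<^sup>2) = 1"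
proof -
  have s: "indep_standardized M x"
    using assms by (auto simp: input_sequence_def assumption_A1_def assumption_A2_def assumption_A3_def)
  thus "indep_vars (\<lambda>_. borel) x UNIV" "x t \<in> borel_measurable M" "integrable M (x t)"
    "integrable M (\<lambda>\<omega>. (x t \<omega>)\<^sup>2)" and 0: "expectation (x t) = 0"
    by (auto simp: indep_standardized_def standardized_def)
  have "expectation (\<lambda>\<omega>. (x t \<omega> - expectation (x t))\<^sup>2) = 1"
    using s unfolding indep_standardized_def standardized_def by blast
  thus "expectation (\<lambda>\<omega>. (x t \<omega>)\<^sup>2) = 1" unfolding 0 by simp
qed

text \<open>Two series have to converge. For identical distributions, their partial sums are
  expectations of sums over \<open>t\<close> bounded pointwise by \<open>g\<close> and
  \<open>2 * g\<close>; with fourth moments, both are dominated by \<open>C / (t + 1) ^ 2\<close>,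
  as \<open>g ^ 2\<close> is at most the fourth power.\<close>

lemma input_sequence_slln:
  fixes g :: "real \<Rightarrow> real"
  assumes x: "input_sequence M x" and g [measurable]: "g \<in> borel_measurable borel"
    and g0: "\<And>z. 0 \<le> g z" and g2: "\<And>z. g z \<le> z\<^sup>2"
    and mean: "\<And>t. expectation (\<lambda>\<omega>. g (x t \<omega>)) \<le> \<epsilon>" and \<epsilon>: "\<epsilon> > 0"
  shows "AE \<omega> in M. eventually (\<lambda>n. (\<Sum>t<n. g (x t \<omega>)) \<le> 3 * \<epsilon> * real n) sequentially"
proof -
  note [measurable] = input_sequence_facts(2)[OF x]
  have int: "integrable M (\<lambda>\<omega>. g (x t \<omega>))" for t
    by (rule Bochner_Integration.integrable_bound[OF input_sequence_facts(4)[OF x, of t]])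
      (use g0 g2 in auto)
  define P where "P t = prob {\<omega> \<in> space M. g (x t \<omega>) > real t + 1}" for t
  define v where "v t \<omega> = (if g (x t \<omega>) \<le> real t + 1 then g (x t \<omega>) else 0)\<^sup>2" for t \<omega>
  have "summable P \<and> summable (\<lambda>t. expectation (v t) / (real t + 1)\<^sup>2)"
  proof (rule input_sequence_cases[OF x])
    assume id: "\<And>s t. distr M borel (x s) = distr M borel (x t)"
    have same: "expectation (\<lambda>\<omega>. h (x t \<omega>)) = expectation (\<lambda>\<omega>. h (x 0 \<omega>))"
      if [measurable]: "h \<in> borel_measurable borel" for h :: "real \<Rightarrow> real" and t
      using integral_distr[of "x t" M borel h] integral_distr[of "x 0" M borel h] id[of t 0] by simp
    have Pt: "P t = expectation (\<lambda>\<omega>. of_bool (real t + 1 < g (x 0 \<omega>)))" for t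
    proof -
      have "P t = expectation (indicator {\<omega> \<in> space M. g (x t \<omega>) > real t + 1})"
        unfolding P_def by simp
      also have "\<dots> = expectation (\<lambda>\<omega>. of_bool (real t + 1 < g (x t \<omega>)))"
        by (intro Bochner_Integration.integral_cong) (auto simp: indicator_def)
      also have "\<dots> = expectation (\<lambda>\<omega>. of_bool (real t + 1 < g (x 0 \<omega>)))"
        by (rule same[of "\<lambda>z. of_bool (real t + 1 < g z)"]) measurable
      finally show ?thesis .
    qed
    have vt: "expectation (v t) / (real t + 1)\<^sup>2
        = expectation (\<lambda>\<omega>. (if g (x 0 \<omega>) \<le> real t + 1 then g (x 0 \<omega>) else 0)\<^sup>2 / (real t + 1)\<^sup>2)" for t
      unfolding v_def using same[of "\<lambda>z. (if g z \<le> real t + 1 then g z else 0)\<^sup>2" t] by simp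
    have "summable P"
    proof (rule summableI_nonneg_bounded)
      have int': "integrable M (\<lambda>\<omega>. of_bool (real t + 1 < g (x 0 \<omega>)) :: real)" for t
        by (rule integrable_const_bound[where B = 1]) auto
      fix n
      have "(\<Sum>t<n. P t) = expectation (\<lambda>\<omega>. \<Sum>t<n. of_bool (real t + 1 < g (x 0 \<omega>)))"
        unfolding Pt by (rule Bochner_Integration.integral_sum[symmetric, OF int'])
      also have "\<dots> \<le> expectation (\<lambda>\<omega>. g (x 0 \<omega>))"
        by (intro integral_mono Bochner_Integration.integrable_sum int' int sum_exceedances_le g0)
      finally show "(\<Sum>t<n. P t) \<le> expectation (\<lambda>\<omega>. g (x 0 \<omega>))" .
    qed (simp add: P_def)
    moreover have "summable (\<lambda>t. expectation (v t) / (real t + 1)\<^sup>2)"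
    proof (rule summableI_nonneg_bounded)
      have int': "integrable M (\<lambda>\<omega>. (if g (x 0 \<omega>) \<le> real t + 1 then g (x 0 \<omega>) else 0)\<^sup>2 / (real t + 1)\<^sup>2)" for t
        by (rule integrable_const_bound[where B = 1])
          (use g0 in \<open>auto simp: divide_le_eq intro!: power_mono\<close>)
      fix n
      have "(\<Sum>t<n. expectation (v t) / (real t + 1)\<^sup>2)
          = expectation (\<lambda>\<omega>. \<Sum>t<n. (if g (x 0 \<omega>) \<le> real t + 1 then g (x 0 \<omega>) else 0)\<^sup>2 / (real t + 1)\<^sup>2)"
        unfolding vt by (rule Bochner_Integration.integral_sum[symmetric, OF int'])
      also have "\<dots> \<le> expectation (\<lambda>\<omega>. 2 * g (x 0 \<omega>))"
        using truncated_square_sum_le[OF g0] int[of 0]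
        by (intro integral_mono Bochner_Integration.integrable_sum int') auto
      finally show "(\<Sum>t<n. expectation (v t) / (real t + 1)\<^sup>2) \<le> expectation (\<lambda>\<omega>. 2 * g (x 0 \<omega>))" .
    qed (simp add: v_def)
    ultimately show ?thesis ..
  next
    fix C assume C: "\<And>t. integrable M (\<lambda>\<omega>. x t \<omega> ^ 4)" "\<And>t. expectation (\<lambda>\<omega>. x t \<omega> ^ 4) \<le> C"
    have g4: "(g z)\<^sup>2 \<le> z ^ 4" for z using power_mono[OF g2 g0, of z 2] by (simp flip: power_mult)
    have int2: "integrable M (\<lambda>\<omega>. (g (x t \<omega>))\<^sup>2)" for t
      by (rule Bochner_Integration.integrable_bound[OF C(1)[of t]]) (use g4 in auto)
    have E2: "expectation (\<lambda>\<omega>. (g (x t \<omega>))\<^sup>2) \<le> C" for t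
      using integral_mono[OF int2 C(1) g4] C(2)[of t] by (rule order.trans)
    have sC: "summable (\<lambda>t. C / (real t + 1)\<^sup>2)"
    proof -
      have "summable (\<lambda>t. C * (1 / real (Suc t) ^ 2))"
        using inverse_power_summable[of 2, where 'a = real]
        by (intro summable_mult, subst summable_Suc_iff) (simp add: inverse_eq_divide)
      thus ?thesis by (simp add: add_ac)
    qed
    have "P t \<le> C / (real t + 1)\<^sup>2" for t
    proof -
      have "P t \<le> prob {\<omega> \<in> space M. (real t + 1)\<^sup>2 \<le> (g (x t \<omega>))\<^sup>2}"
        unfolding P_def by (intro finite_measure_mono) (auto intro!: power_mono)
      also have "\<dots> \<le> expectation (\<lambda>\<omega>. (g (x t \<omega>))\<^sup>2) / (real t + 1)\<^sup>2"
        by (rule integral_Markov_inequality_measure[where A = "space M"]) (use int2 in auto)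
      also have "\<dots> \<le> C / (real t + 1)\<^sup>2" by (intro divide_right_mono E2) auto
      finally show ?thesis .
    qed
    hence "summable P"
      by (intro summable_comparison_test_ev[OF always_eventually sC]) (simp add: P_def)
    moreover have "expectation (v t) \<le> C" for t
    proof -
      have vg: "v t \<omega> \<le> (g (x t \<omega>))\<^sup>2" for \<omega> by (simp add: v_def)
      have "v t \<in> borel_measurable M" unfolding v_def by measurable
      hence "integrable M (v t)"
        by (rule Bochner_Integration.integrable_bound[OF int2[of t]]) (simp add: v_def)
      thus ?thesis using integral_mono[OF _ int2 vg] E2[of t] by (meson order.trans)
    qed
    hence "summable (\<lambda>t. expectation (v t) / (real t + 1)\<^sup>2)"
      by (intro summable_comparison_test_ev[OF always_eventually sC])
        (auto simp: v_def intro!: divide_right_mono)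
    ultimately show ?thesis ..
  qed
  moreover have "indep_vars (\<lambda>_. borel) (\<lambda>t \<omega>. g (x t \<omega>)) UNIV"
    by (rule indep_vars_compose2[OF input_sequence_facts(1)[OF x]]) measurable
  ultimately show ?thesis
    by (intro slln_upper_bound g0 int mean \<epsilon>) (simp_all add: P_def[abs_def] v_def[abs_def])
qed

end

context prob_space
begin

text \<open>Dominated convergence for one variable settles identical distributions. With fourth
  moments, the square is at most the fourth power divided by \<open>K\<close> where the variable
  exceeds \<open>K \<ge> 1\<close>.\<close>

lemma input_sequence_uniformly_integrable:
  assumes x: "input_sequence M x" and \<epsilon>: "\<epsilon> > 0"
  shows "\<exists>K\<ge>1. \<forall>t. expectation (\<lambda>\<omega>. if \<bar>x t \<omega>\<bar> > K then (x t \<omega>)\<^sup>2 else 0) \<le> \<epsilon>"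
proof -
  note [measurable] = input_sequence_facts(2)[OF x]
  show ?thesis
  proof (rule input_sequence_cases[OF x])
    assume id: "\<And>s t. distr M borel (x s) = distr M borel (x t)"
    have "(\<lambda>k. expectation (\<lambda>\<omega>. if \<bar>x 0 \<omega>\<bar> > real k then (x 0 \<omega>)\<^sup>2 else 0)) \<longlonglongrightarrow> expectation (\<lambda>\<omega>. 0)"
    proof (rule integral_dominated_convergence[where w = "\<lambda>\<omega>. (x 0 \<omega>)\<^sup>2"])
      show "AE \<omega> in M. (\<lambda>k. if \<bar>x 0 \<omega>\<bar> > real k then (x 0 \<omega>)\<^sup>2 else 0) \<longlonglongrightarrow> 0"
      proof (rule AE_I2, rule tendsto_eventually)
        fix \<omega>
        show "eventually (\<lambda>k. (if \<bar>x 0 \<omega>\<bar> > real k then (x 0 \<omega>)\<^sup>2 else 0) = 0) sequentially"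
        proof (rule eventually_sequentiallyI[of "nat \<lceil>\<bar>x 0 \<omega>\<bar>\<rceil>"])
          fix k assume "nat \<lceil>\<bar>x 0 \<omega>\<bar>\<rceil> \<le> k"
          hence "\<bar>x 0 \<omega>\<bar> \<le> real k" by linarith
          thus "(if \<bar>x 0 \<omega>\<bar> > real k then (x 0 \<omega>)\<^sup>2 else 0) = 0" by simp
        qed
      qed
    qed (auto simp: input_sequence_facts(4)[OF x])
    hence "eventually (\<lambda>k. expectation (\<lambda>\<omega>. if \<bar>x 0 \<omega>\<bar> > real k then (x 0 \<omega>)\<^sup>2 else 0) < \<epsilon>) sequentially"
      using \<epsilon> by (intro order_tendstoD(2)) auto
    hence "eventually (\<lambda>k. k \<ge> 1 \<and> expectation (\<lambda>\<omega>. if \<bar>x 0 \<omega>\<bar> > real k then (x 0 \<omega>)\<^sup>2 else 0) < \<epsilon>) sequentially"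
      by (intro eventually_conj eventually_ge_at_top)
    then obtain k where k: "k \<ge> 1" "expectation (\<lambda>\<omega>. if \<bar>x 0 \<omega>\<bar> > real k then (x 0 \<omega>)\<^sup>2 else 0) < \<epsilon>"
      using eventually_happens by fastforce
    define h :: "real \<Rightarrow> real" where "h z = (if \<bar>z\<bar> > real k then z\<^sup>2 else 0)" for z
    have [measurable]: "h \<in> borel_measurable borel" unfolding h_def by measurable
    have E: "expectation (\<lambda>\<omega>. h (x t \<omega>)) = expectation (\<lambda>\<omega>. h (x 0 \<omega>))" for t
      using integral_distr[of "x t" M borel h] integral_distr[of "x 0" M borel h] id[of t 0] by simp
    have "expectation (\<lambda>\<omega>. h (x 0 \<omega>)) < \<epsilon>" using k(2) by (simp add: h_def)
    hence "\<forall>t. expectation (\<lambda>\<omega>. h (x t \<omega>)) \<le> \<epsilon>" by (metis E less_imp_le)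
    thus ?thesis using k(1) unfolding h_def by (intro exI[of _ "real k"]) simp
  next
    fix C assume C: "\<And>t. integrable M (\<lambda>\<omega>. x t \<omega> ^ 4)" "\<And>t. expectation (\<lambda>\<omega>. x t \<omega> ^ 4) \<le> C"
    have C0: "C \<ge> 0"
    proof -
      have "0 \<le> expectation (\<lambda>\<omega>. x 0 \<omega> ^ 4)" by (rule integral_nonneg_AE) simp
      thus ?thesis using C(2)[of 0] by linarith
    qed
    define K where "K = max 1 (C / \<epsilon>)"
    have K: "K \<ge> 1" "C \<le> \<epsilon> * K" using \<epsilon> by (auto simp: K_def max_def field_simps split: if_splits)
    show ?thesis
    proof (intro exI[of _ K] conjI allI K(1))
      fix t
      have "(if \<bar>x t \<omega>\<bar> > K then (x t \<omega>)\<^sup>2 else 0) \<le> x t \<omega> ^ 4 / K" for \<omega>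
      proof (cases "\<bar>x t \<omega>\<bar> > K")
        case True
        have "K * 1 \<le> \<bar>x t \<omega>\<bar> * \<bar>x t \<omega>\<bar>" using True K(1) by (intro mult_mono) auto
        hence "(x t \<omega>)\<^sup>2 * K \<le> (x t \<omega>)\<^sup>2 * (x t \<omega>)\<^sup>2"
          by (intro mult_left_mono) (auto simp: power2_eq_square)
        moreover have "(x t \<omega>)\<^sup>2 * (x t \<omega>)\<^sup>2 = x t \<omega> ^ 4" by (simp flip: power_add)
        ultimately have "(x t \<omega>)\<^sup>2 * K \<le> x t \<omega> ^ 4" by simp
        thus ?thesis using True K(1) by (simp add: le_divide_eq)
      qed (use K(1) in simp)
      moreover have "integrable M (\<lambda>\<omega>. if \<bar>x t \<omega>\<bar> > K then (x t \<omega>)\<^sup>2 else 0)"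
        by (rule Bochner_Integration.integrable_bound[OF input_sequence_facts(4)[OF x, of t]]) auto
      ultimately have "expectation (\<lambda>\<omega>. if \<bar>x t \<omega>\<bar> > K then (x t \<omega>)\<^sup>2 else 0)
          \<le> expectation (\<lambda>\<omega>. x t \<omega> ^ 4 / K)"
        using C(1)[of t] by (intro integral_mono) auto
      also have "\<dots> = expectation (\<lambda>\<omega>. x t \<omega> ^ 4) / K" by simp
      also have "\<dots> \<le> \<epsilon>"
        using C(2)[of t] K by (simp add: divide_le_eq)
      finally show "expectation (\<lambda>\<omega>. if \<bar>x t \<omega>\<bar> > K then (x t \<omega>)\<^sup>2 else 0) \<le> \<epsilon>" .
    qed
  qed
qed

text \<open>Cutting at level \<open>K\<close> disturbs mean and variance, so the result is centred
  and rescaled, since tree walks need variance exactly 1. Mean and variance may vary with the index,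
  hence so does \<open>\<phi>\<close>.\<close>

lemma input_sequence_truncation:
  assumes x: "input_sequence M x" and \<epsilon>: "\<epsilon> > 0" "\<epsilon> \<le> 1 / 4"
  shows "\<exists>\<phi> B. (\<forall>t. \<phi> t \<in> borel_measurable borel) \<and>
    standardized_bounded M (\<lambda>t \<omega>. \<phi> t (x t \<omega>)) B \<and>
    (AE \<omega> in M. eventually (\<lambda>n. (\<Sum>t<n. (x t \<omega> - \<phi> t (x t \<omega>))\<^sup>2) \<le> 30 * \<epsilon> * real n) sequentially)"
proof -
  note [measurable] = input_sequence_facts(2)[OF x]
  obtain K where K: "K \<ge> 1" and UI: "\<forall>t. expectation (\<lambda>\<omega>. if \<bar>x t \<omega>\<bar> > K then (x t \<omega>)\<^sup>2 else 0) \<le> \<epsilon>"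
    using input_sequence_uniformly_integrable[OF x \<epsilon>(1)] by blast
  define h where "h z = (if \<bar>z\<bar> \<le> K then z else 0)" for z :: real
  define g where "g z = (if \<bar>z\<bar> > K then z\<^sup>2 else 0)" for z :: real
  have [measurable]: "h \<in> borel_measurable borel" "g \<in> borel_measurable borel"
    unfolding h_def g_def by measurable
  have g: "0 \<le> g z" "g z \<le> z\<^sup>2" for z by (auto simp: g_def)
  have hz: "\<bar>h z\<bar> \<le> K" for z using K by (auto simp: h_def)
  have hg: "(h z)\<^sup>2 = z\<^sup>2 - g z" for z by (auto simp: h_def g_def)
  have gh: "(z - h z)\<^sup>2 = g z" for z by (auto simp: h_def g_def)
  \<comment> \<open>Where \<open>h\<close> cuts, \<open>\<bar>z\<bar> > K \<ge> 1\<close> and so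
    \<open>\<bar>z\<bar> \<le> z\<^sup>2\<close>; the shift of the mean is thus controlled by the
    truncated second moment.\<close>
  have lin: "\<bar>h z - z\<bar> \<le> g z" for z
    using K self_le_power[of "\<bar>z\<bar>" 2] by (auto simp: h_def g_def)
  have Eg: "expectation (\<lambda>\<omega>. g (x t \<omega>)) \<le> \<epsilon>" for t using UI by (simp add: g_def)
  have intg: "integrable M (\<lambda>\<omega>. g (x t \<omega>))" for t
    by (rule Bochner_Integration.integrable_bound[OF input_sequence_facts(4)[OF x, of t]]) (use g in auto)
  have inth: "integrable M (\<lambda>\<omega>. h (x t \<omega>))" for t
    by (rule integrable_const_bound[where B = K]) (use hz in auto)
  define m where "m t = expectation (\<lambda>\<omega>. h (x t \<omega>))" for t
  define s where "s t = sqrt (expectation (\<lambda>\<omega>. (h (x t \<omega>))\<^sup>2) - (m t)\<^sup>2)" for t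
  have m: "\<bar>m t\<bar> \<le> \<epsilon>" for t
  proof -
    have "m t = expectation (\<lambda>\<omega>. h (x t \<omega>) - x t \<omega>)"
      unfolding m_def using inth input_sequence_facts(3,5)[OF x]
      by (subst Bochner_Integration.integral_diff) auto
    hence "\<bar>m t\<bar> \<le> expectation (\<lambda>\<omega>. \<bar>h (x t \<omega>) - x t \<omega>\<bar>)"
      using integral_abs_bound by metis
    also have "\<dots> \<le> expectation (\<lambda>\<omega>. g (x t \<omega>))"
      using inth input_sequence_facts(3)[OF x] intg lin by (intro integral_mono) auto
    finally show ?thesis using Eg[of t] by linarith
  qed
  have m2: "(m t)\<^sup>2 \<le> \<epsilon> / 4" for t
  proof -
    have "(m t)\<^sup>2 = \<bar>m t\<bar> * \<bar>m t\<bar>" by (simp add: power2_eq_square)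
    also have "\<dots> \<le> \<epsilon> * (1 / 4)" using m[of t] \<epsilon> by (intro mult_mono) auto
    finally show ?thesis by simp
  qed
  have Eh: "1 - \<epsilon> \<le> expectation (\<lambda>\<omega>. (h (x t \<omega>))\<^sup>2)" "expectation (\<lambda>\<omega>. (h (x t \<omega>))\<^sup>2) \<le> 1" for t
  proof -
    have "expectation (\<lambda>\<omega>. (h (x t \<omega>))\<^sup>2) = 1 - expectation (\<lambda>\<omega>. g (x t \<omega>))"
      unfolding hg using intg input_sequence_facts(4,6)[OF x]
      by (subst Bochner_Integration.integral_diff) auto
    moreover have "0 \<le> expectation (\<lambda>\<omega>. g (x t \<omega>))" using g by (intro integral_nonneg_AE) auto
    ultimately show "1 - \<epsilon> \<le> expectation (\<lambda>\<omega>. (h (x t \<omega>))\<^sup>2)" "expectation (\<lambda>\<omega>. (h (x t \<omega>))\<^sup>2) \<le> 1"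
      using Eg[of t] by linarith+
  qed
  have v: "1 - 5 / 4 * \<epsilon> \<le> expectation (\<lambda>\<omega>. (h (x t \<omega>))\<^sup>2) - (m t)\<^sup>2"
    "expectation (\<lambda>\<omega>. (h (x t \<omega>))\<^sup>2) - (m t)\<^sup>2 \<le> 1" for t
    using Eh[of t] m2[of t] zero_le_power2[of "m t"] by linarith+
  have s2: "(s t)\<^sup>2 = expectation (\<lambda>\<omega>. (h (x t \<omega>))\<^sup>2) - (m t)\<^sup>2" for t
    unfolding s_def using v(1)[of t] \<epsilon> by (intro real_sqrt_pow2) linarith
  \<comment> \<open>For \<open>\<epsilon> \<le> 1 / 4\<close> the variance after truncation is at
    least 11/16, so rescaling is harmless.\<close>
  have s_half: "1 / 2 \<le> (s t)\<^sup>2" for t using v(1)[of t] \<epsilon> unfolding s2 by linarith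
  have s0: "0 \<le> s t" for t unfolding s_def using v(1)[of t] \<epsilon> by (intro real_sqrt_ge_zero) linarith
  have s1: "s t \<le> 1" for t unfolding s_def using v(2)[of t] real_sqrt_le_1_iff by blast
  have s_ge: "1 / 2 \<le> s t" for t
  proof -
    have "(s t)\<^sup>2 \<le> s t" using s0[of t] s1[of t] by (simp add: power2_eq_square mult_left_le)
    thus ?thesis using s_half[of t] by linarith
  qed
  define \<phi> where "\<phi> t z = (h z - m t) / s t" for t z
  show ?thesis
  proof (intro exI[of _ \<phi>] exI[of _ "2 * (K + 1)"] conjI allI)
    show "\<phi> t \<in> borel_measurable borel" for t unfolding \<phi>_def by measurable
    show "standardized_bounded M (\<lambda>t \<omega>. \<phi> t (x t \<omega>)) (2 * (K + 1))"
      unfolding standardized_bounded_def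
    proof (intro conjI allI)
      show "indep_vars (\<lambda>_. borel) (\<lambda>t \<omega>. \<phi> t (x t \<omega>)) UNIV"
        by (rule indep_vars_compose2[OF input_sequence_facts(1)[OF x]]) (unfold \<phi>_def, measurable)
      fix t
      show "\<bar>\<phi> t (x t \<omega>)\<bar> \<le> 2 * (K + 1)" for \<omega>
      proof -
        have "\<bar>h (x t \<omega>) - m t\<bar> \<le> K + 1" using hz[of "x t \<omega>"] m[of t] \<epsilon> by linarith
        also have "\<dots> \<le> 2 * (K + 1) * s t"
        proof -
          have "K + 1 = 2 * (K + 1) * (1 / 2)" by simp
          also have "\<dots> \<le> 2 * (K + 1) * s t"
            using s_ge[of t] K by (intro mult_left_mono) auto
          finally show ?thesis .
        qed
        finally show ?thesis using s_ge[of t] by (simp add: \<phi>_def abs_divide divide_le_eq)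
      qed
      show "expectation (\<lambda>\<omega>. \<phi> t (x t \<omega>)) = 0"
      proof -
        have "expectation (\<lambda>\<omega>. \<phi> t (x t \<omega>)) = expectation (\<lambda>\<omega>. h (x t \<omega>) - m t) / s t"
          unfolding \<phi>_def by (rule integral_divide_zero)
        also have "expectation (\<lambda>\<omega>. h (x t \<omega>) - m t) = 0"
          using inth by (subst Bochner_Integration.integral_diff) (auto simp: m_def prob_space)
        finally show ?thesis by simp
      qed
      show "expectation (\<lambda>\<omega>. (\<phi> t (x t \<omega>))\<^sup>2) = 1"
      proof -
        have "integrable M (\<lambda>\<omega>. (h (x t \<omega>))\<^sup>2)"
          unfolding hg using intg input_sequence_facts(4)[OF x] by auto
        hence "expectation (\<lambda>\<omega>. (h (x t \<omega>) - m t)\<^sup>2) = (s t)\<^sup>2"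
          unfolding s2 m_def by (rule variance_eq[OF inth])
        moreover have "expectation (\<lambda>\<omega>. (\<phi> t (x t \<omega>))\<^sup>2) = expectation (\<lambda>\<omega>. (h (x t \<omega>) - m t)\<^sup>2) / (s t)\<^sup>2"
          unfolding \<phi>_def power_divide by (rule integral_divide_zero)
        ultimately show ?thesis using s_ge[of t] by simp
      qed
    qed
    \<comment> \<open>The difference has three parts, from truncation, rescaling and centring; the
      factor 3 comes from squaring a sum of three terms.\<close>
    have diff: "(z - \<phi> t z)\<^sup>2 \<le> 3 * g z + 6 * \<epsilon> * z\<^sup>2 + 3 * \<epsilon>" for t z
    proof -
      have st: "s t > 0" using s_ge[of t] by linarith
      have sq3: "(a + b + c)\<^sup>2 \<le> 3 * a\<^sup>2 + 3 * b\<^sup>2 + 3 * c\<^sup>2" for a b c :: real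
      proof -
        have "0 \<le> (a - b)\<^sup>2 + (b - c)\<^sup>2 + (a - c)\<^sup>2" by simp
        thus ?thesis by (simp add: power2_eq_square algebra_simps)
      qed
      have "z - \<phi> t z = (z - h z) + h z * (1 - 1 / s t) + m t / s t"
        using st by (simp add: \<phi>_def field_simps)
      hence "(z - \<phi> t z)\<^sup>2 \<le> 3 * (z - h z)\<^sup>2 + 3 * (h z * (1 - 1 / s t))\<^sup>2 + 3 * (m t / s t)\<^sup>2"
        by (simp only: sq3)
      moreover have "(h z * (1 - 1 / s t))\<^sup>2 \<le> z\<^sup>2 * (2 * \<epsilon>)"
      proof -
        have "(1 - s t) \<le> 1 - (s t)\<^sup>2"
          using s0[of t] s1[of t] by (simp add: power2_eq_square mult_left_le)
        hence 1: "1 - s t \<le> 5 / 4 * \<epsilon>" using v(1)[of t] unfolding s2[symmetric] by linarith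
        have "(1 - s t)\<^sup>2 = (1 - s t) * (1 - s t)" by (simp add: power2_eq_square)
        also have "\<dots> \<le> (5 / 4 * \<epsilon>) * (5 / 4 * (1 / 4))" using 1 s1[of t] \<epsilon> by (intro mult_mono) auto
        also have "\<dots> \<le> \<epsilon>" using \<epsilon> by simp
        finally have "(1 - s t)\<^sup>2 \<le> \<epsilon>" .
        also have "\<epsilon> \<le> 2 * \<epsilon> * (s t)\<^sup>2"
          using mult_left_mono[OF s_half[of t], of "2 * \<epsilon>"] \<epsilon> by simp
        finally have "(1 - s t)\<^sup>2 / (s t)\<^sup>2 \<le> 2 * \<epsilon>" using st by (simp add: divide_le_eq)
        moreover have "(1 - 1 / s t)\<^sup>2 = (1 - s t)\<^sup>2 / (s t)\<^sup>2"
          using st by (simp add: field_simps power2_eq_square)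
        ultimately have "(1 - 1 / s t)\<^sup>2 \<le> 2 * \<epsilon>" by simp
        moreover have "(h z)\<^sup>2 \<le> z\<^sup>2" using hg[of z] g(1)[of z] by linarith
        ultimately show ?thesis unfolding power_mult_distrib by (intro mult_mono) auto
      qed
      moreover have "(m t / s t)\<^sup>2 \<le> \<epsilon>"
      proof -
        have "\<epsilon> / 4 \<le> \<epsilon> * (s t)\<^sup>2" using mult_left_mono[OF s_half[of t], of \<epsilon>] \<epsilon> by simp
        hence "(m t)\<^sup>2 \<le> \<epsilon> * (s t)\<^sup>2" using m2[of t] by linarith
        thus ?thesis using st by (simp add: power_divide divide_le_eq)
      qed
      ultimately have "(z - \<phi> t z)\<^sup>2 \<le> 3 * g z + 3 * (z\<^sup>2 * (2 * \<epsilon>)) + 3 * \<epsilon>"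
        unfolding gh by (meson add_mono mult_left_mono order.refl order.trans zero_le_numeral)
      thus ?thesis by (simp add: mult_ac)
    qed
    have "AE \<omega> in M. eventually (\<lambda>n. (\<Sum>t<n. g (x t \<omega>)) \<le> 3 * \<epsilon> * real n) sequentially"
      by (rule input_sequence_slln[OF x _ g Eg \<epsilon>(1)]) measurable
    moreover have "AE \<omega> in M. eventually (\<lambda>n. (\<Sum>t<n. (x t \<omega>)\<^sup>2) \<le> 3 * 1 * real n) sequentially"
      by (rule input_sequence_slln[OF x]) (auto simp: input_sequence_facts(6)[OF x])
    ultimately show "AE \<omega> in M. eventually (\<lambda>n. (\<Sum>t<n. (x t \<omega> - \<phi> t (x t \<omega>))\<^sup>2) \<le> 30 * \<epsilon> * real n) sequentially"
    proof eventually_elim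
      case (elim \<omega>)
      thus ?case
      proof eventually_elim
        case (elim n)
        have "(\<Sum>t<n. (x t \<omega> - \<phi> t (x t \<omega>))\<^sup>2) \<le> (\<Sum>t<n. 3 * g (x t \<omega>) + 6 * \<epsilon> * (x t \<omega>)\<^sup>2 + 3 * \<epsilon>)"
          by (intro sum_mono diff)
        also have "\<dots> = 3 * (\<Sum>t<n. g (x t \<omega>)) + 6 * \<epsilon> * (\<Sum>t<n. (x t \<omega>)\<^sup>2) + 3 * \<epsilon> * real n"
          by (simp add: sum.distrib sum_distrib_left mult.commute)
        \<comment> \<open>The constant is \<open>3 * 3 + 6 * 3 + 3 = 30\<close>, where the inner 3
          is that of the law of large numbers.\<close>
        also have "\<dots> \<le> 3 * (3 * \<epsilon> * real n) + 6 * \<epsilon> * (3 * 1 * real n) + 3 * \<epsilon> * real n"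
          using elim \<epsilon> by (intro add_mono mult_left_mono) auto
        finally show ?case by simp
      qed
    qed
  qed
qed

lemma input_sequence_square_average:
  assumes x: "input_sequence M x"
  shows "AE \<omega> in M. eventually (\<lambda>n. (\<Sum>t<n. (x t \<omega>)\<^sup>2) \<le> 3 * real n) sequentially"
  using input_sequence_slln[OF x, of "\<lambda>z. z\<^sup>2" 1] by (simp add: input_sequence_facts(6)[OF x])

lemma standardized_bounded_mono:
  "standardized_bounded M X B \<Longrightarrow> B \<le> B' \<Longrightarrow> standardized_bounded M X B'"
  unfolding standardized_bounded_def by (meson order.trans)

text \<open>The truncations act coordinate by coordinate, so they preserve the independence of the
  two sequences.\<close>

lemma bounded_array_approximation:
  assumes x: "input_sequence M x" and y: "input_sequence M y" and xy: "indep_sequences M x y"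
    and \<epsilon>: "\<epsilon> > 0" "\<epsilon> \<le> 1 / 4"
  shows "\<exists>X Y B. bounded_array M X Y B \<and>
    (AE \<omega> in M. eventually (\<lambda>n. (\<Sum>t<n. (x t \<omega> - X t \<omega>)\<^sup>2) \<le> 30 * \<epsilon> * real n) sequentially) \<and>
    (AE \<omega> in M. eventually (\<lambda>n. (\<Sum>t<n. (y t \<omega> - Y t \<omega>)\<^sup>2) \<le> 30 * \<epsilon> * real n) sequentially)"
proof -
  obtain \<phi> B1 where \<phi>: "\<forall>t. \<phi> t \<in> borel_measurable borel"
    "standardized_bounded M (\<lambda>t \<omega>. \<phi> t (x t \<omega>)) B1"
    "AE \<omega> in M. eventually (\<lambda>n. (\<Sum>t<n. (x t \<omega> - \<phi> t (x t \<omega>))\<^sup>2) \<le> 30 * \<epsilon> * real n) sequentially"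
    using input_sequence_truncation[OF x \<epsilon>] by blast
  obtain \<psi> B2 where \<psi>: "\<forall>t. \<psi> t \<in> borel_measurable borel"
    "standardized_bounded M (\<lambda>t \<omega>. \<psi> t (y t \<omega>)) B2"
    "AE \<omega> in M. eventually (\<lambda>n. (\<Sum>t<n. (y t \<omega> - \<psi> t (y t \<omega>))\<^sup>2) \<le> 30 * \<epsilon> * real n) sequentially"
    using input_sequence_truncation[OF y \<epsilon>] by blast
  have meas: "(\<lambda>z t. f t (z t)) \<in> PiM UNIV (\<lambda>_. borel) \<rightarrow>\<^sub>M PiM UNIV (\<lambda>_. borel)"
    if "\<forall>t. f t \<in> borel_measurable borel" for f :: "nat \<Rightarrow> real \<Rightarrow> real"
  proof (rule measurable_PiM_single')
    show "(\<lambda>z. f t (z t)) \<in> borel_measurable (PiM UNIV (\<lambda>_. borel))" for t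
      by (rule measurable_compose[OF measurable_component_singleton]) (use that in simp_all)
  qed auto
  have "indep_sequences M (\<lambda>t \<omega>. \<phi> t (x t \<omega>)) (\<lambda>t \<omega>. \<psi> t (y t \<omega>))"
    using indep_var_compose[OF xy[unfolded indep_sequences_def] meas[OF \<phi>(1)] meas[OF \<psi>(1)]]
    by (simp add: indep_sequences_def comp_def)
  hence "bounded_array M (\<lambda>t \<omega>. \<phi> t (x t \<omega>)) (\<lambda>t \<omega>. \<psi> t (y t \<omega>)) (max B1 B2)"
    using \<phi>(2) \<psi>(2) standardized_bounded_mono
    by (intro bounded_array.intro bounded_array_axioms.intro prob_space_axioms) auto
  thus ?thesis using \<phi>(3) \<psi>(3) by blast
qed

end

subsection \<open>The limiting spectral distribution\<close>

lemma toeplitz_index_less: "a < n \<Longrightarrow> b < n \<Longrightarrow> toeplitz_index (a, b) < n"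
  by (auto simp: toeplitz_index_def)

lemma hankel_index_less: "a < n \<Longrightarrow> b < n \<Longrightarrow> hankel_index (a, b) < 2 * n + 1"
  by (auto simp: hankel_index_def)

text \<open>The pair of indices determines the unordered pair \<open>{a, b}\<close>.\<close>
lemma sum_toeplitz_hankel_le:
  fixes u v :: "nat \<Rightarrow> real"
  assumes "\<And>t. u t \<ge> 0" "\<And>t. v t \<ge> 0"
  shows "(\<Sum>a<n. \<Sum>b<n. u (toeplitz_index (a, b)) * v (hankel_index (a, b)))
    \<le> 2 * ((\<Sum>t<n. u t) * (\<Sum>t<2 * n + 1. v t))"
proof -
  let ?P = "{..<n} \<times> {..<n}" and ?Q = "{..<n} \<times> {..<2 * n + 1}"
  let ?i = "\<lambda>z. (toeplitz_index z, hankel_index z)"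
  have part: "(\<Sum>z\<in>R. u (toeplitz_index z) * v (hankel_index z)) \<le> (\<Sum>t<n. u t) * (\<Sum>t<2 * n + 1. v t)"
    if "R \<subseteq> ?P" "inj_on ?i R" for R
  proof -
    have "(\<Sum>z\<in>R. u (toeplitz_index z) * v (hankel_index z)) = (\<Sum>(s, t)\<in>?i ` R. u s * v t)"
      by (subst sum.reindex[OF that(2)]) simp
    also have "\<dots> \<le> (\<Sum>(s, t)\<in>?Q. u s * v t)"
    proof (rule sum_mono2)
      show "?i ` R \<subseteq> ?Q"
      proof (rule image_subsetI)
        fix z assume "z \<in> R"
        hence z: "fst z < n" "snd z < n" using that(1) by auto
        show "?i z \<in> ?Q"
          using toeplitz_index_less[OF z] hankel_index_less[OF z] by simp
      qed
    qed (use assms in auto)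
    also have "\<dots> = (\<Sum>t<n. u t) * (\<Sum>t<2 * n + 1. v t)"
      by (simp only: sum_product sum.cartesian_product)
    finally show ?thesis .
  qed
  have "(\<Sum>a<n. \<Sum>b<n. u (toeplitz_index (a, b)) * v (hankel_index (a, b)))
      = (\<Sum>z\<in>?P. u (toeplitz_index z) * v (hankel_index z))"
    by (subst sum.cartesian_product) (simp add: case_prod_beta)
  also have "\<dots> = (\<Sum>z\<in>{z \<in> ?P. fst z \<le> snd z}. u (toeplitz_index z) * v (hankel_index z))
      + (\<Sum>z\<in>{z \<in> ?P. \<not> fst z \<le> snd z}. u (toeplitz_index z) * v (hankel_index z))"
  proof (subst sum.union_disjoint[symmetric])
    show "(\<Sum>z\<in>?P. u (toeplitz_index z) * v (hankel_index z)) =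
        (\<Sum>z\<in>{z \<in> ?P. fst z \<le> snd z} \<union> {z \<in> ?P. \<not> fst z \<le> snd z}. u (toeplitz_index z) * v (hankel_index z))"
      by (rule sum.cong) blast+
  qed (blast | simp)+
  also have "\<dots> \<le> (\<Sum>t<n. u t) * (\<Sum>t<2 * n + 1. v t) + (\<Sum>t<n. u t) * (\<Sum>t<2 * n + 1. v t)"
  proof (intro add_mono part)
    have less: "toeplitz_index z = snd z - fst z" if "fst z \<le> snd z" for z
      using that by (cases z) (simp add: toeplitz_index_def)
    have greater: "toeplitz_index z = fst z - snd z" if "\<not> fst z \<le> snd z" for z
      using that by (cases z) (simp add: toeplitz_index_def)
    have hank: "hankel_index z = fst z + snd z + 2" for z
      by (cases z) (simp add: hankel_index_def)
    show "inj_on ?i {z \<in> ?P. fst z \<le> snd z}"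
    proof (rule inj_onI)
      fix z w assume "z \<in> {z \<in> ?P. fst z \<le> snd z}" "w \<in> {z \<in> ?P. fst z \<le> snd z}" "?i z = ?i w"
      hence "fst z \<le> snd z" "fst w \<le> snd w" "snd z - fst z = snd w - fst w"
        "fst z + snd z = fst w + snd w" using less[of z] less[of w] hank[of z] hank[of w] by simp_all
      thus "z = w" by (intro prod_eqI) linarith+
    qed
    show "inj_on ?i {z \<in> ?P. \<not> fst z \<le> snd z}"
    proof (rule inj_onI)
      fix z w assume "z \<in> {z \<in> ?P. \<not> fst z \<le> snd z}" "w \<in> {z \<in> ?P. \<not> fst z \<le> snd z}" "?i z = ?i w"
      hence "\<not> fst z \<le> snd z" "\<not> fst w \<le> snd w" "fst z - snd z = fst w - snd w"
        "fst z + snd z = fst w + snd w" using greater[of z] greater[of w] hank[of z] hank[of w] by simp_all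
      thus "z = w" by (intro prod_eqI) linarith+
    qed
  qed blast+
  finally show ?thesis by simp
qed

lemma walk_vertices_subset:
  assumes "vs \<noteq> []" "\<And>a b. (a, b) \<in> set (walk_edges p vs) \<Longrightarrow> a \<in> S \<and> b \<in> S"
  shows "set (p # vs) \<subseteq> S"
  using assms
proof (induction vs arbitrary: p)
  case (Cons v vs)
  have "p \<in> S" "v \<in> S" using Cons.prems(2)[of p v] by auto
  moreover have "set (v # vs) \<subseteq> S" if "vs \<noteq> []" using Cons.IH[of v] Cons.prems(2) that by auto
  ultimately show ?case by (cases "vs = []") auto
qed simp

text \<open>A walk that leaves the corner contains an edge of weight 0. This needs at least one
  edge: for \<open>h = 0\<close> all \<open>n\<close> vertices count.\<close>

lemma trace_power_corner:
  assumes "m \<le> n" "h > 0"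
    and A: "\<And>a b. A a b = (if a < m \<and> b < m then W (a, b) / r else 0)"
  shows "(\<Sum>a<n. mat_power_entry n A h a a) = (\<Sum>vs\<in>closed_walks m h. walk_weight W vs) / r ^ h"
proof -
  have sub: "closed_walks m h \<subseteq> closed_walks n h"
    using assms(1) by (auto simp: closed_walks_def lists_below_def)
  have zero: "walk_weight (case_prod A) vs = 0" if vs: "vs \<in> closed_walks n h - closed_walks m h" for vs
  proof -
    obtain v vs' where v: "vs = v # vs'" "vs' \<noteq> []"
      using vs assms(2) by (cases vs) (auto simp: closed_walks_def lists_below_def)
    have "\<not> set vs \<subseteq> {..<m}" using vs by (auto simp: closed_walks_def lists_below_def)
    then obtain a b where ab: "(a, b) \<in> set (walk_edges v vs')" "\<not> (a < m \<and> b < m)"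
      using walk_vertices_subset[of vs' v "{..<m}"] v by auto
    have "\<exists>e\<in>set (walk_edges v vs'). case_prod A e = 0"
      by (rule bexI[OF _ ab(1)], simp only: prod.case, subst A) (use ab(2) in auto)
    thus ?thesis by (auto simp: walk_weight_def v prod_list_zero_iff image_iff)
  qed
  have nonzero: "walk_weight (case_prod A) vs = walk_weight W vs / r ^ h" if vs: "vs \<in> closed_walks m h" for vs
  proof -
    obtain v vs' where v: "vs = v # vs'" "length vs' = h" "set vs \<subseteq> {..<m}"
      using vs by (cases vs) (auto simp: closed_walks_def lists_below_def)
    have "case_prod A e = W e * (1 / r)" if "e \<in> set (walk_edges v vs')" for e
    proof -
      obtain a b where e: "e = (a, b)" by (cases e)
      have "a < m \<and> b < m" using walk_edges_subset[of a b v vs'] that v e by auto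
      thus ?thesis by (simp add: e A)
    qed
    hence "walk_weight (case_prod A) vs = prod_list (map (\<lambda>e. W e * (1 / r)) (walk_edges v vs'))"
      unfolding walk_weight_def v(1) list.sel by (intro arg_cong[of _ _ prod_list] map_cong refl)
    also have "\<dots> = walk_weight W vs * (1 / r) ^ h"
      unfolding prod_list_map_mult map_replicate_const by (simp add: walk_weight_def v)
    finally show ?thesis by (simp add: power_one_over)
  qed
  have "(\<Sum>a<n. mat_power_entry n A h a a) = (\<Sum>vs\<in>closed_walks m h. walk_weight (case_prod A) vs)"
    unfolding trace_mat_power_walks by (rule sum.mono_neutral_right[OF _ sub]) (use zero in auto)
  also have "\<dots> = (\<Sum>vs\<in>closed_walks m h. walk_weight W vs / r ^ h)"
    by (intro sum.cong refl nonzero)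
  finally show ?thesis by (simp add: sum_divide_distrib)
qed

section \<open>Corners whose size is a perfect square\<close>

definition int_sqrt :: "nat \<Rightarrow> nat" where
  "int_sqrt n = nat \<lfloor>sqrt (real n)\<rfloor>"

lemma int_sqrt_bounds: "real (int_sqrt n) \<le> sqrt (real n)" "sqrt (real n) < real (int_sqrt n) + 1"
  unfolding int_sqrt_def by (simp_all add: of_nat_nat)

lemma int_sqrt_square_le: "(int_sqrt n)\<^sup>2 \<le> n"
proof -
  have "(real (int_sqrt n))\<^sup>2 \<le> (sqrt (real n))\<^sup>2"
    by (intro power_mono int_sqrt_bounds) auto
  hence "real ((int_sqrt n)\<^sup>2) \<le> real n" by simp
  thus ?thesis by (simp only: of_nat_le_iff)
qed

lemma int_sqrt_square_ge: "real n - real ((int_sqrt n)\<^sup>2) \<le> 2 * sqrt (real n)"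
proof -
  define s where "s = sqrt (real n)"
  have s: "s * s = real n" "s \<ge> 0" by (simp_all add: s_def)
  have "real ((int_sqrt n)\<^sup>2) = real (int_sqrt n) * real (int_sqrt n)" by (simp add: power2_eq_square)
  moreover have "s * s - real (int_sqrt n) * real (int_sqrt n) = (s - real (int_sqrt n)) * (s + real (int_sqrt n))"
    by (simp add: algebra_simps)
  moreover have "\<dots> \<le> 1 * (2 * s)"
    using int_sqrt_bounds[of n] s(2) unfolding s_def[symmetric] by (intro mult_mono) auto
  ultimately show ?thesis using s by (simp add: s_def)
qed

lemma inverse_sqrt_tendsto_0: "(\<lambda>n. c / sqrt (real n)) \<longlonglongrightarrow> 0"
  by (rule real_tendsto_divide_at_top[OF tendsto_const])
    (rule filterlim_compose[OF sqrt_at_top filterlim_real_sequentially])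

lemma int_sqrt_at_top: "filterlim int_sqrt at_top sequentially"
  unfolding filterlim_at_top
proof
  fix Z
  show "eventually (\<lambda>n. Z \<le> int_sqrt n) sequentially"
  proof (rule eventually_sequentiallyI[of "Z\<^sup>2"])
    fix n assume "Z\<^sup>2 \<le> n"
    hence "real (Z\<^sup>2) \<le> real n" by (simp only: of_nat_le_iff)
    hence "sqrt (real (Z\<^sup>2)) \<le> sqrt (real n)" by (rule real_sqrt_le_mono)
    hence "real Z \<le> sqrt (real n)" by simp
    hence "real Z < real (int_sqrt n) + 1" using int_sqrt_bounds(2)[of n] by linarith
    thus "Z \<le> int_sqrt n" by linarith
  qed
qed

lemma int_sqrt_ratio: "(\<lambda>n. real (int_sqrt n) / sqrt (real n)) \<longlonglongrightarrow> 1"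
proof (rule tendsto_sandwich)
  show "eventually (\<lambda>n. 1 - 1 / sqrt (real n) \<le> real (int_sqrt n) / sqrt (real n)) sequentially"
    using eventually_gt_at_top[of 0]
  proof eventually_elim
    case (elim n)
    hence s: "sqrt (real n) > 0" by simp
    have "1 - 1 / sqrt (real n) = (sqrt (real n) - 1) / sqrt (real n)"
      using s by (simp add: diff_divide_distrib)
    also have "\<dots> \<le> real (int_sqrt n) / sqrt (real n)"
      using int_sqrt_bounds(2)[of n] s by (intro divide_right_mono) auto
    finally show ?case .
  qed
  show "eventually (\<lambda>n. real (int_sqrt n) / sqrt (real n) \<le> 1) sequentially"
    using eventually_gt_at_top[of 0]
  proof eventually_elim
    case (elim n)
    thus ?case using int_sqrt_bounds(1)[of n] by (simp add: divide_le_eq)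
  qed
  show "(\<lambda>n. 1 - 1 / sqrt (real n)) \<longlonglongrightarrow> 1"
    using tendsto_diff[OF tendsto_const inverse_sqrt_tendsto_0, of 1 1] by simp
qed simp

text \<open>The approximating matrices are the corners of size \<open>(int_sqrt n)\<^sup>2\<close>, filled up with zeros:
  the moments converge almost surely along the squares only.\<close>
lemma corner_moment_convergence:
  assumes conv: "\<And>h. (\<lambda>j. (\<Sum>vs\<in>closed_walks (j\<^sup>2) h. walk_weight W vs) / real j ^ (h + 2))
      \<longlonglongrightarrow> semicircle_moment h"
    and A: "\<And>n a b. A n a b = (if a < (int_sqrt n)\<^sup>2 \<and> b < (int_sqrt n)\<^sup>2
      then W (a, b) / sqrt (real n) else (0::real))"
  shows "(\<lambda>n. (\<Sum>a<n. mat_power_entry n (A n) h a a) / real n) \<longlonglongrightarrow> semicircle_moment h"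
proof (cases "h = 0")
  case True
  have "semicircle_moment h = 1" by (simp add: True semicircle_moment_def)
  moreover have "eventually (\<lambda>n. (\<Sum>a<n. mat_power_entry n (A n) h a a) / real n = 1) sequentially"
    using eventually_gt_at_top[of 0] by eventually_elim (simp add: True)
  ultimately show ?thesis by (simp only: tendsto_eventually)
next
  case False
  define S where "S j = (\<Sum>vs\<in>closed_walks (j\<^sup>2) h. walk_weight W vs)" for j
  have "(\<lambda>n. S (int_sqrt n) / real (int_sqrt n) ^ (h + 2) * (real (int_sqrt n) / sqrt (real n)) ^ (h + 2))
      \<longlonglongrightarrow> semicircle_moment h * 1 ^ (h + 2)"
    by (intro tendsto_mult tendsto_power int_sqrt_ratio
      filterlim_compose[OF conv[of h, folded S_def] int_sqrt_at_top])
  moreover have "eventually (\<lambda>n. S (int_sqrt n) / real (int_sqrt n) ^ (h + 2) * (real (int_sqrt n) / sqrt (real n)) ^ (h + 2)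
      = (\<Sum>a<n. mat_power_entry n (A n) h a a) / real n) sequentially"
    using eventually_ge_at_top[of 1] int_sqrt_at_top[unfolded filterlim_at_top, rule_format, of 1]
  proof eventually_elim
    case (elim n)
    have "(\<Sum>a<n. mat_power_entry n (A n) h a a) = S (int_sqrt n) / sqrt (real n) ^ h"
      unfolding S_def by (rule trace_power_corner[OF int_sqrt_square_le]) (use False A in auto)
    moreover have "sqrt (real n) ^ (h + 2) = sqrt (real n) ^ h * real n" by (simp add: power_add)
    moreover have "real (int_sqrt n) \<noteq> 0" using elim(2) by simp
    ultimately show ?case by (simp add: power_divide)
  qed
  ultimately show ?thesis by (auto intro: Lim_transform_eventually)
qed

text \<open>Write \<open>x y - X Y = (x - X) y + X (y - Y)\<close>. Summing over the entries turns
  products of squares into products of sums, each of order \<open>n\<close>, with one of them small.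
  The term with \<open>B\<close> comes from the O(sqrt n) rows and columns outside the
  corner.\<close>

lemma schur_product_perturbation:
  fixes x y X Y :: "nat \<Rightarrow> real"
  assumes \<epsilon>: "0 < \<epsilon>" "\<epsilon> \<le> 1 / 4" and B: "\<And>t. \<bar>X t\<bar> \<le> B" "\<And>t. \<bar>Y t\<bar> \<le> B" and n: "n > 0"
    and x2: "(\<Sum>t<n. (x t)\<^sup>2) \<le> 3 * real n" and y2: "(\<Sum>t<2 * n + 1. (y t)\<^sup>2) \<le> 3 * real (2 * n + 1)"
    and xX: "(\<Sum>t<n. (x t - X t)\<^sup>2) \<le> 30 * \<epsilon> * real n"
    and yY: "(\<Sum>t<2 * n + 1. (y t - Y t)\<^sup>2) \<le> 30 * \<epsilon> * real (2 * n + 1)"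
    and A: "\<And>a b. A a b = x (toeplitz_index (a, b)) * y (hankel_index (a, b)) / sqrt (real n)"
    and A': "\<And>a b. A' a b = (if a < (int_sqrt n)\<^sup>2 \<and> b < (int_sqrt n)\<^sup>2
      then X (toeplitz_index (a, b)) * Y (hankel_index (a, b)) / sqrt (real n) else 0)"
  shows "(\<Sum>a<n. \<Sum>b<n. (A a b - A' a b)\<^sup>2) / real n \<le> 17280 * \<epsilon> + 8 * B ^ 4 / sqrt (real n)"
proof -
  define m where "m = (int_sqrt n)\<^sup>2"
  have mn: "m \<le> n" unfolding m_def by (rule int_sqrt_square_le)
  have B0: "B \<ge> 0" using B(1)[of 0] by linarith
  define d where "d a b = 4 * ((x (toeplitz_index (a, b)) - X (toeplitz_index (a, b)))\<^sup>2 * (y (hankel_index (a, b)))\<^sup>2)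
    + 4 * ((X (toeplitz_index (a, b)))\<^sup>2 * (y (hankel_index (a, b)) - Y (hankel_index (a, b)))\<^sup>2)" for a b
  have sq2: "(p + q)\<^sup>2 \<le> 2 * p\<^sup>2 + 2 * q\<^sup>2" for p q :: real
    using sum_squares_bound[of p q] by (simp add: power2_sum)
  have pt: "(A a b - A' a b)\<^sup>2 * real n \<le> d a b + 2 * B ^ 4 * (of_bool (m \<le> a) + of_bool (m \<le> b))" for a b
  proof -
    define s t where "s = toeplitz_index (a, b)" and "t = hankel_index (a, b)"
    have "(A a b - A' a b)\<^sup>2 * real n = (x s * y t - (if a < m \<and> b < m then X s * Y t else 0))\<^sup>2"
      using n by (auto simp: A A' m_def s_def t_def power_divide diff_divide_distrib[symmetric])
    also have "x s * y t - (if a < m \<and> b < m then X s * Y t else 0)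
        = (x s * y t - X s * Y t) + (if a < m \<and> b < m then 0 else X s * Y t)" by simp
    also have "(\<dots>)\<^sup>2 \<le> 2 * (x s * y t - X s * Y t)\<^sup>2 + 2 * (if a < m \<and> b < m then 0 else X s * Y t)\<^sup>2"
      by (rule sq2)
    also have "x s * y t - X s * Y t = (x s - X s) * y t + X s * (y t - Y t)" by (simp add: algebra_simps)
    also have "2 * (\<dots>)\<^sup>2 \<le> 2 * (2 * ((x s - X s) * y t)\<^sup>2 + 2 * (X s * (y t - Y t))\<^sup>2)"
      by (intro mult_left_mono sq2) simp
    also have "\<dots> = d a b" by (simp add: d_def s_def t_def power_mult_distrib)
    also have "2 * (if a < m \<and> b < m then 0 else X s * Y t)\<^sup>2 \<le> 2 * B ^ 4 * (of_bool (m \<le> a) + of_bool (m \<le> b))"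
    proof -
      have "\<bar>X s * Y t\<bar> \<le> B * B" unfolding abs_mult using B B0 by (intro mult_mono) auto
      hence "\<bar>X s * Y t\<bar>\<^sup>2 \<le> (B * B)\<^sup>2" by (intro power_mono) auto
      hence "(X s * Y t)\<^sup>2 \<le> B ^ 4" by (simp add: power_mult_distrib flip: power_add)
      moreover from this have "(X s * Y t)\<^sup>2 \<le> 2 * B ^ 4"
        using zero_le_power2[of "X s * Y t"] by linarith
      ultimately show ?thesis by (auto simp: of_bool_def not_less)
    qed
    finally show ?thesis by simp
  qed
  have X2: "(\<Sum>t<n. (X t)\<^sup>2) \<le> 21 * real n"
  proof -
    have "(\<Sum>t<n. (X t)\<^sup>2) \<le> (\<Sum>t<n. 2 * (x t)\<^sup>2 + 2 * (x t - X t)\<^sup>2)"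
    proof (rule sum_mono)
      fix t
      show "(X t)\<^sup>2 \<le> 2 * (x t)\<^sup>2 + 2 * (x t - X t)\<^sup>2" using sq2[of "x t" "X t - x t"]
        by (simp add: power2_commute)
    qed
    also have "\<dots> = 2 * (\<Sum>t<n. (x t)\<^sup>2) + 2 * (\<Sum>t<n. (x t - X t)\<^sup>2)"
      by (simp add: sum.distrib sum_distrib_left)
    also have "\<dots> \<le> 2 * (3 * real n) + 2 * (30 * \<epsilon> * real n)" by (intro add_mono mult_left_mono x2 xX) auto
    \<comment> \<open>The bound for \<open>x\<close> is carried over to \<open>X\<close>: 6 + 15 =
      21.\<close>
    also have "\<dots> \<le> 2 * (3 * real n) + 2 * (30 * (1 / 4) * real n)"
      using \<epsilon> by (intro add_mono mult_left_mono mult_right_mono) auto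
    finally show ?thesis by simp
  qed
  \<comment> \<open>Hankel indices run up to \<open>2 * n\<close>, hence the sums of
    \<open>2 * n + 1\<close> terms, which is at most \<open>3 * n\<close> for
    \<open>n > 0\<close>.\<close>
  have n9: "3 * real (2 * n + 1) \<le> 9 * real n" using n by simp
  have D: "(\<Sum>a<n. \<Sum>b<n. d a b) \<le> 17280 * \<epsilon> * (real n)\<^sup>2"
  proof -
    let ?s = "\<lambda>u v. (\<Sum>a<n. \<Sum>b<n. u (toeplitz_index (a, b)) * v (hankel_index (a, b)))"
    have "(\<Sum>a<n. \<Sum>b<n. d a b)
        = 4 * ?s (\<lambda>t. (x t - X t)\<^sup>2) (\<lambda>t. (y t)\<^sup>2) + 4 * ?s (\<lambda>t. (X t)\<^sup>2) (\<lambda>t. (y t - Y t)\<^sup>2)"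
      unfolding d_def sum.distrib sum_distrib_left ..
    also have "\<dots> \<le> 4 * (2 * ((\<Sum>t<n. (x t - X t)\<^sup>2) * (\<Sum>t<2 * n + 1. (y t)\<^sup>2)))
        + 4 * (2 * ((\<Sum>t<n. (X t)\<^sup>2) * (\<Sum>t<2 * n + 1. (y t - Y t)\<^sup>2)))"
      by (intro add_mono mult_left_mono sum_toeplitz_hankel_le) auto
    also have "\<dots> \<le> 4 * (2 * ((30 * \<epsilon> * real n) * (9 * real n)))
        + 4 * (2 * ((21 * real n) * (30 * \<epsilon> * (3 * real n))))"
    proof (intro add_mono mult_left_mono mult_mono xX X2)
      show "(\<Sum>t<2 * n + 1. (y t)\<^sup>2) \<le> 9 * real n" using y2 n9 by linarith
      have "30 * \<epsilon> * real (2 * n + 1) \<le> 30 * \<epsilon> * (3 * real n)" using n9 \<epsilon> by (intro mult_left_mono) auto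
      thus "(\<Sum>t<2 * n + 1. (y t - Y t)\<^sup>2) \<le> 30 * \<epsilon> * (3 * real n)" using yY by linarith
    qed (use \<epsilon> in \<open>auto simp del: sum.lessThan_Suc intro!: sum_nonneg\<close>)
    \<comment> \<open>\<open>8 * 30 * 9 + 8 * 21 * 90 = 17280\<close>.\<close>
    also have "\<dots> = 17280 * \<epsilon> * (real n)\<^sup>2" by (simp add: power2_eq_square)
    finally show ?thesis .
  qed
  have out: "(\<Sum>a<n. \<Sum>b<n. of_bool (m \<le> a) + of_bool (m \<le> b)) = 2 * real n * (real n - real m)"
  proof -
    have "(\<Sum>a<n. of_bool (m \<le> a)) = real (card ({..<n} \<inter> {a. m \<le> a}))"
      by (simp add: of_bool_def sum.If_cases)
    also have "{..<n} \<inter> {a. m \<le> a} = {m..<n}" by auto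
    finally have "(\<Sum>a<n. of_bool (m \<le> a)) = real n - real m" using mn by simp
    thus ?thesis by (simp only: sum.distrib sum_constant card_lessThan sum_distrib_left[symmetric])
  qed
  have "(\<Sum>a<n. \<Sum>b<n. (A a b - A' a b)\<^sup>2) * real n
      = (\<Sum>a<n. \<Sum>b<n. (A a b - A' a b)\<^sup>2 * real n)" by (simp only: sum_distrib_right)
  also have "\<dots> \<le> (\<Sum>a<n. \<Sum>b<n. d a b + 2 * B ^ 4 * (of_bool (m \<le> a) + of_bool (m \<le> b)))"
    by (intro sum_mono pt)
  also have "\<dots> = (\<Sum>a<n. \<Sum>b<n. d a b) + 2 * B ^ 4 * (2 * real n * (real n - real m))"
    unfolding out[symmetric] by (simp only: sum.distrib[of "d _"] sum.distrib[of "\<lambda>a. sum (d a) _"] sum_distrib_left)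
  also have "\<dots> \<le> 17280 * \<epsilon> * (real n)\<^sup>2 + 2 * B ^ 4 * (2 * real n * (2 * sqrt (real n)))"
    using D int_sqrt_square_ge[of n] B0 unfolding m_def[symmetric]
    by (intro add_mono mult_left_mono) auto
  finally have "(\<Sum>a<n. \<Sum>b<n. (A a b - A' a b)\<^sup>2) * real n
      \<le> 17280 * \<epsilon> * (real n)\<^sup>2 + 8 * B ^ 4 * real n * sqrt (real n)" by simp
  also have "\<dots> = (17280 * \<epsilon> + 8 * B ^ 4 / sqrt (real n)) * real n * real n"
  proof -
    have "real n / sqrt (real n) = sqrt (real n)" by (rule real_div_sqrt) simp
    hence "8 * B ^ 4 * real n * sqrt (real n) = 8 * B ^ 4 * real n * (real n / sqrt (real n))"
      by (simp only:)
    also have "\<dots> = 8 * B ^ 4 / sqrt (real n) * real n * real n" by simp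
    finally show ?thesis by (simp only: distrib_right power2_eq_square mult.assoc)
  qed
  finally have "(\<Sum>a<n. \<Sum>b<n. (A a b - A' a b)\<^sup>2) \<le> (17280 * \<epsilon> + 8 * B ^ 4 / sqrt (real n)) * real n"
    using n by simp
  thus ?thesis using n by (simp add: divide_le_eq)
qed

lemma scaled_schur_product:
  "(1 / sqrt (real n)) \<cdot>\<^sub>m schur_product (toeplitz_mat n x) (hankel_mat n y)
    = Matrix.mat n n (\<lambda>(i, j). x (toeplitz_index (i, j)) * y (hankel_index (i, j)) / sqrt (real n))"
  by (rule eq_matI)
    (auto simp: schur_product_def toeplitz_mat_def hankel_mat_def toeplitz_index_def hankel_index_def)

theorem mainTheorem1:
  fixes M :: "'a measure" and x y :: "nat \<Rightarrow> 'a \<Rightarrow> real"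
  assumes "prob_space M"
    and "input_sequence M x"
    and "input_sequence M y"
    and "indep_sequences M x y"
  shows "\<exists>\<mu>. semicircular_law \<mu> \<and>
    has_lsd M
      (\<lambda>n \<omega>. (1 / sqrt (real n)) \<cdot>\<^sub>m
        schur_product (toeplitz_mat n (\<lambda>t. x t \<omega>)) (hankel_mat n (\<lambda>t. y t \<omega>)))
      (cdf \<mu>)"
proof -
  interpret prob_space M by fact
  \<comment> \<open>Countably many accuracies, so that one null set serves all of them; the shift by
    4 ensures \<open>\<epsilon> k \<le> 1 / 4\<close>.\<close>
  define \<epsilon> where "\<epsilon> k = 1 / (real k + 4)" for k :: nat
  have \<epsilon>: "0 < \<epsilon> k" "\<epsilon> k \<le> 1 / 4" for k by (auto simp: \<epsilon>_def field_simps)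
  define near where "near k z Z \<longleftrightarrow>
    (AE \<omega> in M. eventually (\<lambda>n. (\<Sum>t<n. (z t \<omega> - Z t \<omega>)\<^sup>2) \<le> 30 * \<epsilon> k * real n) sequentially)"
    for k and z Z :: "nat \<Rightarrow> 'a \<Rightarrow> real"
  define good where "good k X Y B \<longleftrightarrow> bounded_array M X Y B \<and> near k x X \<and> near k y Y" for k X Y B
  have "\<exists>X Y B. good k X Y B" for k
    unfolding good_def near_def by (rule bounded_array_approximation[OF assms(2-4) \<epsilon>])
  hence "\<forall>k. \<exists>X Y B. good k X Y B" by (rule allI)
  from choice[OF this] obtain X where "\<forall>k. \<exists>Y B. good k (X k) Y B" by (elim exE)
  from choice[OF this] obtain Y where "\<forall>k. \<exists>B. good k (X k) (Y k) B" by (elim exE)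
  from choice[OF this] obtain B where good: "\<forall>k. good k (X k) (Y k) (B k)" by (elim exE)
  have arr: "bounded_array M (X k) (Y k) (B k)" and near: "near k x (X k)" "near k y (Y k)" for k
    using good[rule_format, of k] by (simp_all only: good_def)
  define W where "W k \<omega> e = X k (toeplitz_index e) \<omega> * Y k (hankel_index e) \<omega>" for k \<omega> e
  have moments: "AE \<omega> in M. \<forall>h. (\<lambda>j. (\<Sum>vs\<in>closed_walks (j\<^sup>2) h. walk_weight (W k \<omega>) vs) / real j ^ (h + 2))
      \<longlonglongrightarrow> semicircle_moment h" for k
  proof -
    interpret A: bounded_array M "X k" "Y k" "B k" by (rule arr)
    have "A.entry \<omega> = W k \<omega>" for \<omega> by (rule ext) (simp add: A.entry_def W_def)
    thus ?thesis using A.walk_sum_converges by (simp add: A.walk_sum_def)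
  qed
  have bounds: "\<bar>X k t \<omega>\<bar> \<le> B k" "\<bar>Y k t \<omega>\<bar> \<le> B k" for k t \<omega>
    using bounded_array.X[OF arr[of k]] bounded_array.Y[OF arr[of k]]
    unfolding standardized_bounded_def by blast+
  have all: "AE \<omega> in M. \<forall>k. eventually (\<lambda>n. (\<Sum>t<n. (x t \<omega> - X k t \<omega>)\<^sup>2) \<le> 30 * \<epsilon> k * real n) sequentially"
    "AE \<omega> in M. \<forall>k. eventually (\<lambda>n. (\<Sum>t<n. (y t \<omega> - Y k t \<omega>)\<^sup>2) \<le> 30 * \<epsilon> k * real n) sequentially"
    "AE \<omega> in M. \<forall>k h. (\<lambda>j. (\<Sum>vs\<in>closed_walks (j\<^sup>2) h. walk_weight (W k \<omega>) vs) / real j ^ (h + 2))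
      \<longlonglongrightarrow> semicircle_moment h"
    using near moments unfolding AE_all_countable near_def by (simp_all only: simp_thms)
  have "AE \<omega> in M. \<forall>u. isCont (cdf semicircle_measure) u \<longrightarrow>
    (\<lambda>n. esd ((1 / sqrt (real n)) \<cdot>\<^sub>m
        schur_product (toeplitz_mat n (\<lambda>t. x t \<omega>)) (hankel_mat n (\<lambda>t. y t \<omega>))) u)
      \<longlonglongrightarrow> cdf semicircle_measure u"
    using all input_sequence_square_average[OF assms(2)] input_sequence_square_average[OF assms(3)]
  proof eventually_elim
    case (elim \<omega>)
    define A where "A n a b = x (toeplitz_index (a, b)) \<omega> * y (hankel_index (a, b)) \<omega> / sqrt (real n)"
      for n a b
    show ?case
    proof (intro allI impI)
      fix u assume u: "isCont (cdf semicircle_measure) u"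
      have sym: "toeplitz_index (i, j) = toeplitz_index (j, i)" "hankel_index (i, j) = hankel_index (j, i)" for i j
        by (simp_all add: toeplitz_index_def hankel_index_def abs_minus_commute)
      have "(\<lambda>n. esd (Matrix.mat n n (\<lambda>(i, j). A n i j)) u) \<longlonglongrightarrow> cdf semicircle_measure u"
      proof (rule esd_semicircle_limit[OF _ _ u])
        show "A n i j = A n j i" for n i j unfolding A_def sym[of i j] ..
        fix \<delta> :: real assume \<delta>: "\<delta> > 0"
        \<comment> \<open>34560 is twice 17280, leaving half of \<open>\<delta>\<close> for the part
          outside the corner.\<close>
        obtain k :: nat where k: "34560 / \<delta> \<le> real k" using real_arch_simple by blast
        have k\<delta>: "17280 * \<epsilon> k \<le> \<delta> / 2"
        proof -
          have "34560 \<le> real k * \<delta>" using k \<delta> by (simp add: divide_le_eq)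
          thus ?thesis using \<delta> by (simp add: \<epsilon>_def divide_le_eq) (simp add: algebra_simps)
        qed
        define A' where "A' n a b = (if a < (int_sqrt n)\<^sup>2 \<and> b < (int_sqrt n)\<^sup>2
          then W k \<omega> (a, b) / sqrt (real n) else 0)" for n a b
        \<comment> \<open>The bounds for the Hankel sequence are required for sums of
          \<open>2 * n + 1\<close> terms.\<close>
        have double: "filterlim (\<lambda>n::nat. 2 * n + 1) at_top sequentially"
          by (rule filterlim_subseq) (simp add: strict_mono_def)
        have "eventually (\<lambda>n. 8 * B k ^ 4 / sqrt (real n) < \<delta> / 2) sequentially"
          using inverse_sqrt_tendsto_0[of "8 * B k ^ 4"] \<delta> by (intro order_tendstoD(2)) auto
        with elim(4) eventually_compose_filterlim[OF elim(5) double]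
          elim(1)[rule_format, of k] eventually_compose_filterlim[OF elim(2)[rule_format, of k] double]
          eventually_gt_at_top[of 0]
        have "eventually (\<lambda>n. (\<Sum>a<n. \<Sum>b<n. (A n a b - A' n a b)\<^sup>2) / real n \<le> \<delta>) sequentially"
        proof eventually_elim
          case (elim n)
          have "(\<Sum>a<n. \<Sum>b<n. (A n a b - A' n a b)\<^sup>2) / real n
              \<le> 17280 * \<epsilon> k + 8 * B k ^ 4 / sqrt (real n)"
          proof (rule schur_product_perturbation[where x = "\<lambda>t. x t \<omega>" and y = "\<lambda>t. y t \<omega>"
                  and X = "\<lambda>t. X k t \<omega>" and Y = "\<lambda>t. Y k t \<omega>" and A = "A n" and A' = "A' n"
                  and \<epsilon> = "\<epsilon> k" and B = "B k"])
            show "\<bar>X k t \<omega>\<bar> \<le> B k" "\<bar>Y k t \<omega>\<bar> \<le> B k" for t by (rule bounds)+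
            show "A n a b = x (toeplitz_index (a, b)) \<omega> * y (hankel_index (a, b)) \<omega> / sqrt (real n)" for a b
              by (rule A_def)
            show "A' n a b = (if a < (int_sqrt n)\<^sup>2 \<and> b < (int_sqrt n)\<^sup>2
                then X k (toeplitz_index (a, b)) \<omega> * Y k (hankel_index (a, b)) \<omega> / sqrt (real n) else 0)"
              for a b unfolding A'_def W_def by (rule refl)
          qed (rule \<epsilon> elim(1-5))+
          thus ?case using elim(6) k\<delta> by linarith
        qed
        moreover have "\<forall>h. (\<lambda>n. (\<Sum>a<n. mat_power_entry n (A' n) h a a) / real n) \<longlonglongrightarrow> semicircle_moment h"
        proof
          fix h
          show "(\<lambda>n. (\<Sum>a<n. mat_power_entry n (A' n) h a a) / real n) \<longlonglongrightarrow> semicircle_moment h"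
          proof (rule corner_moment_convergence[where W = "W k \<omega>" and A = A'])
            show "(\<lambda>j. (\<Sum>vs\<in>closed_walks (j\<^sup>2) h. walk_weight (W k \<omega>) vs) / real j ^ (h + 2))
                \<longlonglongrightarrow> semicircle_moment h" for h
              by (rule elim(3)[THEN spec, THEN spec])
            show "A' n a b = (if a < (int_sqrt n)\<^sup>2 \<and> b < (int_sqrt n)\<^sup>2
                then W k \<omega> (a, b) / sqrt (real n) else 0)" for n a b
              by (rule A'_def)
          qed
        qed
        moreover have "\<forall>n i j. A' n i j = A' n j i"
        proof (intro allI)
          fix n i j
          show "A' n i j = A' n j i" unfolding A'_def W_def sym[of i j] conj_commute[of "i < _"] ..
        qed
        ultimately show "\<exists>A'. (\<forall>n i j. A' n i j = A' n j i) \<and>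
            eventually (\<lambda>n. (\<Sum>a<n. \<Sum>b<n. (A n a b - A' n a b)\<^sup>2) / real n \<le> \<delta>) sequentially \<and>
            (\<forall>h. (\<lambda>n. (\<Sum>a<n. mat_power_entry n (A' n) h a a) / real n) \<longlonglongrightarrow> semicircle_moment h)"
          by (intro exI[of _ A'] conjI)
      qed
      thus "(\<lambda>n. esd ((1 / sqrt (real n)) \<cdot>\<^sub>m
          schur_product (toeplitz_mat n (\<lambda>t. x t \<omega>)) (hankel_mat n (\<lambda>t. y t \<omega>))) u)
          \<longlonglongrightarrow> cdf semicircle_measure u"
        unfolding scaled_schur_product A_def .
    qed
  qed
  hence "has_lsd M
      (\<lambda>n \<omega>. (1 / sqrt (real n)) \<cdot>\<^sub>m
        schur_product (toeplitz_mat n (\<lambda>t. x t \<omega>)) (hankel_mat n (\<lambda>t. y t \<omega>)))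
      (cdf semicircle_measure)"
    unfolding has_lsd_def
    by (intro conjI exI[of _ semicircle_measure] refl real_distribution_semicircle_measure)
  thus ?thesis
    by (intro exI[of _ semicircle_measure] conjI semicircular_law_semicircle_measure)
qed

end
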